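(* Let $b_1,\dots,b_6$ be complex numbers with $b_1\cdots b_6=q$, such that $b_i/b_j\notin q^{\mathbb Z}$ for $1\le i<j\le 6$ and $b_ib_j\notin q^{\mathbb Z}$ for $1\le i\le j\le 6$. Let $V$ and Rahman's functional $\mathbf J$ on $V$ be as defined in the context. For generic values of $\lambda$ and $\mu$, and every $f\in V$, $$\mathbf J(f)=\frac{(1-\lambda^2)\left\{\theta(\mu b_1,\dots,\mu b_6)-\frac{q}{\mu^2}\,\theta(\mu/b_1,\dots,\mu/b_6)\right\}\prod_{j=1}^6(q\lambda^\pm/b_j)_\infty}{(q)_\infty\,\theta(\lambda^2,\mu^2,\lambda\mu,\mu/\lambda)\prod_{1\leq i<j\leq 6}(q/b_ib_j)_\infty}$$ $$\times\sum_{x=-\infty}^\infty\frac{1-\lambda^2q^{2x}}{1-\lambda^2}\,q^x\prod_{j=1}^6\frac{(\lambda b_j)_x}{(q\lambda/b_j)_x}\;f\left(\frac{\lambda q^x+\lambda^{-1}q^{-x}}2\right)+\mathrm{idem}(\lambda;\mu).$$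
   Context: Throughout, $q$ is a fixed complex number with $0<|q|<1$ (the base $q$ is suppressed from the notation). For $k\in\mathbb Z_{\ge 0}$, $(a)_k=(1-a)(1-aq)\cdots(1-aq^{k-1})$; for $k\in\mathbb Z_{<0}$, $(a)_k=\left((1-aq^{-1})\cdots(1-aq^{k})\right)^{-1}$; $(a)_\infty=\prod_{j=0}^\infty(1-aq^j)$; $\theta(x)=(x)_\infty(q/x)_\infty$. Repeated arguments and $\pm$ denote products, e.g. $(bz^\pm)_k=(bz)_k(b/z)_k$, $(q\lambda^\pm/b)_\infty=(q\lambda/b)_\infty(q\lambda^{-1}/b)_\infty$, $\theta(x,y)=\theta(x)\theta(y)$; $q/b_ib_j$ means $q/(b_ib_j)$. The notation $F(\lambda,\mu)+\mathrm{idem}(\lambda;\mu)$ means $F(\lambda,\mu)+F(\mu,\lambda)$, where $F(\lambda,\mu)$ is the whole preceding expression (prefactor times sum). $V$ is the vector space of rational functions $f$ in the variable $(z+z^{-1})/2$ that are regular, including at infinity (the degree of the numerator does not exceed the degree of the denominator), except for possible single (simple) poles at the points with $z\in b_jq^{\mathbb Z_{<0}}$ or $z^{-1}\in b_jq^{\mathbb Z_{<0}}$, $1\leq j\leq 6$. It is spanned by the functions $(b_1z^\pm)_{k_1}\cdots(b_6z^\pm)_{k_6}$ with $k_j\in\mathbb Z$, $k_1+\dots+k_6=0$. Rahman's functional $\mathbf J$ is the linear functional on $V$ determined by $$\mathbf J\left((b_1z^\pm)_{k_1}\cdots(b_6z^\pm)_{k_6}\right)=\frac{\prod_{1\leq i<j\leq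 6}(b_ib_j)_{k_i+k_j}}{\prod_{j=1}^6q^{\binom{k_j}2}b_j^{k_j}},\qquad k_1+\dots+k_6=0.$$ "Generic" means that $\lambda,\mu$ are nonzero, no factor in a denominator vanishes, and the evaluation points avoid all possible poles of elements of $V$ (so $\lambda^{\pm1},\mu^{\pm1}\notin b_jq^{\mathbb Z}$). *)

theory Defs
  imports
    "HOL-Analysis.Analysis"
    "HOL-Computational_Algebra.Polynomial_Factorial"
    "HOL-Computational_Algebra.Field_as_Ring"
begin

text \<open>Throughout, the parameters \<open>b\<^sub>1, \<dots>, b\<^sub>6\<close> are the values of \<open>b :: nat \<Rightarrow> complex\<close> on \<open>{1..6}\<close>; the other
  values of \<open>b\<close> are never used. The same convention applies to the exponents \<open>k\<^sub>1, \<dots>, k\<^sub>6\<close>.\<close>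


definition qpoch :: "complex \<Rightarrow> complex \<Rightarrow> int \<Rightarrow> complex" where
  "qpoch q a k =
     (if k \<ge> 0 then \<Prod>i<nat k. 1 - a * q ^ i
      else inverse (\<Prod>i\<in>{1..nat (- k)}. 1 - a * q powi (- int i)))"

definition qpoch_inf :: "complex \<Rightarrow> complex \<Rightarrow> complex" where
  "qpoch_inf q a = prodinf (\<lambda>j. 1 - a * q ^ j)"

definition qtheta :: "complex \<Rightarrow> complex \<Rightarrow> complex" where
  "qtheta q x = qpoch_inf q x * qpoch_inf q (q / x)"

definition q_powers :: "complex \<Rightarrow> complex set" where
  "q_powers q = range (\<lambda>k :: int. q powi k)"


text \<open>Rational functions of the variable \<open>X = (z + 1/z) / 2\<close> are elements of
  \<open>complex poly fract\<close>. \<^const>\<open>quot_of_fract\<close> yields the reduced numerator and denominator, so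
  the poles are the roots of the denominator, and the value \<open>eval_rat f x\<close> is the
  value of \<open>f\<close> whenever \<open>x\<close> is not a pole.\<close>

definition eval_rat :: "complex poly fract \<Rightarrow> complex \<Rightarrow> complex" where
  "eval_rat f x = poly (fst (quot_of_fract f)) x / poly (snd (quot_of_fract f)) x"

definition allowed_poles :: "complex \<Rightarrow> (nat \<Rightarrow> complex) \<Rightarrow> complex set" where
  "allowed_poles q b =
     {(z + 1 / z) / 2 | z. z \<noteq> 0 \<and>
        (\<exists>j\<in>{1..6}. \<exists>k::int. k < 0 \<and> (z = b j * q powi k \<or> 1 / z = b j * q powi k))}"

text \<open>Regularity at infinity is the degree condition.\<close>

definition V_space :: "complex \<Rightarrow> (nat \<Rightarrow> complex) \<Rightarrow> complex poly fract set" where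
  "V_space q b =
     {f. degree (fst (quot_of_fract f)) \<le> degree (snd (quot_of_fract f)) \<and>
         (\<forall>x. poly (snd (quot_of_fract f)) x = 0 \<longrightarrow>
            x \<in> allowed_poles q b \<and> order x (snd (quot_of_fract f)) = 1)}"

text \<open>The product \<open>(1 - c z) (1 - c / z) = 1 + c\<^sup>2 - 2 c X\<close> as a polynomial in \<open>X\<close>, and
  \<open>(c z)\<^sub>k (c / z)\<^sub>k\<close> as a rational function of \<open>X\<close>; see \<open>eval_zpm_poch\<close> below.\<close>

definition zpm_factor :: "complex \<Rightarrow> complex poly" where
  "zpm_factor c = [:1 + c\<^sup>2, - 2 * c:]"

definition zpm_poch :: "complex \<Rightarrow> complex \<Rightarrow> int \<Rightarrow> complex poly fract" where
  "zpm_poch q c k =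
     (if k \<ge> 0 then Fract (\<Prod>i<nat k. zpm_factor (c * q ^ i)) 1
      else Fract 1 (\<Prod>i\<in>{1..nat (- k)}. zpm_factor (c * q powi (- int i))))"

lemma eval_rat_Fract:
  assumes "poly d x \<noteq> 0"
  shows "eval_rat (Fract p d) x = poly p x / poly d x"
proof -
  have "d \<noteq> 0" using assms by auto
  define p' d' where "p' = fst (normalize_quot (p, d))" and "d' = snd (normalize_quot (p, d))"
  obtain e where e: "p = p' * e" "d = d' * e"
    using normalize_quotE[OF \<open>d \<noteq> 0\<close>, of p] unfolding p'_def d'_def by metis
  have "quot_of_fract (Fract p d) = normalize_quot (p, d)"
    using quot_of_fract_quot_to_fract[of "(p, d)"] \<open>d \<noteq> 0\<close> by (simp add: quot_to_fract_def)
  then have "eval_rat (Fract p d) x = poly p' x / poly d' x"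
    by (simp add: eval_rat_def p'_def d'_def)
  moreover have "poly p x = poly p' x * poly e x" "poly d x = poly d' x * poly e x"
    by (simp_all only: e poly_mult)
  ultimately show ?thesis using assms by simp
qed

lemma poly_zpm_factor:
  assumes "z \<noteq> 0"
  shows "poly (zpm_factor c) ((z + 1 / z) / 2) = (1 - c * z) * (1 - c / z)"
proof -
  have "(1 - c * z) * (1 - c / z) = 1 - c * z - c / z + (c * z) * (c / z)"
    by (simp only: ring_distribs mult_1_left mult_1_right diff_diff_eq2) simp
  also have "(c * z) * (c / z) = c * c"
    using assms by simp
  also have "1 - c * z - c / z + c * c = poly (zpm_factor c) ((z + 1 / z) / 2)"
    by (simp add: zpm_factor_def power2_eq_square ring_distribs add_divide_distrib)
  finally show ?thesis ..
qed

lemma eval_zpm_poch: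
  assumes "z \<noteq> 0"
    and "\<And>i::int. k \<le> i \<Longrightarrow> i < 0 \<Longrightarrow> c * q powi i * z \<noteq> 1 \<and> c * q powi i / z \<noteq> 1"
  shows "eval_rat (zpm_poch q c k) ((z + 1 / z) / 2) = qpoch q (c * z) k * qpoch q (c / z) k"
proof (cases "k \<ge> 0")
  case True
  define p where "p = (\<Prod>i<nat k. zpm_factor (c * q ^ i))"
  have p: "poly p ((z + 1 / z) / 2) = (\<Prod>i<nat k. (1 - c * q ^ i * z) * (1 - c * q ^ i / z))"
    unfolding p_def poly_prod by (simp only: poly_zpm_factor[OF assms(1)])
  have "eval_rat (zpm_poch q c k) ((z + 1 / z) / 2) = poly p ((z + 1 / z) / 2)"
    using True by (simp add: zpm_poch_def p_def[symmetric] eval_rat_Fract)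
  also have "\<dots> = qpoch q (c * z) k * qpoch q (c / z) k"
    unfolding p using True by (simp add: qpoch_def prod.distrib mult_ac)
  finally show ?thesis .
next
  case False
  define r where "r = (\<lambda>i::nat. q powi (- int i))"
  define d where "d = (\<Prod>i\<in>{1..nat (- k)}. zpm_factor (c * r i))"
  have d: "poly d ((z + 1 / z) / 2) = (\<Prod>i\<in>{1..nat (- k)}. (1 - c * r i * z) * (1 - c * r i / z))"
    unfolding d_def poly_prod by (simp only: poly_zpm_factor[OF assms(1)])
  have "(1 - c * r i * z) * (1 - c * r i / z) \<noteq> 0" if "i \<in> {1..nat (- k)}" for i
  proof -
    have "k \<le> - int i" "- int i < 0" using that False by auto
    from assms(2)[OF this] show ?thesis unfolding r_def by (simp only: mult_eq_0_iff) auto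
  qed
  then have "poly d ((z + 1 / z) / 2) \<noteq> 0"
    unfolding d by (simp only: prod_zero_iff finite_atLeastAtMost) blast
  then have "eval_rat (zpm_poch q c k) ((z + 1 / z) / 2) = inverse (poly d ((z + 1 / z) / 2))"
    using False eval_rat_Fract[of d "(z + 1 / z) / 2" 1]
    by (simp only: zpm_poch_def d_def[unfolded r_def, symmetric] if_False poly_1 inverse_eq_divide
        simp_thms)
  also have "\<dots> = inverse (\<Prod>i\<in>{1..nat (- k)}. 1 - c * z * r i) *
      inverse (\<Prod>i\<in>{1..nat (- k)}. 1 - c / z * r i)"
    unfolding d prod.distrib by (simp add: mult_ac)
  also have "\<dots> = qpoch q (c * z) k * qpoch q (c / z) k"
    using False by (simp only: qpoch_def if_False r_def)
  finally show ?thesis .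
qed

definition V_gen :: "complex \<Rightarrow> (nat \<Rightarrow> complex) \<Rightarrow> (nat \<Rightarrow> int) \<Rightarrow> complex poly fract" where
  "V_gen q b k = (\<Prod>j\<in>{1..6}. zpm_poch q (b j) (k j))"

definition rahman_functional ::
    "complex \<Rightarrow> (nat \<Rightarrow> complex) \<Rightarrow> (complex poly fract \<Rightarrow> complex) \<Rightarrow> bool" where
  "rahman_functional q b J \<longleftrightarrow>
     (\<forall>f\<in>V_space q b. \<forall>g\<in>V_space q b. J (f + g) = J f + J g) \<and>
     (\<forall>c. \<forall>f\<in>V_space q b. J (to_fract [:c:] * f) = c * J f) \<and>
     (\<forall>k. (\<Sum>j\<in>{1..6}. k j) = 0 \<longrightarrow>
        J (V_gen q b k) =
          (\<Prod>i\<in>{1..6}. \<Prod>j\<in>{i<..6}. qpoch q (b i * b j) (k i + k j)) /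
          (\<Prod>j\<in>{1..6}. q powi (k j * (k j - 1) div 2) * b j powi (k j)))"

text \<open>Only the values on \<^const>\<open>V_space\<close> are meaningful; requiring the value \<open>0\<close> elsewhere
  makes the total function unique.\<close>

definition rahman_J :: "complex \<Rightarrow> (nat \<Rightarrow> complex) \<Rightarrow> complex poly fract \<Rightarrow> complex" where
  "rahman_J q b = (THE J. rahman_functional q b J \<and> (\<forall>f. f \<notin> V_space q b \<longrightarrow> J f = 0))"


text \<open>The theta conditions cover the denominators of both halves of the formula (the second one
  contains \<open>\<theta>(\<lambda>/\<mu>)\<close>) and imply \<open>\<lambda>\<^sup>2 \<noteq> 1 \<noteq> \<mu>\<^sup>2\<close>. The last condition also takes care of
  the denominators of \<open>(\<lambda> b\<^sub>j)\<^sub>x / (q \<lambda> / b\<^sub>j)\<^sub>x\<close>.\<close>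

definition generic :: "complex \<Rightarrow> (nat \<Rightarrow> complex) \<Rightarrow> complex \<Rightarrow> complex \<Rightarrow> bool" where
  "generic q b l m \<longleftrightarrow>
     l \<noteq> 0 \<and> m \<noteq> 0 \<and>
     qtheta q (l\<^sup>2) \<noteq> 0 \<and> qtheta q (m\<^sup>2) \<noteq> 0 \<and> qtheta q (l * m) \<noteq> 0 \<and>
     qtheta q (m / l) \<noteq> 0 \<and> qtheta q (l / m) \<noteq> 0 \<and>
     (\<forall>j\<in>{1..6}. \<forall>k::int. b j * q powi k \<notin> {l, 1 / l, m, 1 / m})"

definition prefactor :: "complex \<Rightarrow> (nat \<Rightarrow> complex) \<Rightarrow> complex \<Rightarrow> complex \<Rightarrow> complex" where
  "prefactor q b l m =
     (1 - l\<^sup>2) *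
     ((\<Prod>j\<in>{1..6}. qtheta q (m * b j)) - q / m\<^sup>2 * (\<Prod>j\<in>{1..6}. qtheta q (m / b j))) *
     (\<Prod>j\<in>{1..6}. qpoch_inf q (q * l / b j) * qpoch_inf q (q * inverse l / b j)) /
     (qpoch_inf q q *
      (qtheta q (l\<^sup>2) * qtheta q (m\<^sup>2) * qtheta q (l * m) * qtheta q (m / l)) *
      (\<Prod>i\<in>{1..6}. \<Prod>j\<in>{i<..6}. qpoch_inf q (q / (b i * b j))))"

definition series_term ::
    "complex \<Rightarrow> (nat \<Rightarrow> complex) \<Rightarrow> complex poly fract \<Rightarrow> complex \<Rightarrow> int \<Rightarrow> complex" where
  "series_term q b f l x =
     (1 - l\<^sup>2 * q powi (2 * x)) / (1 - l\<^sup>2) * q powi x *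
     (\<Prod>j\<in>{1..6}. qpoch q (l * b j) x / qpoch q (q * l / b j) x) *
     eval_rat f ((l * q powi x + inverse l * q powi (- x)) / 2)"

end

theory Submission
  imports Defs "HOL-Complex_Analysis.Complex_Analysis" "HOL-Computational_Algebra.Fundamental_Theorem_Algebra"
begin

text \<open>The functional and the two series are compared on generators of the space.

Two of the six parameters already suffice to span it: over a common denominator an element is a
polynomial of degree at most \<open>6 n\<close>, and the products \<open>(c z\<^bsup>\<plusminus>\<^esup>)\<^bsub>m\<^esub> (d z\<^bsup>\<plusminus>\<^esup>)\<^bsub>6 n - m\<^esub>\<close> span these
polynomials (\<open>poly_zpm_induct\<close>). So a linear functional is determined by its values on the generators, and it
remains to evaluate the right-hand side on each of them; this also proves that the functional
exists. In the summand of the series, a generator amounts to the replacement of every \<open>b\<^sub>j\<close> by \<open>b\<^sub>j q\<^bsup>k\<^sub>j\<^esup>\<close>,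
up to explicit factors (\<open>weight_G_shifted\<close>, \<open>theta_bracket_shifted\<close>, \<open>pair_product_shifted\<close>), and these
factors combine to the prescribed value. Everything is thereby reduced to \<open>f = 1\<close>.

With \<open>G(z) = \<Prod>\<^sub>j (q z\<^bsup>\<plusminus>\<^esup> / b\<^sub>j)\<^bsub>\<infinity>\<^esub>\<close> the series for \<open>f = 1\<close> becomes, up to a factor,
\<open>S(\<lambda>) = \<Sum>\<^bsub>x\<^esub> (1 - \<lambda>\<^bsup>2\<^esup> q\<^bsup>2x\<^esup>) \<lambda>\<^bsup>6x\<^esup> q\<^bsup>3x^2 - x\<^esup> G(\<lambda> q\<^bsup>x\<^esup>)\<close>. It is holomorphic for \<open>\<lambda> \<noteq> 0\<close>, so that it may be
evaluated at the exceptional points as well. Let \<open>P\<close> denote the bracket in the prefactor. The claim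
is then \<open>\<lambda> S(\<lambda>) P(\<mu>) - \<mu> S(\<mu>) P(\<lambda>) = \<lambda> \<theta>(\<lambda>\<^bsup>2\<^esup>, \<mu>\<^bsup>2\<^esup>, \<lambda> \<mu>, \<mu> / \<lambda>) (q)\<^bsub>\<infinity>\<^esub> \<Prod>\<^bsub>i < j\<^esub> (q / b\<^sub>i b\<^sub>j)\<^bsub>\<infinity>\<^esub>\<close>. Both
\<open>\<lambda> S(\<lambda>)\<close> and \<open>P(\<lambda>)\<close> obey the same functional equations under \<open>\<lambda> \<mapsto> q \<lambda>\<close> and \<open>\<lambda> \<mapsto> 1 / \<lambda>\<close>, and counting zeros of
theta functions shows that such a determinant is a multiple of the theta factor, with a
multiplier independent of \<open>\<lambda>\<close> and \<open>\<mu>\<close> (\<open>BC_theta_two_values\<close>). It remains to find the multiplier, that is, to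
show that the difference of the two sides, called the defect, vanishes.

The defect vanishes if \<open>b\<^sub>1 b\<^sub>2\<close> is a power of \<open>q\<close>. For a positive power \<open>S\<close> and \<open>P\<close> both vanish at \<open>b\<^sub>1\<close>;
for \<open>b\<^sub>1 b\<^sub>2 = 1\<close> a single term of \<open>S(b\<^sub>1)\<close> survives; a linear relation between three parameter sets that
differ by shifts (\<open>defect_contiguous\<close>) leads from there to the negative powers. Finally let \<open>b\<^sub>1 = t\<close> vary while
\<open>b\<^sub>1 b\<^sub>2\<close> is fixed. The defect is holomorphic in \<open>t \<noteq> 0\<close> and grows like a product of four theta functions,
yet it vanishes on five classes modulo \<open>q\<^bsup>\<int>\<^esup>\<close>, namely where \<open>t b\<^sub>j\<close> for \<open>j = 3, ..., 6\<close> or \<open>b\<^sub>2 b\<^sub>3\<close> is a power of \<open>q\<close>.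
This is one class too many (\<open>theta_growth_too_many_zeros\<close>). The fifth class differs from the others
only if \<open>b\<^sub>1 b\<^sub>2 b\<^sub>3\<^bsup>2\<^esup>\<close> is not a power of \<open>q\<close>; if it is, \<open>b\<^sub>2\<close> and \<open>b\<^sub>3\<close> are exchanged first. This helps, because
\<open>b\<^sub>2 / b\<^sub>3\<close> would be a power of \<open>q\<close> if both orders failed.\<close>

section \<open>Infinite products and theta functions\<close>

locale q_base =
  fixes q :: complex
  assumes q_pos: "0 < norm q" and q_less_1: "norm q < 1"
begin

lemma q_nonzero [simp]: "q \<noteq> 0"
  using q_pos by auto

abbreviation phi :: "complex \<Rightarrow> complex" where "phi \<equiv> qpoch_inf q"
abbreviation theta :: "complex \<Rightarrow> complex" where "theta \<equiv> qtheta q"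

text \<open>A majorant of the infinite product on a circle; it is increasing in the radius.\<close>

definition phi_bound :: "real \<Rightarrow> real" where
  "phi_bound r = prodinf (\<lambda>j. 1 + r * norm q ^ j)"

lemma summable_q_power: "summable (\<lambda>j. c * norm q ^ j)"
  using q_less_1 by (intro summable_mult summable_geometric) simp

lemma convergent_prod_phi: "convergent_prod (\<lambda>j. 1 - a * q ^ j)"
  by (rule abs_convergent_prod_imp_convergent_prod,
      rule summable_imp_abs_convergent_prod)
     (simp add: norm_mult norm_power q_less_1)

lemma convergent_prod_phi_bound: "convergent_prod (\<lambda>j. 1 + r * norm q ^ j)" for r :: real
proof (rule abs_convergent_prod_imp_convergent_prod, rule summable_imp_abs_convergent_prod)
  show "summable (\<lambda>j. norm (1 + r * norm q ^ j - 1))"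
    using summable_q_power[of "\<bar>r\<bar>"] by (simp add: abs_mult)
qed

lemma phi_split: "phi a = (\<Prod>i<n. 1 - a * q ^ i) * phi (a * q ^ n)"
  using has_prod_unique[OF has_prod_ignore_initial_segment'[OF convergent_prod_phi[of a], of n]]
  by (simp add: qpoch_inf_def power_add mult_ac)

lemma phi_rec: "phi a = (1 - a) * phi (a * q)"
  using phi_split[of a 1] by simp

lemma phi_eq_0_iff: "phi a = 0 \<longleftrightarrow> (\<exists>j::nat. a * q ^ j = 1)"
proof
  assume "phi a = 0"
  then have "\<exists>j. 1 - a * q ^ j = 0"
    unfolding qpoch_inf_def using prodinf_nonzero[OF convergent_prod_phi[of a]] by blast
  then show "\<exists>j::nat. a * q ^ j = 1" by (metis eq_iff_diff_eq_0)
next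
  assume "\<exists>j::nat. a * q ^ j = 1"
  then obtain j where "a * q ^ j = 1" by blast
  then have "(\<Prod>i<Suc j. 1 - a * q ^ i) = 0" by simp
  then show "phi a = 0" using phi_split[of a "Suc j"] by simp
qed

lemma phi_bound_split: "phi_bound r = (\<Prod>i<n. 1 + r * norm q ^ i) * phi_bound (r * norm q ^ n)"
  using has_prod_unique[OF has_prod_ignore_initial_segment'[OF convergent_prod_phi_bound[of r], of n]]
  by (simp add: phi_bound_def power_add mult_ac)

lemma phi_bound_ge_1: "1 \<le> phi_bound r" if "0 \<le> r"
  unfolding phi_bound_def
  using that by (intro prodinf_nonneg[OF convergent_prod_has_prod[OF convergent_prod_phi_bound]]) simp

lemma phi_bound_mono: "phi_bound r \<le> phi_bound s" if "0 \<le> r" "r \<le> s"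
  unfolding phi_bound_def using that
  by (intro prodinf_le[OF convergent_prod_has_prod[OF convergent_prod_phi_bound]
        convergent_prod_has_prod[OF convergent_prod_phi_bound]])
     (auto intro!: mult_right_mono add_nonneg_nonneg)

lemma norm_one_minus_le: "norm (1 - a * q ^ i) \<le> 1 + norm a * norm q ^ i"
  using norm_triangle_ineq4[of 1 "a * q ^ i"] by (simp add: norm_mult norm_power)

lemma norm_partial_prod_le: "norm (\<Prod>i<n. 1 - a * q ^ i) \<le> (\<Prod>i<n. 1 + norm a * norm q ^ i)"
  unfolding prod_norm[symmetric] by (intro prod_mono conjI norm_ge_zero norm_one_minus_le)

lemma norm_phi_le: "norm (phi a) \<le> phi_bound (norm a)"
proof (rule LIMSEQ_le)
  show "(\<lambda>n. norm (\<Prod>i\<le>n. 1 - a * q ^ i)) \<longlonglongrightarrow> norm (phi a)"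
    unfolding qpoch_inf_def by (intro tendsto_norm convergent_prod_LIMSEQ convergent_prod_phi)
  show "(\<lambda>n. \<Prod>i\<le>n. 1 + norm a * norm q ^ i) \<longlonglongrightarrow> phi_bound (norm a)"
    unfolding phi_bound_def by (intro convergent_prod_LIMSEQ convergent_prod_phi_bound)
  show "\<exists>N. \<forall>n\<ge>N. norm (\<Prod>i\<le>n. 1 - a * q ^ i) \<le> (\<Prod>i\<le>n. 1 + norm a * norm q ^ i)"
    using norm_partial_prod_le[of a "Suc _"] by (simp add: lessThan_Suc_atMost)
qed

text \<open>A finite factor at one argument and an infinite tail at another, of comparable size, together
  cost only one factor \<^const>\<open>phi_bound\<close>. This saving is what makes the growth of the bilateral
  series in its parameters small enough.\<close>

lemma norm_partial_prod_times_phi_le: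
  assumes "norm a \<le> r" "norm c \<le> r"
  shows "norm (\<Prod>i<n. 1 - a * q ^ i) * norm (phi (c * q ^ n)) \<le> phi_bound r"
proof -
  have r: "0 \<le> r" using assms(1) norm_ge_zero order_trans by blast
  have "norm (\<Prod>i<n. 1 - a * q ^ i) \<le> (\<Prod>i<n. 1 + r * norm q ^ i)"
    using norm_partial_prod_le[of a n]
    by (rule order_trans) (auto intro!: prod_mono mult_right_mono assms add_nonneg_nonneg)
  moreover have "norm (phi (c * q ^ n)) \<le> phi_bound (r * norm q ^ n)"
    using norm_phi_le[of "c * q ^ n"]
    by (rule order_trans) (auto simp: norm_mult norm_power intro!: phi_bound_mono mult_right_mono assms)
  ultimately show ?thesis
    unfolding phi_bound_split[of r n] using r
    by (intro mult_mono prod_nonneg) auto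
qed

lemma holomorphic_phi_UNIV: "phi holomorphic_on UNIV"
proof -
  have "phi field_differentiable at a" for a
  proof -
    define R where "R = norm a + 1"
    have unif: "uniformly_convergent_on (cball 0 R) (\<lambda>N x. \<Prod>n<N. 1 - x * q ^ n)"
    proof (rule uniformly_convergent_on_prod')
      show "uniformly_convergent_on (cball 0 R) (\<lambda>N x. \<Sum>n<N. norm (1 - x * q ^ n - 1))"
      proof (rule Weierstrass_m_test')
        show "norm (norm (1 - x * q ^ n - 1)) \<le> R * norm q ^ n" if "x \<in> cball 0 R" for n x
          using that by (auto simp: norm_mult norm_power intro!: mult_right_mono)
      qed (rule summable_q_power)
    qed (auto intro!: continuous_intros)
    have lim: "uniform_limit (cball 0 R) (\<lambda>N x. \<Prod>n<N. 1 - x * q ^ n) phi sequentially"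
    proof -
      have "uniform_limit (cball 0 R) (\<lambda>N x. \<Prod>n<N. 1 - x * q ^ n)
              (\<lambda>x. lim (\<lambda>N. \<Prod>n<N. 1 - x * q ^ n)) sequentially"
        using unif uniformly_convergent_uniform_limit_iff by blast
      moreover have "lim (\<lambda>N. \<Prod>n<N. 1 - x * q ^ n) = phi x" for x
        using convergent_prod_LIMSEQ[OF convergent_prod_phi[of x]]
        by (simp add: LIMSEQ_lessThan_iff_atMost[of "\<lambda>N. \<Prod>n\<in>N. 1 - x * q ^ n"] qpoch_inf_def limI)
      ultimately show ?thesis by simp
    qed
    have "phi holomorphic_on ball 0 R"
      by (rule holomorphic_uniform_limit[OF _ lim])
         (auto intro!: always_eventually continuous_intros holomorphic_intros)
    moreover have "a \<in> ball 0 R" by (simp add: R_def)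
    ultimately show ?thesis
      by (metis at_within_open holomorphic_on_def open_ball)
  qed
  then show ?thesis by (simp add: holomorphic_on_def field_differentiable_at_within)
qed

lemma holomorphic_phi [holomorphic_intros]:
  "f holomorphic_on S \<Longrightarrow> (\<lambda>z. phi (f z)) holomorphic_on S"
  using holomorphic_on_compose_gen[OF _ holomorphic_phi_UNIV, of f S] by (simp add: o_def)

lemma holomorphic_theta [holomorphic_intros]:
  "f holomorphic_on S \<Longrightarrow> (\<And>z. z \<in> S \<Longrightarrow> f z \<noteq> 0) \<Longrightarrow> (\<lambda>z. theta (f z)) holomorphic_on S"
  unfolding qtheta_def by (intro holomorphic_intros) auto

lemma theta_q: "theta (q * x) = - theta x / x" if "x \<noteq> 0"
proof -
  have "phi (1 / x) = (1 - 1 / x) * phi (q / x)"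
    using phi_rec[of "1 / x"] by simp
  then have "theta (q * x) = phi (x * q) * ((1 - 1 / x) * phi (q / x))"
    using that by (simp add: qtheta_def mult.commute)
  also have "\<dots> = - ((1 - x) * phi (x * q)) * phi (q / x) / x"
    using that by (simp add: field_simps)
  finally show ?thesis by (simp add: qtheta_def phi_rec[of x, symmetric])
qed

lemma theta_inverse: "theta (1 / x) = - theta x / x" if "x \<noteq> 0"
  using theta_q[OF that] that by (simp add: qtheta_def mult.commute)

lemma theta_mult_q_power: "theta (x * q ^ n) = (- 1 / x) ^ n / q ^ (n choose 2) * theta x"
  if "x \<noteq> 0"
proof (induction n)
  case (Suc n)
  have "theta (x * q ^ Suc n) = - theta (x * q ^ n) / (x * q ^ n)"
    using theta_q[of "x * q ^ n"] that by (simp add: mult_ac)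
  then show ?case unfolding Suc using that
    by (simp add: numeral_2_eq_2 power_add field_simps)
qed (simp add: numeral_2_eq_2)

lemma theta_div_q_power: "theta (x / q ^ n) = (- x / q) ^ n / q ^ (n choose 2) * theta x"
  if "x \<noteq> 0"
proof (induction n)
  case (Suc n)
  have "theta (x / q ^ n) = - theta (x / q ^ Suc n) / (x / q ^ Suc n)"
    using theta_q[of "x / q ^ Suc n"] that by (simp add: mult_ac)
  then have "theta (x / q ^ Suc n) = - (x / q ^ Suc n) * theta (x / q ^ n)"
    using that by (simp add: field_simps)
  then show ?case unfolding Suc using that
    by (simp add: numeral_2_eq_2 power_add field_simps)
qed (simp add: numeral_2_eq_2)

lemma q_powersI: "x = q powi k \<Longrightarrow> x \<in> q_powers q"
  by (auto simp: q_powers_def)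

lemma q_powers_mult_iff: "x * q powi k \<in> q_powers q \<longleftrightarrow> x \<in> q_powers q"
proof
  assume "x * q powi k \<in> q_powers q"
  then obtain j where "x * q powi k = q powi j" by (auto simp: q_powers_def)
  then have "x = q powi (j - k)" by (simp add: power_int_diff field_simps)
  then show "x \<in> q_powers q" by (rule q_powersI)
next
  assume "x \<in> q_powers q"
  then obtain j where "x = q powi j" by (auto simp: q_powers_def)
  then have "x * q powi k = q powi (j + k)" by (simp add: power_int_add)
  then show "x * q powi k \<in> q_powers q" by (rule q_powersI)
qed

lemma q_powers_inverse_iff: "1 / x \<in> q_powers q \<longleftrightarrow> x \<in> q_powers q"
proof -
  have "1 / y \<in> q_powers q" if "y \<in> q_powers q" for y
  proof -
    from that obtain j where "y = q powi j" by (auto simp: q_powers_def)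
    then have "1 / y = q powi (- j)" by (simp add: power_int_minus field_simps)
    then show ?thesis by (rule q_powersI)
  qed
  from this[of x] this[of "1/x"] show ?thesis by auto
qed

lemma q_powers_mult: "x \<in> q_powers q \<Longrightarrow> y \<in> q_powers q \<Longrightarrow> x * y \<in> q_powers q"
  using q_powers_mult_iff by (auto simp: q_powers_def)

lemma q_powers_divide: "x \<in> q_powers q \<Longrightarrow> y \<in> q_powers q \<Longrightarrow> x / y \<in> q_powers q"
  using q_powers_mult[of x "1 / y"] q_powers_inverse_iff[of y] by simp

lemma q_power_in_q_powers [simp]: "q ^ n \<in> q_powers q" "q \<in> q_powers q" "1 \<in> q_powers q"
  using q_powersI[of "q ^ n" "int n"] q_powersI[of q 1] q_powersI[of 1 0] by auto

lemma q_power_eq_1_iff: "q ^ n = 1 \<longleftrightarrow> n = 0"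
proof
  assume "q ^ n = 1"
  then have "norm q ^ n = 1" by (metis norm_power norm_one)
  then show "n = 0" 
    using power_Suc_less_one[OF q_pos q_less_1, of "n - 1"] by (cases n) auto
qed simp

lemma q_powi_eq_1_iff: "q powi n = 1 \<longleftrightarrow> n = 0"
proof (cases n)
  case (nonneg m) then show ?thesis by (simp add: q_power_eq_1_iff)
next
  case (neg m) 
  have "q powi n = inverse (q ^ Suc m)" unfolding neg by (simp only: power_int_minus power_int_of_nat)
  then show ?thesis using neg q_power_eq_1_iff[of "Suc m"] by (simp del: power_Suc)
qed

lemma theta_eq_0_iff: "theta x = 0 \<longleftrightarrow> x \<in> q_powers q" if "x \<noteq> 0"
proof
  assume "theta x = 0"
  then obtain j :: nat where "x * q ^ j = 1 \<or> q / x * q ^ j = 1"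
    unfolding qtheta_def mult_eq_0_iff phi_eq_0_iff by blast
  then consider "x = 1 / q ^ j" | "x = q ^ Suc j"
    using that by (auto simp: field_simps)
  then show "x \<in> q_powers q" 
    by cases (simp_all add: q_powers_inverse_iff del: power_Suc)
next
  assume "x \<in> q_powers q"
  then obtain k where k: "x = q powi k" by (auto simp: q_powers_def)
  show "theta x = 0"
  proof (cases "k \<le> 0")
    case True
    then have "x * q ^ nat (- k) = 1"
      unfolding k by (simp add: power_int_def power_inverse)
    then show ?thesis by (auto simp: qtheta_def phi_eq_0_iff)
  next
    case False
    then have "k = 1 + int (nat (k - 1))" by simp
    then have "x = q * q ^ nat (k - 1)"
      unfolding k by (metis power_Suc power_int_of_nat of_nat_Suc)
    then have "q / x * q ^ nat (k - 1) = 1" using that by simp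
    then show ?thesis by (auto simp: qtheta_def phi_eq_0_iff)
  qed
qed

end

section \<open>Growth and zeros of holomorphic functions on the punctured plane\<close>

text \<open>At a common zero \<open>a\<close> both functions are divided by \<open>z - a\<close>; a simple zero of
  the denominator leaves a quotient with nonvanishing denominator there.\<close>

lemma holomorphic_quotient:
  fixes f g :: "complex \<Rightarrow> complex"
  assumes S: "open S" and f: "f holomorphic_on S" and g: "g holomorphic_on S"
    and zeros: "\<And>z. z \<in> S \<Longrightarrow> g z = 0 \<Longrightarrow> f z = 0 \<and> deriv g z \<noteq> 0"
  shows "\<exists>h. h holomorphic_on S \<and> (\<forall>z\<in>S. f z = g z * h z)"
proof -
  define h where "h = (\<lambda>z. if g z = 0 then deriv f z / deriv g z else f z / g z)"
  have "h field_differentiable at a" if a: "a \<in> S" for a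
  proof (cases "g a = 0")
    case False
    have "continuous_on S g" using g by (rule holomorphic_on_imp_continuous_on)
    then have op: "open {z \<in> S. g z \<noteq> 0}"
      using continuous_open_preimage[of S g "- {0}"] S by (simp add: open_Compl vimage_def Int_def)
    have "(\<lambda>z. f z / g z) holomorphic_on {z \<in> S. g z \<noteq> 0}"
      by (intro holomorphic_on_divide holomorphic_on_subset[OF f] holomorphic_on_subset[OF g]) auto
    then have "h holomorphic_on {z \<in> S. g z \<noteq> 0}"
      by (rule holomorphic_transform) (simp add: h_def)
    then show ?thesis
      using op a False by (intro holomorphic_on_imp_differentiable_at[of h "{z \<in> S. g z \<noteq> 0}" a]) auto
  next
    case True
    with zeros a have fa: "f a = 0" and dg: "deriv g a \<noteq> 0" by auto
    define F where "F = (\<lambda>z. if z = a then deriv f a else (f z - f a) / (z - a))"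
    define G where "G = (\<lambda>z. if z = a then deriv g a else (g z - g a) / (z - a))"
    have F: "F holomorphic_on S" and G: "G holomorphic_on S"
      unfolding F_def G_def by (intro pole_lemma_open f g S)+
    have "continuous_on S G" using G by (rule holomorphic_on_imp_continuous_on)
    then have op: "open {z \<in> S. G z \<noteq> 0}"
      using continuous_open_preimage[of S G "- {0}"] S by (simp add: open_Compl vimage_def Int_def)
    have "(\<lambda>z. F z / G z) holomorphic_on {z \<in> S. G z \<noteq> 0}"
      by (intro holomorphic_on_divide holomorphic_on_subset[OF F] holomorphic_on_subset[OF G]) auto
    moreover have "F z / G z = h z" if "z \<in> {z \<in> S. G z \<noteq> 0}" for z
      using that by (auto simp: F_def G_def h_def fa True)
    ultimately have "h holomorphic_on {z \<in> S. G z \<noteq> 0}"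
      by (rule holomorphic_transform)
    then show ?thesis
      using op a dg by (intro holomorphic_on_imp_differentiable_at[of h "{z \<in> S. G z \<noteq> 0}" a]) (auto simp: G_def)
  qed
  then have "h holomorphic_on S"
    by (simp add: holomorphic_on_def field_differentiable_at_within)
  moreover have "\<forall>z\<in>S. f z = g z * h z"
    using zeros by (auto simp: h_def)
  ultimately show ?thesis by blast
qed

context q_base
begin

lemma theta_holomorphic_punctured: "theta holomorphic_on - {0}"
  by (rule holomorphic_theta[of "\<lambda>z. z", simplified]) auto

lemma theta_differentiable: "theta field_differentiable at x" if "x \<noteq> 0"
  using holomorphic_on_imp_differentiable_at[OF theta_holomorphic_punctured] that
  by (simp add: open_Compl)

lemma deriv_theta_1: "deriv theta 1 \<noteq> 0"
proof -
  have phi_q: "phi q \<noteq> 0"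
    using q_power_eq_1_iff[of "Suc _"] by (auto simp: phi_eq_0_iff)
  have dphi: "phi field_differentiable at x" for x
    using holomorphic_phi_UNIV by (simp add: holomorphic_on_def)
  define g where "g = (\<lambda>x. phi (x * q) * phi (q / x))"
  have "g holomorphic_on - {0}"
    unfolding g_def by (intro holomorphic_intros) auto
  then have "g field_differentiable at 1"
    by (rule holomorphic_on_imp_differentiable_at) (auto simp: open_Compl)
  then obtain g' where "(g has_field_derivative g') (at 1)"
    by (auto simp: field_differentiable_def)
  then have "((\<lambda>x. (1 - x) * g x) has_field_derivative - g 1) (at 1)"
    by (auto intro!: derivative_eq_intros)
  moreover have "theta = (\<lambda>x. (1 - x) * g x)"
    by (rule ext) (simp add: qtheta_def g_def phi_rec[symmetric] mult.assoc[symmetric])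
  ultimately have "deriv theta 1 = - g 1" by (simp add: DERIV_imp_deriv)
  then show ?thesis using phi_q by (simp add: g_def)
qed

lemma deriv_theta_q: "deriv theta (q * x) \<noteq> 0 \<longleftrightarrow> deriv theta x \<noteq> 0"
  if "theta x = 0" "x \<noteq> 0"
proof -
  have "(theta has_field_derivative deriv theta (q * x)) (at (q * x))"
    using theta_differentiable[of "q * x"] that by (simp add: DERIV_deriv_iff_field_differentiable)
  then have "((\<lambda>y. theta (q * y)) has_field_derivative deriv theta (q * x) * q) (at x)"
    by (rule DERIV_chain2[where g = "\<lambda>y. q * y"]) (auto intro!: derivative_eq_intros)
  moreover have "((\<lambda>y. theta (q * y)) has_field_derivative - deriv theta x / x) (at x)"
  proof (rule has_field_derivative_transform_within_open[of _ _ _ "- {0}"])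
    have "(theta has_field_derivative deriv theta x) (at x)"
      using theta_differentiable[OF that(2)] by (simp add: DERIV_deriv_iff_field_differentiable)
    then show "((\<lambda>y. - theta y / y) has_field_derivative - deriv theta x / x) (at x)"
      using that by (auto intro!: derivative_eq_intros)
  qed (use that in \<open>auto simp: theta_q\<close>)
  ultimately have "deriv theta (q * x) * q = - deriv theta x / x"
    by (rule DERIV_unique)
  then show ?thesis using that by (auto simp: field_simps)
qed

text \<open>All zeros of the theta function are simple: this holds at the zero \<open>1\<close>, and the functional
  equation \<open>\<theta>(q x) = - \<theta>(x) / x\<close> carries it to the others.\<close>

lemma deriv_theta_nonzero:
  assumes "theta x = 0" "x \<noteq> 0"
  shows "deriv theta x \<noteq> 0"
proof -
  obtain k where k: "x = q powi k"
    using assms by (auto simp: theta_eq_0_iff q_powers_def)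
  have zero: "theta (q powi j) = 0" for j
    using q_powersI[of "q powi j" j] by (simp add: theta_eq_0_iff)
  have "deriv theta (q powi k) \<noteq> 0"
  proof (induction k rule: int_induct[of _ 0])
    case base then show ?case by (simp add: deriv_theta_1)
  next
    case (step1 i)
    then show ?case using deriv_theta_q[OF zero[of i]] by (simp add: power_int_add mult.commute)
  next
    case (step2 i)
    then show ?case using deriv_theta_q[OF zero[of "i - 1"]] by (simp add: power_int_diff)
  qed
  then show ?thesis by (simp add: k)
qed

text \<open>The zeros of the theta function are simple and form one class modulo
  \<open>q\<^bsup>\<int>\<^esup>\<close>, so a function with zeros on that class can be divided.\<close>

lemma theta_division:
  assumes f: "f holomorphic_on - {0}" and a: "a \<noteq> 0" and zero: "\<And>k. f (a * q powi k) = 0"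
  obtains h where "h holomorphic_on - {0}" "\<And>t. t \<noteq> 0 \<Longrightarrow> f t = theta (t / a) * h t"
proof -
  have "(\<lambda>t. theta (t / a)) holomorphic_on - {0}"
    using a by (intro holomorphic_intros) auto
  moreover have "f z = 0 \<and> deriv (\<lambda>t. theta (t / a)) z \<noteq> 0"
    if z: "z \<in> - {0}" and "theta (z / a) = 0" for z
  proof
    from that a obtain k where "z / a = q powi k" by (auto simp: theta_eq_0_iff q_powers_def)
    with a have "z = a * q powi k" by (simp add: field_simps)
    with zero show "f z = 0" by simp
    have "(theta has_field_derivative deriv theta (z / a)) (at (z / a))"
      using theta_differentiable[of "z / a"] z a by (simp add: DERIV_deriv_iff_field_differentiable)
    then have "((\<lambda>t. theta (t / a)) has_field_derivative deriv theta (z / a) * (1 / a)) (at z)"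
      by (rule DERIV_chain2[where g = "\<lambda>t. t / a"]) (use a in \<open>auto intro!: derivative_eq_intros\<close>)
    then show "deriv (\<lambda>t. theta (t / a)) z \<noteq> 0"
      using deriv_theta_nonzero[of "z / a"] that a by (simp add: DERIV_imp_deriv)
  qed
  ultimately obtain h where "h holomorphic_on - {0}" "\<forall>z\<in>- {0}. f z = theta (z / a) * h z"
    using holomorphic_quotient[OF _ f, of "\<lambda>t. theta (t / a)"] by (auto simp: open_Compl)
  then show ?thesis using that by simp
qed

lemma theta_product_division:
  assumes "finite A" and "0 \<notin> A" and "f holomorphic_on - {0}"
    and "\<And>a k. a \<in> A \<Longrightarrow> f (a * q powi k) = 0"
    and "\<And>a b. a \<in> A \<Longrightarrow> b \<in> A \<Longrightarrow> a \<noteq> b \<Longrightarrow> a / b \<notin> q_powers q"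
  obtains h where "h holomorphic_on - {0}" "\<And>t. t \<noteq> 0 \<Longrightarrow> f t = (\<Prod>a\<in>A. theta (t / a)) * h t"
  using assms
proof (induction A arbitrary: f thesis rule: finite_induct)
  case empty
  then show ?case by (metis mult_1_left prod.empty)
next
  case (insert a A)
  obtain g where g: "g holomorphic_on - {0}" "\<And>t. t \<noteq> 0 \<Longrightarrow> f t = theta (t / a) * g t"
    using theta_division[OF insert.prems(3), of a] insert.prems(2,4) by auto
  have "g (b * q powi k) = 0" if "b \<in> A" for b k
  proof -
    have "b \<noteq> 0" using that insert.prems(2) by auto
    moreover have "b / a \<notin> q_powers q" using insert.prems(5)[of b a] that insert.hyps by auto
    then have "b * q powi k / a \<notin> q_powers q"
      using q_powers_mult_iff[of "b / a" k] by simp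
    moreover have "f (b * q powi k) = 0" using insert.prems(4) that by auto
    ultimately show ?thesis
      using g(2)[of "b * q powi k"] insert.prems(2) theta_eq_0_iff[of "b * q powi k / a"] by auto
  qed
  then obtain h where "h holomorphic_on - {0}" "\<And>t. t \<noteq> 0 \<Longrightarrow> g t = (\<Prod>a\<in>A. theta (t / a)) * h t"
    using insert.IH[OF _ _ g(1)] insert.prems by (metis insert_iff)
  then show ?case
    using insert.prems(1)[of h] insert.hyps g(2) by (simp add: mult.assoc)
qed

text \<open>A function of theta growth \<open>d\<close> grows towards \<open>0\<close> and \<open>\<infinity>\<close> at most like a product of \<open>d\<close> theta
  functions, up to a factor that is exponential in \<open>log \<bar>t\<bar>\<close>.\<close>

definition theta_growth :: "nat \<Rightarrow> (complex \<Rightarrow> complex) \<Rightarrow> bool" where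
  "theta_growth d f \<longleftrightarrow> (\<exists>K\<ge>0. \<exists>A\<ge>1. \<forall>n t. norm q \<le> norm t \<longrightarrow> norm t \<le> 1 \<longrightarrow>
     norm (f (t * q ^ n)) \<le> K * A ^ n * (1 / norm q) ^ (d * (n choose 2)) \<and>
     norm (f (t / q ^ n)) \<le> K * A ^ n * (1 / norm q) ^ (d * (n choose 2)))"

text \<open>A gap of one theta degree leaves a factor of this kind, whatever the exponential factors in the growth
  bounds are.\<close>

lemma gaussian_decay: "(\<lambda>n. x ^ n * norm q ^ (n choose 2)) \<longlonglongrightarrow> 0" for x :: real
proof -
  have "(\<lambda>n. norm x * norm q ^ n) \<longlonglongrightarrow> norm x * 0"
    using q_less_1 by (intro tendsto_mult tendsto_const LIMSEQ_power_zero) simp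
  then have "eventually (\<lambda>n. norm x * norm q ^ n < 1 / 2) sequentially"
    by (intro order_tendstoD(2)) auto
  then obtain N where N: "\<And>n. n \<ge> N \<Longrightarrow> norm x * norm q ^ n < 1 / 2"
    by (auto simp: eventually_sequentially)
  have "summable (\<lambda>n. x ^ n * norm q ^ (n choose 2))"
  proof (rule summable_ratio_test[of "1/2" N])
    fix n assume "n \<ge> N"
    have "norm (x ^ Suc n * norm q ^ (Suc n choose 2)) =
        (norm x * norm q ^ n) * norm (x ^ n * norm q ^ (n choose 2))"
      by (simp add: numeral_2_eq_2 power_add norm_mult abs_mult mult_ac)
    also have "\<dots> \<le> 1 / 2 * norm (x ^ n * norm q ^ (n choose 2))"
      using N[OF \<open>n \<ge> N\<close>] by (intro mult_right_mono) auto
    finally show "norm (x ^ Suc n * norm q ^ (Suc n choose 2)) \<le> 1 / 2 * norm (x ^ n * norm q ^ (n choose 2))" .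
  qed simp
  then show ?thesis by (rule summable_LIMSEQ_zero)
qed

end

text \<open>The maximum principle on the annuli between the two families of circles.\<close>

lemma holomorphic_zero_by_circles:
  fixes h :: "complex \<Rightarrow> complex" and r s \<epsilon> :: "nat \<Rightarrow> real"
  assumes h: "h holomorphic_on - {0}" and r: "\<And>n. 0 < r n" "r \<longlonglongrightarrow> 0"
    and s: "filterlim s at_top sequentially" and \<epsilon>: "\<epsilon> \<longlonglongrightarrow> 0"
    and bound: "\<And>n z. norm z = r n \<or> norm z = s n \<Longrightarrow> norm (h z) \<le> \<epsilon> n"
    and w: "w \<noteq> 0"
  shows "h w = 0"
proof -
  have "norm (h w) \<le> 0"
  proof (rule tendsto_lowerbound[OF \<epsilon>])
    have "eventually (\<lambda>n. r n < norm w) sequentially"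
      using order_tendstoD(2)[OF r(2)] w by auto
    moreover have "eventually (\<lambda>n. norm w < s n) sequentially"
      using s by (simp add: filterlim_at_top_dense)
    ultimately show "eventually (\<lambda>n. norm (h w) \<le> \<epsilon> n) sequentially"
    proof eventually_elim
      case (elim n)
      define X where "X = {z :: complex. r n < norm z} \<inter> {z. norm z < s n}"
      have op: "open X" unfolding X_def by (intro open_Int open_Collect_less continuous_intros)
      have cl: "closure X \<subseteq> {z. r n \<le> norm z} \<inter> {z. norm z \<le> s n}"
        by (rule closure_minimal) (auto simp: X_def intro!: closed_Int closed_Collect_le continuous_intros)
      show ?case
      proof (rule maximum_modulus_frontier[of h X])
        show "h holomorphic_on interior X"
          unfolding interior_open[OF op]
          using r(1)[of n] by (intro holomorphic_on_subset[OF h]) (auto simp: X_def)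
        show "continuous_on (closure X) h"
          using cl r(1)[of n] by (intro holomorphic_on_imp_continuous_on holomorphic_on_subset[OF h]) auto
        show "bounded X" unfolding X_def bounded_iff by (auto intro: less_imp_le)
        show "norm (h z) \<le> \<epsilon> n" if "z \<in> frontier X" for z
        proof (rule bound)
          from that cl have "z \<notin> X" "r n \<le> norm z \<and> norm z \<le> s n"
            unfolding frontier_def interior_open[OF op] by auto
          then show "norm z = r n \<or> norm z = s n" by (auto simp: X_def)
        qed
        show "w \<in> X" using elim by (simp add: X_def)
      qed
    qed
  qed simp
  then show ?thesis by simp
qed

context q_base
begin

text \<open>On a circle without zeros the modulus of the theta product has a positive minimum, and the functional
  equation transports it to the circles scaled by powers of \<open>q\<close>.\<close>

lemma theta_product_lower_bound:
  assumes A: "finite A" "0 \<notin> A" and r: "0 < r" "\<And>a k. a \<in> A \<Longrightarrow> norm (a * q powi k) \<noteq> r"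
  obtains \<delta> B where "0 < \<delta>" "0 < B"
    "\<And>n t. norm t = r \<Longrightarrow> \<delta> * B ^ n * (1 / norm q) ^ (card A * (n choose 2)) \<le> norm (\<Prod>a\<in>A. theta (t * q ^ n / a))"
    "\<And>n t. norm t = r \<Longrightarrow> \<delta> * B ^ n * (1 / norm q) ^ (card A * (n choose 2)) \<le> norm (\<Prod>a\<in>A. theta (t / q ^ n / a))"
proof -
  define \<Theta> where "\<Theta> = (\<lambda>t. \<Prod>a\<in>A. theta (t / a))"
  have nz: "\<Theta> t \<noteq> 0" if "norm t = r" for t
  proof -
    have "theta (t / a) \<noteq> 0" if "a \<in> A" for a
    proof
      assume z: "theta (t / a) = 0"
      have "a \<noteq> 0" "t \<noteq> 0" using that A(2) r(1) \<open>norm t = r\<close> by auto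
      with z obtain k where "t / a = q powi k" by (auto simp: theta_eq_0_iff q_powers_def)
      with \<open>a \<noteq> 0\<close> have "t = a * q powi k" by (simp add: field_simps)
      with r(2)[OF that, of k] \<open>norm t = r\<close> show False by simp
    qed
    then show ?thesis using A(1) by (simp add: \<Theta>_def)
  qed
  have "\<Theta> holomorphic_on - {0}"
    unfolding \<Theta>_def using A(2) by (intro holomorphic_intros) auto
  then have cont: "continuous_on (sphere 0 r) (\<lambda>t. norm (\<Theta> t))"
    using r(1) by (intro continuous_intros holomorphic_on_imp_continuous_on) (auto elim: holomorphic_on_subset)
  have "sphere (0::complex) r \<noteq> {}" using r(1) by simp
  then obtain t0 where t0: "norm t0 = r" "\<And>t. norm t = r \<Longrightarrow> norm (\<Theta> t0) \<le> norm (\<Theta> t)"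
    using continuous_attains_inf[OF compact_sphere _ cont] by auto
  define \<delta> where "\<delta> = norm (\<Theta> t0)"
  have \<delta>: "\<delta> > 0" using nz[OF t0(1)] by (simp add: \<delta>_def)
  \<comment> \<open>The factors by which the modulus of \<open>theta (t / a)\<close> changes, apart from the quadratic exponents.\<close>
  define \<beta>1 \<beta>2 where "\<beta>1 = (\<lambda>a::complex. norm a / r)" and "\<beta>2 = (\<lambda>a::complex. r / (norm a * norm q))"
  define B where "B = min (prod \<beta>1 A) (prod \<beta>2 A)"
  have B0: "B > 0"
    using A r(1) unfolding B_def \<beta>1_def \<beta>2_def by (auto intro!: prod_pos divide_pos_pos mult_pos_pos)
  have low: "\<delta> * B ^ n * (1 / norm q) ^ (card A * (n choose 2)) \<le> norm (\<Prod>a\<in>A. theta (u / a))"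
    if eq: "\<And>a. a \<in> A \<Longrightarrow> norm (theta (u / a)) = \<beta> a ^ n * (1 / norm q) ^ (n choose 2) * norm (theta (t / a))"
      and \<beta>: "B \<le> prod \<beta> A" and t: "norm t = r" for \<beta> u t n
  proof -
    define X where "X = (1 / norm q) ^ (card A * (n choose 2))"
    have "norm (\<Prod>a\<in>A. theta (u / a)) = prod \<beta> A ^ n * X * norm (\<Theta> t)"
      unfolding prod_norm[symmetric] \<Theta>_def X_def
      by (simp add: eq prod.distrib prod_power_distrib[symmetric] power_mult mult.commute[of "card A"])
    moreover have "(B ^ n * X) * \<delta> \<le> (prod \<beta> A ^ n * X) * norm (\<Theta> t)"
      using \<beta> B0 t0(2)[OF t] \<delta> by (intro mult_mono mult_right_mono power_mono) (auto simp: \<delta>_def X_def)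
    ultimately show ?thesis by (simp add: X_def mult_ac)
  qed
  show ?thesis
  proof (rule that[OF \<delta> B0])
    fix n :: nat and t :: complex assume t: "norm t = r"
    show "\<delta> * B ^ n * (1 / norm q) ^ (card A * (n choose 2)) \<le> norm (\<Prod>a\<in>A. theta (t * q ^ n / a))"
    proof (rule low[OF _ _ t])
      fix a assume "a \<in> A"
      then have "a \<noteq> 0" "t \<noteq> 0" using A(2) t r(1) by auto
      then have "theta (t * q ^ n / a) = (- 1 / (t / a)) ^ n / q ^ (n choose 2) * theta (t / a)"
        using theta_mult_q_power[of "t / a" n] by simp
      then show "norm (theta (t * q ^ n / a)) = \<beta>1 a ^ n * (1 / norm q) ^ (n choose 2) * norm (theta (t / a))"
        using t by (simp add: \<beta>1_def norm_mult norm_divide norm_power power_divide)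
    qed (simp add: B_def)
    show "\<delta> * B ^ n * (1 / norm q) ^ (card A * (n choose 2)) \<le> norm (\<Prod>a\<in>A. theta (t / q ^ n / a))"
    proof (rule low[OF _ _ t])
      fix a assume "a \<in> A"
      then have "a \<noteq> 0" "t \<noteq> 0" using A(2) t r(1) by auto
      then have "theta (t / q ^ n / a) = (- (t / a) / q) ^ n / q ^ (n choose 2) * theta (t / a)"
        using theta_div_q_power[of "t / a" n] by (simp add: mult.commute)
      then show "norm (theta (t / q ^ n / a)) = \<beta>2 a ^ n * (1 / norm q) ^ (n choose 2) * norm (theta (t / a))"
        using t by (simp add: \<beta>2_def norm_mult norm_divide norm_power power_divide)
    qed (simp add: B_def)
  qed
qed

text \<open>The quotient of \<open>f\<close> by the theta product with the prescribed zeros tends to \<open>0\<close>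
  along circles that shrink to \<open>0\<close> and circles that grow to \<open>\<infinity>\<close>, because the theta product grows
  with the larger degree; the maximum principle then kills it.\<close>

lemma theta_growth_too_many_zeros:
  assumes f: "f holomorphic_on - {0}" and growth: "theta_growth d f"
    and A: "finite A" "0 \<notin> A" "d < card A"
    and zero: "\<And>a k. a \<in> A \<Longrightarrow> f (a * q powi k) = 0"
    and distinct: "\<And>a b. a \<in> A \<Longrightarrow> b \<in> A \<Longrightarrow> a \<noteq> b \<Longrightarrow> a / b \<notin> q_powers q"
    and w: "w \<noteq> 0"
  shows "f w = 0"
proof -
  obtain h where h: "h holomorphic_on - {0}" "\<And>t. t \<noteq> 0 \<Longrightarrow> f t = (\<Prod>a\<in>A. theta (t / a)) * h t"
    using theta_product_division[OF A(1,2) f zero distinct] by metis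
  define \<Theta> where "\<Theta> = (\<lambda>t. \<Prod>a\<in>A. theta (t / a))"
  \<comment> \<open>a radius whose circle carries no zero of the theta product\<close>
  have "countable (\<Union>a\<in>A. range (\<lambda>k. norm (a * q powi k)))"
    using A(1) by (intro countable_UN countable_image) (auto intro: countable_finite)
  moreover have "uncountable {norm q<..<1}"
    using q_less_1 by (simp add: uncountable_open_interval)
  ultimately have "\<not> {norm q<..<1} \<subseteq> (\<Union>a\<in>A. range (\<lambda>k. norm (a * q powi k)))"
    using countable_subset by blast
  then obtain r where "r \<in> {norm q<..<1}" "r \<notin> (\<Union>a\<in>A. range (\<lambda>k. norm (a * q powi k)))"
    by blast
  then have r: "norm q < r" "r < 1" "\<And>a k. a \<in> A \<Longrightarrow> norm (a * q powi k) \<noteq> r"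
    by auto
  have r0: "0 < r" using q_pos r(1) by (rule less_trans)
  define m where "m = card A"
  obtain \<delta> B where \<delta>: "0 < \<delta>" and B0: "0 < B" and
    low: "\<And>n t. norm t = r \<Longrightarrow> \<delta> * B ^ n * (1 / norm q) ^ (m * (n choose 2)) \<le> norm (\<Theta> (t * q ^ n))"
      "\<And>n t. norm t = r \<Longrightarrow> \<delta> * B ^ n * (1 / norm q) ^ (m * (n choose 2)) \<le> norm (\<Theta> (t / q ^ n))"
    using theta_product_lower_bound[OF A(1,2) r0 r(3)] unfolding \<Theta>_def m_def by metis
  obtain K C where K: "K \<ge> 0" "C \<ge> 1" and KC:
    "\<And>n t. norm q \<le> norm t \<Longrightarrow> norm t \<le> 1 \<Longrightarrow> norm (f (t * q ^ n)) \<le> K * C ^ n * (1 / norm q) ^ (d * (n choose 2))"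
    "\<And>n t. norm q \<le> norm t \<Longrightarrow> norm t \<le> 1 \<Longrightarrow> norm (f (t / q ^ n)) \<le> K * C ^ n * (1 / norm q) ^ (d * (n choose 2))"
    using growth unfolding theta_growth_def by metis
  define \<epsilon> where "\<epsilon> = (\<lambda>n. K / \<delta> * ((C / B) ^ n * norm q ^ (n choose 2)))"
  have quotient: "norm (h u) \<le> \<epsilon> n"
    if u: "u \<noteq> 0" and up: "norm (f u) \<le> K * C ^ n * (1 / norm q) ^ (d * (n choose 2))"
      and lower: "\<delta> * B ^ n * (1 / norm q) ^ (m * (n choose 2)) \<le> norm (\<Theta> u)" for u n
  proof -
    have q1: "1 \<le> 1 / norm q" using q_pos q_less_1 by simp
    define N where "N = n choose 2"
    define Q where "Q = 1 / norm q"
    have Q: "1 \<le> Q" using q1 by (simp add: Q_def)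
    have low': "0 < \<delta> * B ^ n * Q ^ (m * N)" using \<delta> B0 Q by simp
    have "d * N + N \<le> m * N" using A(3) by (metis Suc_leI add.commute m_def mult_Suc mult_le_mono1)
    then have le: "Q ^ (d * N) * Q ^ N \<le> Q ^ (m * N)"
      using Q by (metis power_add power_increasing)
    have cancel: "norm q ^ N * Q ^ N = 1" using q_pos by (simp add: Q_def flip: power_mult_distrib)
    have "Q ^ (d * N) = (norm q ^ N * Q ^ N) * Q ^ (d * N)" by (simp add: cancel)
    also have "\<dots> = norm q ^ N * (Q ^ (d * N) * Q ^ N)" by (simp only: mult_ac)
    also have "\<dots> \<le> norm q ^ N * Q ^ (m * N)" using le by (rule mult_left_mono) simp
    finally have *: "Q ^ (d * N) \<le> norm q ^ N * Q ^ (m * N)" .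
    have "norm (h u) = norm (f u) / norm (\<Theta> u)"
      using h(2)[OF u] lower low' by (auto simp: norm_mult \<Theta>_def Q_def N_def)
    also have "\<dots> \<le> (K * C ^ n * Q ^ (d * N)) / (\<delta> * B ^ n * Q ^ (m * N))"
      using up lower low' K by (intro frac_le) (auto simp: Q_def N_def)
    also have "\<dots> \<le> (K * C ^ n * (norm q ^ N * Q ^ (m * N))) / (\<delta> * B ^ n * Q ^ (m * N))"
      using * K low' by (intro divide_right_mono mult_left_mono) auto
    also have "\<dots> = \<epsilon> n"
      using Q \<delta> B0 by (simp add: \<epsilon>_def power_divide N_def field_simps)
    finally show ?thesis .
  qed
  have "h w = 0"
  proof (rule holomorphic_zero_by_circles[OF h(1) _ _ _ _ _ w])
    show "0 < r * norm q ^ n" for n using r0 q_pos by simp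
    have "(\<lambda>n. r * norm q ^ n) \<longlonglongrightarrow> r * 0"
      using q_less_1 by (intro tendsto_mult tendsto_const LIMSEQ_power_zero) simp
    then show "(\<lambda>n. r * norm q ^ n) \<longlonglongrightarrow> 0" by simp
    have "filterlim (\<lambda>n. (1 / norm q) ^ n) at_top sequentially"
      using filterlim_inverse_at_top[of "\<lambda>n. norm q ^ n" sequentially] q_pos q_less_1
      by (simp add: LIMSEQ_power_zero power_divide inverse_eq_divide)
    then show "filterlim (\<lambda>n. r * (1 / norm q) ^ n) at_top sequentially"
      using r0 by (intro filterlim_tendsto_pos_mult_at_top[OF tendsto_const]) auto
    have "(\<lambda>n. K / \<delta> * ((C / B) ^ n * norm q ^ (n choose 2))) \<longlonglongrightarrow> K / \<delta> * 0"
      by (intro tendsto_mult tendsto_const gaussian_decay)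
    then show "\<epsilon> \<longlonglongrightarrow> 0" by (simp add: \<epsilon>_def)
    show "norm (h z) \<le> \<epsilon> n" if "norm z = r * norm q ^ n \<or> norm z = r * (1 / norm q) ^ n" for n z
      using that
    proof
      assume z: "norm z = r * norm q ^ n"
      define t where "t = z / q ^ n"
      have t: "norm t = r" and zt: "z = t * q ^ n" using z q_pos by (simp_all add: t_def norm_divide norm_power)
      have "z \<noteq> 0" using z r0 q_pos by auto
      then show ?thesis using quotient[of z n] KC(1)[of t n] low(1)[OF t, of n] t r zt by simp
    next
      assume z: "norm z = r * (1 / norm q) ^ n"
      define t where "t = z * q ^ n"
      have t: "norm t = r" and zt: "z = t / q ^ n"
        using z q_pos by (simp_all add: t_def norm_mult norm_power power_divide)
      have "z \<noteq> 0" using z r0 q_pos by auto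
      then show ?thesis using quotient[of z n] KC(2)[of t n] low(2)[OF t, of n] t r zt by simp
    qed
  qed
  then show ?thesis using h(2)[OF w] by simp
qed

text \<open>The functional equation reduces the growth to the maximum on the compact annulus between
  \<open>\<bar>q\<bar>\<close> and \<open>1\<close>.\<close>

lemma theta_growthI_quasi_periodic:
  assumes f: "f holomorphic_on - {0}" and \<kappa>: "\<kappa> \<noteq> 0"
    and quasi: "\<And>t. t \<noteq> 0 \<Longrightarrow> f (q * t) = \<kappa> * f t / t ^ d"
  shows "theta_growth d f"
proof -
  have "compact {t :: complex. norm q \<le> norm t \<and> norm t \<le> 1}"
  proof -
    have "{t :: complex. norm q \<le> norm t \<and> norm t \<le> 1} = cball 0 1 \<inter> {t. norm q \<le> norm t}" by auto
    then show ?thesis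
      by (auto intro!: compact_Int_closed closed_Collect_le continuous_intros)
  qed
  moreover have "continuous_on {t. norm q \<le> norm t \<and> norm t \<le> 1} f"
    using q_pos by (intro holomorphic_on_imp_continuous_on holomorphic_on_subset[OF f]) auto
  ultimately have "bounded (f ` {t. norm q \<le> norm t \<and> norm t \<le> 1})"
    by (intro compact_imp_bounded compact_continuous_image)
  then obtain K where K: "\<And>t. norm q \<le> norm t \<Longrightarrow> norm t \<le> 1 \<Longrightarrow> norm (f t) \<le> K"
    by (auto simp: bounded_iff)
  have K0: "0 \<le> K" using order_trans[OF norm_ge_zero K[of 1]] q_less_1 by simp
  have up: "f (t * q ^ n) = (\<kappa> / t ^ d) ^ n / q ^ (d * (n choose 2)) * f t" if "t \<noteq> 0" for t n
  proof (induction n)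
    case (Suc n)
    have "f (t * q ^ Suc n) = \<kappa> * f (t * q ^ n) / (t * q ^ n) ^ d"
      using quasi[of "t * q ^ n"] that by (simp add: mult_ac)
    then show ?case unfolding Suc
      by (simp add: numeral_2_eq_2 power_add power_mult_distrib algebra_simps flip: power_mult)
  qed (simp add: numeral_2_eq_2)
  have down: "f (t / q ^ n) = (t ^ d / (q ^ d * \<kappa>)) ^ n / q ^ (d * (n choose 2)) * f t" if "t \<noteq> 0" for t n
  proof (induction n)
    case (Suc n)
    have "f (t / q ^ n) = \<kappa> * f (t / q ^ Suc n) / (t / q ^ Suc n) ^ d"
      using quasi[of "t / q ^ Suc n"] that by (simp add: mult_ac)
    then have "f (t / q ^ Suc n) = (t / q ^ Suc n) ^ d * f (t / q ^ n) / \<kappa>"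
      using that \<kappa> by (simp add: field_simps)
    then show ?case unfolding Suc
      by (simp add: numeral_2_eq_2 power_add power_mult_distrib power_divide algebra_simps flip: power_mult)
  qed (simp add: numeral_2_eq_2)
  define A where "A = max 1 (max (norm \<kappa> / norm q ^ d) (1 / (norm q ^ d * norm \<kappa>)))"
  have A: "1 \<le> A" "norm \<kappa> / norm q ^ d \<le> A" "1 / (norm q ^ d * norm \<kappa>) \<le> A"
    by (simp_all add: A_def)
  have "norm (f (t * q ^ n)) \<le> K * A ^ n * (1 / norm q) ^ (d * (n choose 2))"
       "norm (f (t / q ^ n)) \<le> K * A ^ n * (1 / norm q) ^ (d * (n choose 2))"
    if t: "norm q \<le> norm t" "norm t \<le> 1" for n t
  proof -
    have t0: "t \<noteq> 0" using t(1) q_pos by auto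
    have bound: "norm (x ^ n / q ^ (d * (n choose 2)) * f t) \<le> K * A ^ n * (1 / norm q) ^ (d * (n choose 2))"
      if "norm x \<le> A" for x
    proof -
      have "norm (x ^ n / q ^ (d * (n choose 2)) * f t) =
          norm (f t) * norm x ^ n * (1 / norm q) ^ (d * (n choose 2))"
        by (simp add: norm_mult norm_divide norm_power power_divide)
      also have "\<dots> \<le> K * A ^ n * (1 / norm q) ^ (d * (n choose 2))"
        using that K[OF t] K0 A(1) by (intro mult_right_mono mult_mono power_mono) auto
      finally show ?thesis .
    qed
    have "norm (\<kappa> / t ^ d) \<le> norm \<kappa> / norm q ^ d"
      unfolding norm_divide norm_power using q_pos t by (intro divide_left_mono power_mono mult_pos_pos zero_less_power) auto
    then show "norm (f (t * q ^ n)) \<le> K * A ^ n * (1 / norm q) ^ (d * (n choose 2))"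
      unfolding up[OF t0] using A(2) by (intro bound) auto
    have "norm (t ^ d / (q ^ d * \<kappa>)) \<le> 1 / (norm q ^ d * norm \<kappa>)"
      unfolding norm_divide norm_power norm_mult using q_pos t
      by (intro divide_right_mono) (auto intro: power_le_one)
    then show "norm (f (t / q ^ n)) \<le> K * A ^ n * (1 / norm q) ^ (d * (n choose 2))"
      unfolding down[OF t0] using A(3) by (intro bound) auto
  qed
  then show ?thesis unfolding theta_growth_def using K0 A(1) by blast
qed

lemma phi_bound_growth:
  assumes c: "0 \<le> c"
  shows "phi_bound (c / norm q ^ n) \<le> phi_bound c * ((1 + c) / norm q) ^ n * (1 / norm q) ^ (n choose 2)"
proof (induction n)
  case (Suc n)
  define p where "p = norm q"
  have p: "0 < p" "p < 1" using q_pos q_less_1 by (auto simp: p_def)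
  have "phi_bound (c / p ^ Suc n) = (1 + c / p ^ Suc n) * phi_bound (c / p ^ n)"
    using phi_bound_split[of "c / p ^ Suc n" 1] p by (simp add: p_def)
  also have "\<dots> \<le> ((1 + c) / p ^ Suc n) * (phi_bound c * ((1 + c) / p) ^ n * (1 / p) ^ (n choose 2))"
  proof (rule mult_mono)
    have "1 \<le> 1 / p ^ Suc n" using p by (simp add: power_le_one mult_le_one del: power_Suc)
    then show "1 + c / p ^ Suc n \<le> (1 + c) / p ^ Suc n" by (simp add: add_divide_distrib)
    show "phi_bound (c / p ^ n) \<le> phi_bound c * ((1 + c) / p) ^ n * (1 / p) ^ (n choose 2)"
      using Suc by (simp add: p_def)
    show "0 \<le> (1 + c) / p ^ Suc n" using p c by simp
    show "0 \<le> phi_bound (c / p ^ n)"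
      using phi_bound_ge_1[of "c / p ^ n"] p c by simp
  qed
  also have "\<dots> = phi_bound c * ((1 + c) / p) ^ Suc n * (1 / p) ^ (Suc n choose 2)"
    using p by (simp add: numeral_2_eq_2 power_add power_divide field_simps)
  finally show ?case by (simp add: p_def)
qed (simp add: numeral_2_eq_2)

text \<open>The majorant behaves like a theta function of \<open>\<bar>t\<bar>\<close>, so \<open>d\<close> counts
  theta factors. While \<open>theta_growth\<close> controls the values on the orbits under multiplication
  by \<open>q\<close>, this form is visibly compatible with products.\<close>

definition theta_dominated :: "nat \<Rightarrow> (complex \<Rightarrow> complex) \<Rightarrow> bool" where
  "theta_dominated d f \<longleftrightarrow> (\<exists>K\<ge>0. \<exists>c\<ge>0. \<forall>t. t \<noteq> 0 \<longrightarrow>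
     norm (f t) \<le> K * (phi_bound (c * norm t) * phi_bound (c / norm t)) ^ d)"

lemma theta_dominatedE:
  assumes "theta_dominated d f"
  obtains K c where "0 \<le> K" "0 \<le> c"
    "\<And>c' t. c \<le> c' \<Longrightarrow> t \<noteq> 0 \<Longrightarrow> norm (f t) \<le> K * (phi_bound (c' * norm t) * phi_bound (c' / norm t)) ^ d"
proof -
  obtain K c where K: "0 \<le> K" and c: "0 \<le> c" and
    le: "\<And>t. t \<noteq> 0 \<Longrightarrow> norm (f t) \<le> K * (phi_bound (c * norm t) * phi_bound (c / norm t)) ^ d"
    using assms by (auto simp: theta_dominated_def)
  show ?thesis
  proof (rule that[OF K c])
    fix c' t assume "c \<le> c'" "(t::complex) \<noteq> 0"
    have "phi_bound (c * norm t) \<le> phi_bound (c' * norm t)" "phi_bound (c / norm t) \<le> phi_bound (c' / norm t)"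
      using c \<open>c \<le> c'\<close> by (auto intro!: phi_bound_mono mult_right_mono divide_right_mono)
    moreover have "1 \<le> phi_bound (c * norm t)" "1 \<le> phi_bound (c / norm t)"
      using c by (auto intro!: phi_bound_ge_1)
    ultimately have "(phi_bound (c * norm t) * phi_bound (c / norm t)) ^ d \<le>
        (phi_bound (c' * norm t) * phi_bound (c' / norm t)) ^ d"
      by (intro power_mono mult_mono) auto
    then show "norm (f t) \<le> K * (phi_bound (c' * norm t) * phi_bound (c' / norm t)) ^ d"
      using le[OF \<open>t \<noteq> 0\<close>] K by (meson mult_left_mono order_trans)
  qed
qed

lemma theta_dominatedI:
  assumes "\<And>t. t \<noteq> 0 \<Longrightarrow> norm (f t) \<le> K * (phi_bound (c * norm t) * phi_bound (c / norm t)) ^ d"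
    and "0 \<le> K" "0 \<le> c"
  shows "theta_dominated d f"
  using assms unfolding theta_dominated_def by blast

lemma theta_dominated_mult:
  assumes "theta_dominated d f" "theta_dominated e g"
  shows "theta_dominated (d + e) (\<lambda>t. f t * g t)"
proof -
  obtain K c where K: "0 \<le> K" "0 \<le> c" "\<And>c' t. c \<le> c' \<Longrightarrow> t \<noteq> 0 \<Longrightarrow>
      norm (f t) \<le> K * (phi_bound (c' * norm t) * phi_bound (c' / norm t)) ^ d"
    using theta_dominatedE[OF assms(1)] by metis
  obtain L e' where L: "0 \<le> L" "0 \<le> e'" "\<And>c' t. e' \<le> c' \<Longrightarrow> t \<noteq> 0 \<Longrightarrow>
      norm (g t) \<le> L * (phi_bound (c' * norm t) * phi_bound (c' / norm t)) ^ e"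
    using theta_dominatedE[OF assms(2)] by metis
  define C where "C = max c e'"
  show ?thesis
  proof (rule theta_dominatedI)
    fix t :: complex assume t: "t \<noteq> 0"
    define X where "X = phi_bound (C * norm t) * phi_bound (C / norm t)"
    have X: "0 \<le> X"
      using phi_bound_ge_1[of "C * norm t"] phi_bound_ge_1[of "C / norm t"] K(2) by (simp add: X_def C_def)
    have "norm (f t * g t) \<le> (K * X ^ d) * (L * X ^ e)"
      unfolding norm_mult X_def
      using K t L X[unfolded X_def] by (intro mult_mono K(3) L(3)) (auto simp: C_def)
    then show "norm (f t * g t) \<le> (K * L) * (phi_bound (C * norm t) * phi_bound (C / norm t)) ^ (d + e)"
      by (simp add: X_def power_add mult_ac)
  qed (use K L in \<open>auto simp: C_def\<close>)
qed

lemma theta_dominated_add: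
  assumes "theta_dominated d f" "theta_dominated d g"
  shows "theta_dominated d (\<lambda>t. f t + g t)"
proof -
  obtain K c where K: "0 \<le> K" "0 \<le> c" "\<And>c' t. c \<le> c' \<Longrightarrow> t \<noteq> 0 \<Longrightarrow>
      norm (f t) \<le> K * (phi_bound (c' * norm t) * phi_bound (c' / norm t)) ^ d"
    using theta_dominatedE[OF assms(1)] by metis
  obtain L e where L: "0 \<le> L" "0 \<le> e" "\<And>c' t. e \<le> c' \<Longrightarrow> t \<noteq> 0 \<Longrightarrow>
      norm (g t) \<le> L * (phi_bound (c' * norm t) * phi_bound (c' / norm t)) ^ d"
    using theta_dominatedE[OF assms(2)] by metis
  show ?thesis
  proof (rule theta_dominatedI[of _ "K + L" "max c e"])
    fix t :: complex assume t: "t \<noteq> 0"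
    show "norm (f t + g t) \<le> (K + L) * (phi_bound (max c e * norm t) * phi_bound (max c e / norm t)) ^ d"
      using norm_triangle_ineq[of "f t" "g t"] K(3)[of "max c e" t] L(3)[of "max c e" t] t
      by (simp add: distrib_right)
  qed (use K L in auto)
qed

lemma theta_dominated_const: "theta_dominated 0 (\<lambda>t. a)"
  by (rule theta_dominatedI[of _ "norm a" 0]) auto

lemma theta_dominated_cmult: "theta_dominated d f \<Longrightarrow> theta_dominated d (\<lambda>t. a * f t)"
  using theta_dominated_mult[OF theta_dominated_const, of d f a] by simp

lemma theta_dominated_phi_pair: "theta_dominated 1 (\<lambda>t. phi (a * t) * phi (b / t))"
proof (rule theta_dominatedI[of _ 1 "max (norm a) (norm b)"])
  fix t :: complex
  have "norm (phi (a * t)) \<le> phi_bound (max (norm a) (norm b) * norm t)"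
    using norm_phi_le[of "a * t"]
    by (rule order_trans) (auto simp: norm_mult intro!: phi_bound_mono mult_right_mono)
  moreover have "norm (phi (b / t)) \<le> phi_bound (max (norm a) (norm b) / norm t)"
    using norm_phi_le[of "b / t"]
    by (rule order_trans) (auto simp: norm_divide intro!: phi_bound_mono divide_right_mono)
  ultimately show "norm (phi (a * t) * phi (b / t)) \<le>
      1 * (phi_bound (max (norm a) (norm b) * norm t) * phi_bound (max (norm a) (norm b) / norm t)) ^ 1"
    unfolding norm_mult mult_1_left power_one_right
    by (intro mult_mono order_trans[OF zero_le_one phi_bound_ge_1]) (auto simp: le_max_iff_disj)
qed (auto simp: le_max_iff_disj)

lemma theta_dominated_theta:
  "theta_dominated 1 (\<lambda>t. theta (a * t))" "theta_dominated 1 (\<lambda>t. theta (a / t))"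
  using theta_dominated_phi_pair[of a "q / a"] theta_dominated_phi_pair[of "q / a" a]
  by (simp_all add: qtheta_def mult.commute)

lemma theta_dominated_imp_growth:
  assumes "theta_dominated d f"
  shows "theta_growth d f"
proof -
  obtain K c where K: "0 \<le> K" "0 \<le> c" and le: "\<And>t. t \<noteq> 0 \<Longrightarrow>
      norm (f t) \<le> K * (phi_bound (c * norm t) * phi_bound (c / norm t)) ^ d"
    using assms by (auto simp: theta_dominated_def)
  \<comment> \<open>On the annulus between \<open>\<bar>q\<bar>\<close> and \<open>1\<close> both \<open>c \<bar>t\<bar>\<close> and \<open>c / \<bar>t\<bar>\<close> are at most \<open>C\<close>.\<close>
  define C where "C = c / norm q"
  have cC: "0 \<le> C" "c \<le> C"
    using K(2) q_pos q_less_1 mult_left_le[of "norm q" c] by (auto simp: C_def field_simps)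
  define A where "A = (1 + C) / norm q"
  have "1 * norm q \<le> 1 + C" using q_less_1 cC by linarith
  then have A1: "1 \<le> A" using q_pos unfolding A_def by (simp only: pos_le_divide_eq)
  define M where "M = phi_bound C * phi_bound C"
  have P1: "1 \<le> phi_bound C" using cC by (intro phi_bound_ge_1)
  have main: "K * (phi_bound (c * norm u) * phi_bound (c / norm u)) ^ d \<le>
      (K * M ^ d) * (A ^ d) ^ n * (1 / norm q) ^ (d * (n choose 2))"
    if "(norm u \<le> 1 \<and> norm q * norm q ^ n \<le> norm u) \<or> (norm q \<le> norm u \<and> norm u \<le> 1 / norm q ^ n)" "u \<noteq> 0" for u :: complex and n
  proof -
    define R where "R = phi_bound C * A ^ n * (1 / norm q) ^ (n choose 2)"
    have R: "phi_bound (C / norm q ^ n) \<le> R"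
      unfolding R_def A_def by (rule phi_bound_growth[OF cC(1)])
    have R0: "0 \<le> R" unfolding R_def using P1 A1 by simp
    have nn: "1 \<le> phi_bound (c * norm u)" "1 \<le> phi_bound (c / norm u)"
      using K(2) by (auto intro!: phi_bound_ge_1)
    have "phi_bound (c * norm u) * phi_bound (c / norm u) \<le> phi_bound C * R"
      using that(1)
    proof
      assume u: "norm u \<le> 1 \<and> norm q * norm q ^ n \<le> norm u"
      have "c * norm u \<le> C" using u K(2) cC(2) mult_left_le[of "norm u" c] by linarith
      moreover have "c / norm u \<le> C / norm q ^ n"
        unfolding C_def divide_divide_eq_left using u K(2) q_pos that(2)
        by (intro divide_left_mono mult_pos_pos) auto
      ultimately have "phi_bound (c * norm u) \<le> phi_bound C" "phi_bound (c / norm u) \<le> phi_bound (C / norm q ^ n)"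
        using K(2) by (auto intro!: phi_bound_mono)
      then show ?thesis using R nn P1 by (intro mult_mono) linarith+
    next
      assume u: "norm q \<le> norm u \<and> norm u \<le> 1 / norm q ^ n"
      have "c / norm u \<le> C" 
        unfolding C_def using u K(2) q_pos that(2) by (intro divide_left_mono mult_pos_pos) auto
      moreover have "c * norm u \<le> C * (1 / norm q ^ n)"
        using u K(2) cC by (intro mult_mono) auto
      ultimately have "phi_bound (c / norm u) \<le> phi_bound C" "phi_bound (c * norm u) \<le> phi_bound (C / norm q ^ n)"
        using K(2) by (auto intro!: phi_bound_mono)
      then have "phi_bound (c / norm u) * phi_bound (c * norm u) \<le> phi_bound C * R"
        using R nn P1 by (intro mult_mono) linarith+
      then show ?thesis by (simp add: mult.commute)
    qed
    then have "K * (phi_bound (c * norm u) * phi_bound (c / norm u)) ^ d \<le> K * (phi_bound C * R) ^ d"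
      using nn K(1) by (intro mult_left_mono power_mono) auto
    also have "\<dots> = (K * M ^ d) * (A ^ d) ^ n * (1 / norm q) ^ (d * (n choose 2))"
      by (simp add: R_def M_def power_mult_distrib power_mult[symmetric] mult_ac)
    finally show ?thesis .
  qed
  have "norm (f (t * q ^ n)) \<le> (K * M ^ d) * (A ^ d) ^ n * (1 / norm q) ^ (d * (n choose 2))"
       "norm (f (t / q ^ n)) \<le> (K * M ^ d) * (A ^ d) ^ n * (1 / norm q) ^ (d * (n choose 2))"
    if t: "norm q \<le> norm t" "norm t \<le> 1" for n t
  proof -
    have t0: "t \<noteq> 0" using t(1) q_pos by auto
    have qn: "norm q ^ n \<le> 1" using q_less_1 by (simp add: power_le_one)
    show "norm (f (t * q ^ n)) \<le> (K * M ^ d) * (A ^ d) ^ n * (1 / norm q) ^ (d * (n choose 2))"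
      by (rule order_trans[OF le main])
         (use t t0 qn in \<open>auto simp: norm_mult norm_power intro!: mult_right_mono mult_le_one\<close>)
    have "norm t \<le> norm t / norm q ^ n"
      using qn q_pos mult_left_le[of "norm q ^ n" "norm t"] by (simp add: field_simps)
    then have "norm q \<le> norm t / norm q ^ n" using t by linarith
    then show "norm (f (t / q ^ n)) \<le> (K * M ^ d) * (A ^ d) ^ n * (1 / norm q) ^ (d * (n choose 2))"
      by (intro order_trans[OF le main])
         (use t t0 qn in \<open>auto simp: norm_divide norm_power intro!: divide_right_mono\<close>)
  qed
  moreover have "0 \<le> K * M ^ d" "1 \<le> A ^ d" using K(1) A1 by (auto simp: M_def)
  ultimately show ?thesis unfolding theta_growth_def by blast
qed

section \<open>The bilateral series and its functional equations\<close>

text \<open>The part of the weight of the series that is invariant under \<open>z \<mapsto> 1 / z\<close>.\<close>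

definition weight_G :: "(nat \<Rightarrow> complex) \<Rightarrow> complex \<Rightarrow> complex" where
  "weight_G b z = (\<Prod>j\<in>{1..6}. phi (q * z / b j) * phi (q * inverse z / b j))"

text \<open>The summand of the series for \<open>f = 1\<close>, multiplied by its value of \<open>(1 -
  l\<^bsup>2\<^esup>) G(l)\<close>. This removes all denominators (\<open>weight_G_series_term\<close>), so
  that it makes sense for every \<open>l \<noteq> 0\<close>.\<close>

definition bilateral_term :: "(nat \<Rightarrow> complex) \<Rightarrow> complex \<Rightarrow> int \<Rightarrow> complex" where
  "bilateral_term b l x = (1 - l\<^sup>2 * q powi (2 * x)) * l powi (6 * x) * q powi (3 * x\<^sup>2 - x)
     * weight_G b (l * q powi x)"

definition bilateral_sum :: "(nat \<Rightarrow> complex) \<Rightarrow> complex \<Rightarrow> complex" where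
  "bilateral_sum b l = (\<Sum>\<^sub>\<infinity>x\<in>UNIV. bilateral_term b l x)"

text \<open>The expression in braces in the prefactor.\<close>

definition theta_bracket :: "(nat \<Rightarrow> complex) \<Rightarrow> complex \<Rightarrow> complex" where
  "theta_bracket b m = (\<Prod>j\<in>{1..6}. theta (m * b j)) - q / m\<^sup>2 * (\<Prod>j\<in>{1..6}. theta (m / b j))"

definition balanced :: "(nat \<Rightarrow> complex) \<Rightarrow> bool" where
  "balanced b \<longleftrightarrow> (\<forall>j\<in>{1..6}. b j \<noteq> 0) \<and> (\<Prod>j\<in>{1..6}. b j) = q"

lemma weight_G_inverse: "weight_G b (inverse z) = weight_G b z"
  by (simp add: weight_G_def mult.commute)

lemma bilateral_term_shift:
  assumes "l \<noteq> 0"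
  shows "bilateral_term b (q * l) x = bilateral_term b l (x + 1) / (l ^ 6 * q\<^sup>2)"
proof -
  define N where "N = 3 * x\<^sup>2 - x"
  have e: "3 * (x + 1)\<^sup>2 - (x + 1) = (6 * x + N) + 2" "2 * (x + 1) = 2 * x + 2"
    "6 * (x + 1) = 6 * x + 6"
    by (simp_all add: N_def power2_eq_square algebra_simps)
  have "q * l * q powi x = l * q powi (x + 1)" by (simp add: power_int_add)
  then show ?thesis
    unfolding bilateral_term_def e N_def[symmetric] using assms
    by (simp add: power_int_add power_int_mult_distrib power_mult_distrib mult_ac)
qed

text \<open>This symmetry exchanges the two ends of the bilateral series, so that estimates are needed for
  nonnegative \<open>x\<close> only.\<close>

lemma bilateral_term_inverse:
  assumes "l \<noteq> 0"
  shows "bilateral_term b (1 / l) x = - bilateral_term b l (- x) / l\<^sup>2"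
proof -
  define N where "N = 3 * x\<^sup>2 - x"
  define u where "u = q powi (2 * x)"
  have u: "u \<noteq> 0" by (simp add: u_def)
  have e: "3 * (- x)\<^sup>2 - (- x) = N + 2 * x" "6 * - x = - (6 * x)" "2 * - x = - (2 * x)"
    by (simp_all add: N_def)
  have G: "weight_G b (1 / l * q powi x) = weight_G b (l * q powi (- x))"
    using weight_G_inverse[of b "l * q powi (- x)"] by (simp add: power_int_minus field_simps)
  have q: "q powi (N + 2 * x) = q powi N * u" "q powi (- (2 * x)) = 1 / u"
    by (simp_all add: u_def power_int_add power_int_minus inverse_eq_divide)
  have l: "(1 / l) powi (6 * x) = l powi (- (6 * x))"
    by (simp add: power_int_minus power_int_divide_distrib inverse_eq_divide)
  show ?thesis
    unfolding bilateral_term_def e N_def[symmetric] u_def[symmetric] G q l using assms u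
    by (simp add: field_simps)
qed

lemma reflected_partial_prod:
  assumes "a \<noteq> 0"
  shows "(\<Prod>i<n. 1 - a * q ^ i) * phi (q / a) = (- a) ^ n * q ^ (n choose 2) * phi (q / (a * q ^ n))"
proof (induction n)
  case (Suc n)
  have "phi (q / (a * q ^ Suc n)) = (1 - 1 / (a * q ^ n)) * phi (q / (a * q ^ n))"
    using phi_rec[of "1 / (a * q ^ n)"] by simp
  then have "(- a) ^ Suc n * q ^ (Suc n choose 2) * phi (q / (a * q ^ Suc n)) =
      ((- a) * q ^ n * (1 - 1 / (a * q ^ n))) * ((- a) ^ n * q ^ (n choose 2) * phi (q / (a * q ^ n)))"
    by (simp add: numeral_2_eq_2 power_add mult_ac)
  also have "\<dots> = (1 - a * q ^ n) * ((\<Prod>i<n. 1 - a * q ^ i) * phi (q / a))"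
    unfolding Suc using assms by (simp add: field_simps)
  finally show ?case by (simp add: mult_ac)
qed (simp add: numeral_2_eq_2)

text \<open>For nonnegative \<open>x\<close> the quadratic exponents are absorbed into finite products; in this form
  the terms visibly decay like \<open>q\<^bsup>n\<^esup>\<close>.\<close>

lemma bilateral_term_nat:
  assumes b: "balanced b" and l: "l \<noteq> 0"
  shows "bilateral_term b l (int n) = (1 - l\<^sup>2 * q ^ (2 * n)) * q ^ n *
    (\<Prod>j\<in>{1..6}. (\<Prod>i<n. 1 - l * b j * q ^ i) * phi (l * q / b j * q ^ n) * phi (q / (l * b j)))"
proof -
  define c where "c = n choose 2"
  have "2 * c + n = n * n" by (cases n) (simp_all add: c_def choose_two)
  then have c: "n * n = 2 * c + n" by simp
  have "(\<Prod>j\<in>{1..6}. (\<Prod>i<n. 1 - l * b j * q ^ i) * phi (l * q / b j * q ^ n) * phi (q / (l * b j))) =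
    (\<Prod>j\<in>{1..6}. (- (l * b j)) ^ n * q ^ c * (phi (q * (l * q ^ n) / b j) * phi (q * inverse (l * q ^ n) / b j)))"
  proof (rule prod.cong[OF refl])
    fix j :: nat assume "j \<in> {1..6}"
    then have "l * b j \<noteq> 0" using b l by (auto simp: balanced_def)
    from reflected_partial_prod[OF this, of n]
    show "(\<Prod>i<n. 1 - l * b j * q ^ i) * phi (l * q / b j * q ^ n) * phi (q / (l * b j)) =
      (- (l * b j)) ^ n * q ^ c * (phi (q * (l * q ^ n) / b j) * phi (q * inverse (l * q ^ n) / b j))"
      by (simp add: c_def divide_simps mult_ac)
  qed
  also have "\<dots> = (\<Prod>j\<in>{1..6}. - (l * b j)) ^ n * (q ^ c) ^ 6 * weight_G b (l * q ^ n)"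
    by (simp add: prod.distrib weight_G_def prod_power_distrib)
  also have "(\<Prod>j\<in>{1..6}. - (l * b j)) = l ^ 6 * q"
    using b by (simp add: balanced_def prod.distrib prod_uminus)
  also have "(l ^ 6 * q) ^ n * (q ^ c) ^ 6 = l ^ (6 * n) * q ^ (n + 6 * c)"
    by (simp add: power_mult_distrib power_add power_mult mult.commute flip: power_mult)
  finally have eq: "(\<Prod>j\<in>{1..6}. (\<Prod>i<n. 1 - l * b j * q ^ i) * phi (l * q / b j * q ^ n) * phi (q / (l * b j)))
     = l ^ (6 * n) * q ^ (n + 6 * c) * weight_G b (l * q ^ n)" .
  have "3 * (int n)\<^sup>2 - int n = int (n + (n + 6 * c))"
    using c by (simp add: power2_eq_square flip: of_nat_mult)
  then have e: "q powi (3 * (int n)\<^sup>2 - int n) = q ^ n * q ^ (n + 6 * c)"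
    by (simp only: power_int_of_nat power_add)
  have e2: "q powi (2 * int n) = q ^ (2 * n)" "l powi (6 * int n) = l ^ (6 * n)" "q powi (int n) = q ^ n"
    using power_int_of_nat[of q "2 * n"] power_int_of_nat[of l "6 * n"] by simp_all
  show ?thesis unfolding eq bilateral_term_def e e2 by simp
qed

lemma phi_0 [simp]: "phi 0 = 1"
  by (simp add: qpoch_inf_def)

text \<open>The parameters \<open>b\<^sub>1\<close> and \<open>1 / b\<^sub>2\<close> may be large here. The finite product belonging to \<open>b\<^sub>1\<close> is
  paired with the infinite tail belonging to \<open>b\<^sub>2\<close>, so that the bound contains only the second power of
  the factor that depends on their size.\<close>

lemma norm_bilateral_term_nat_le:
  assumes b: "balanced b" and l: "l \<noteq> 0" "norm l \<le> L" "1 / norm l \<le> L"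
    and r: "norm (b 1) \<le> r" "1 / norm (b 2) \<le> r"
    and M: "1 / norm (b 1) \<le> M" "norm (b 2) \<le> M"
      "\<And>j. j \<in> {3..6} \<Longrightarrow> norm (b j) \<le> M" "\<And>j. j \<in> {3..6} \<Longrightarrow> 1 / norm (b j) \<le> M"
  shows "norm (bilateral_term b l (int n)) \<le>
    norm q ^ n * ((1 + L\<^sup>2) * phi_bound (L * r) ^ 2 * phi_bound (L * M) ^ 15)"
proof -
  define A where "A = (\<lambda>j. \<Prod>i<n. 1 - l * b j * q ^ i)"
  define B where "B = (\<lambda>j. phi (l * q / b j * q ^ n))"
  define C where "C = (\<lambda>j. phi (q / (l * b j)))"
  have L0: "0 \<le> L" "0 \<le> r" "0 \<le> M"
    using l(2) r(1) M(2) by (meson norm_ge_zero order_trans)+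
  have P: "0 \<le> phi_bound (L * s)" if "0 \<le> s" for s
    using phi_bound_ge_1[of "L * s"] L0 that by simp
  have q1: "norm q \<le> 1" using q_less_1 by simp
  have A: "norm (A j) \<le> phi_bound (L * s)" if "norm (b j) \<le> s" for j s
    using norm_partial_prod_times_phi_le[of "l * b j" "L * s" 0 n] l L0 that
    by (simp add: A_def norm_mult mult_mono order_trans[OF norm_ge_zero that])
  have lb: "norm (l * q / b j) \<le> L * s" if "1 / norm (b j) \<le> s" for j s
  proof -
    have "norm (l * q / b j) = (norm l * norm q) * (1 / norm (b j))"
      by (simp add: norm_mult norm_divide)
    also have "\<dots> \<le> (L * 1) * s"
      using l q1 that L0 by (intro mult_mono) auto
    finally show ?thesis by simp
  qed
  have B: "norm (B j) \<le> phi_bound (L * s)" if "1 / norm (b j) \<le> s" for j s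
    using norm_partial_prod_times_phi_le[of 0 "L * s" "l * q / b j" n] lb[OF that]
      L0(1) order_trans[OF _ that, of 0]
    by (simp add: B_def)
  have C: "norm (C j) \<le> phi_bound (L * s)" if "1 / norm (b j) \<le> s" for j s
  proof -
    have "norm (q / (l * b j)) = (norm q * (1 / norm l)) * (1 / norm (b j))"
      by (simp add: norm_mult norm_divide)
    also have "\<dots> \<le> (1 * L) * s"
      using l q1 that L0 by (intro mult_mono) auto
    finally show ?thesis
      unfolding C_def by (intro order_trans[OF norm_phi_le] phi_bound_mono) auto
  qed
  have AB: "norm (A 1) * norm (B 2) \<le> phi_bound (L * r)"
    unfolding A_def B_def
    using l r(1) L0 by (intro norm_partial_prod_times_phi_le lb r) (auto simp: norm_mult intro!: mult_mono)
  have tail: "norm (A j * B j * C j) \<le> phi_bound (L * M) ^ 3" if "j \<in> {3..6}" for j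
    unfolding norm_mult power3_eq_cube
    using P L0 by (intro mult_mono A B C M that mult_nonneg_nonneg norm_ge_zero) auto
  have "norm (\<Prod>j\<in>{1..6}. A j * B j * C j) =
      (norm (A 1) * norm (B 2)) * (norm (B 1) * norm (C 1) * norm (A 2) * norm (C 2)) *
      norm (\<Prod>j\<in>{3..6}. A j * B j * C j)"
  proof -
    have "{1..6} = insert 1 (insert 2 {3..6::nat})" by auto
    then show ?thesis by (simp add: norm_mult mult_ac)
  qed
  also have "\<dots> \<le> phi_bound (L * r) * (phi_bound (L * M) * phi_bound (L * M) * phi_bound (L * M) * phi_bound (L * r))
      * (phi_bound (L * M) ^ 3) ^ 4"
  proof (intro mult_mono AB B C A M r mult_nonneg_nonneg norm_ge_zero P L0)
    have "norm (\<Prod>j\<in>{3..6::nat}. A j * B j * C j) \<le> (\<Prod>j\<in>{3..6::nat}. phi_bound (L * M) ^ 3)"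
      unfolding prod_norm[symmetric] by (intro prod_mono conjI norm_ge_zero tail)
    then show "norm (\<Prod>j\<in>{3..6::nat}. A j * B j * C j) \<le> (phi_bound (L * M) ^ 3) ^ 4" by simp
  qed
  also have "\<dots> = phi_bound (L * r) ^ 2 * phi_bound (L * M) ^ 15"
    by (simp add: eval_nat_numeral)
  finally have prod: "norm (\<Prod>j\<in>{1..6}. A j * B j * C j) \<le> phi_bound (L * r) ^ 2 * phi_bound (L * M) ^ 15" .
  have "norm (1 - l\<^sup>2 * q ^ (2 * n)) \<le> 1 + L\<^sup>2"
  proof -
    have "norm (1 - l\<^sup>2 * q ^ (2 * n)) \<le> 1 + norm l ^ 2 * norm q ^ (2 * n)"
      using norm_triangle_ineq4[of 1 "l\<^sup>2 * q ^ (2 * n)"] by (simp add: norm_mult norm_power)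
    also have "norm l ^ 2 * norm q ^ (2 * n) \<le> L\<^sup>2 * 1"
      using l q1 L0 by (intro mult_mono power_mono power_le_one) auto
    finally show ?thesis by simp
  qed
  then have "norm (1 - l\<^sup>2 * q ^ (2 * n)) * norm q ^ n * norm (\<Prod>j\<in>{1..6}. A j * B j * C j) \<le>
      (1 + L\<^sup>2) * norm q ^ n * (phi_bound (L * r) ^ 2 * phi_bound (L * M) ^ 15)"
    using prod by (intro mult_mono) auto
  then show ?thesis
    unfolding bilateral_term_nat[OF b l(1)] A_def B_def C_def
    by (simp add: norm_mult norm_power mult_ac)
qed

lemma norm_bilateral_term_le:
  assumes b: "balanced b" and l: "l \<noteq> 0" "norm l \<le> L" "1 / norm l \<le> L"
    and r: "norm (b 1) \<le> r" "1 / norm (b 2) \<le> r"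
    and M: "1 / norm (b 1) \<le> M" "norm (b 2) \<le> M"
      "\<And>j. j \<in> {3..6} \<Longrightarrow> norm (b j) \<le> M" "\<And>j. j \<in> {3..6} \<Longrightarrow> 1 / norm (b j) \<le> M"
  shows "norm (bilateral_term b l x) \<le>
    norm q ^ nat \<bar>x\<bar> * (L\<^sup>2 * ((1 + L\<^sup>2) * phi_bound (L * r) ^ 2 * phi_bound (L * M) ^ 15))"
proof -
  define K where "K = (1 + L\<^sup>2) * phi_bound (L * r) ^ 2 * phi_bound (L * M) ^ 15"
  have L0: "0 \<le> L" "0 \<le> r" "0 \<le> M"
    using l(2) r(1) M(2) by (meson norm_ge_zero order_trans)+
  have K: "0 \<le> K" using phi_bound_ge_1[of "L * M"] L0 by (simp add: K_def)
  have "1 \<le> L"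
    using l by (cases "norm l \<ge> 1") (auto simp: field_simps intro: order_trans)
  then have L2: "1 \<le> L\<^sup>2" by simp
  show ?thesis
  proof (cases "x \<ge> 0")
    case True
    then have "norm (bilateral_term b l x) \<le> norm q ^ nat \<bar>x\<bar> * K"
      using norm_bilateral_term_nat_le[OF b l r M, of "nat x"] by (simp add: K_def)
    also have "\<dots> \<le> norm q ^ nat \<bar>x\<bar> * (L\<^sup>2 * K)"
      using K L2 by (intro mult_left_mono) (auto intro: mult_right_mono[of 1 "L\<^sup>2" K, simplified])
    finally show ?thesis by (simp add: K_def)
  next
    case False
    define n where "n = nat (- x)"
    have x: "x = - int n" using False by (simp add: n_def)
    have "norm (bilateral_term b (1 / l) (int n)) \<le> norm q ^ n * K"
      using norm_bilateral_term_nat_le[of b "1 / l" L r M, OF b _ _ _ r M] l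
      by (simp add: K_def norm_divide)
    then have "L\<^sup>2 * (norm q ^ n * K) \<ge> norm l ^ 2 * norm (bilateral_term b (1 / l) (int n))"
      using l by (intro mult_mono power_mono) auto
    moreover have "bilateral_term b l x = - (l\<^sup>2) * bilateral_term b (1 / l) (int n)"
      using bilateral_term_inverse[OF l(1), of b "int n"] l(1) by (simp add: x)
    ultimately show ?thesis
      by (simp add: x K_def norm_mult norm_power mult_ac)
  qed
qed

lemma summable_q_abs_int: "(\<lambda>x::int. norm q ^ nat \<bar>x\<bar>) summable_on UNIV"
proof -
  have geo: "(\<lambda>n. norm q ^ n) summable_on (UNIV :: nat set)"
    using q_less_1 by (intro norm_summable_imp_summable_on) (simp add: summable_geometric)
  have "(\<lambda>x. norm q ^ nat \<bar>x\<bar>) summable_on range int"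
    using geo by (subst summable_on_reindex) (auto simp: o_def)
  moreover have "(\<lambda>x. norm q ^ nat \<bar>x\<bar>) summable_on range (\<lambda>n. - int n)"
    using geo by (subst summable_on_reindex) (auto simp: o_def inj_on_def)
  ultimately have "(\<lambda>x. norm q ^ nat \<bar>x\<bar>) summable_on (range int \<union> range (\<lambda>n. - int n))"
    by (rule summable_on_union)
  moreover have "range int \<union> range (\<lambda>n. - int n) = UNIV"
  proof -
    have "x \<in> range int \<union> range (\<lambda>n. - int n)" for x :: int
      by (cases x rule: int_cases2) auto
    then show ?thesis by blast
  qed
  ultimately show ?thesis by simp
qed

text \<open>Locally uniform domination by \<open>\<bar>q\<bar>\<^bsup>\<bar>x\<bar>\<^esup>\<close> is enough by the
  Weierstrass test.\<close>

lemma holomorphic_on_bilateral_infsum: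
  fixes f :: "int \<Rightarrow> complex \<Rightarrow> complex"
  assumes hol: "\<And>x. f x holomorphic_on S"
    and bound: "\<And>a. a \<in> S \<Longrightarrow> \<exists>r>0. \<exists>K. cball a r \<subseteq> S \<and> (\<forall>z\<in>cball a r. \<forall>x. norm (f x z) \<le> norm q ^ nat \<bar>x\<bar> * K)"
  shows "(\<lambda>z. \<Sum>\<^sub>\<infinity>x\<in>UNIV. f x z) holomorphic_on S"
proof -
  have "(\<lambda>z. \<Sum>\<^sub>\<infinity>x\<in>UNIV. f x z) field_differentiable at a" if a: "a \<in> S" for a
  proof -
    obtain r K where r: "r > 0" "cball a r \<subseteq> S"
      and K: "\<And>z x. z \<in> cball a r \<Longrightarrow> norm (f x z) \<le> norm q ^ nat \<bar>x\<bar> * K"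
      using bound[OF a] by blast
    have lim: "uniform_limit (cball a r) (\<lambda>X z. \<Sum>x\<in>X. f x z) (\<lambda>z. \<Sum>\<^sub>\<infinity>x\<in>UNIV. f x z) (finite_subsets_at_top UNIV)"
      by (rule Weierstrass_m_test_general[of _ _ _ "\<lambda>x. norm q ^ nat \<bar>x\<bar> * K"])
         (auto intro!: K summable_on_cmult_left summable_q_abs_int)
    have "(\<lambda>z. \<Sum>\<^sub>\<infinity>x\<in>UNIV. f x z) holomorphic_on ball a r"
    proof (rule holomorphic_uniform_limit[OF _ lim])
      have cball: "(\<lambda>z. \<Sum>x\<in>X. f x z) holomorphic_on cball a r" for X
        by (intro holomorphic_on_sum holomorphic_on_subset[OF hol] r)
      have ball: "(\<lambda>z. \<Sum>x\<in>X. f x z) holomorphic_on ball a r" for X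
        by (rule holomorphic_on_subset[OF cball]) auto
      show "eventually (\<lambda>X. continuous_on (cball a r) (\<lambda>z. \<Sum>x\<in>X. f x z) \<and>
          (\<lambda>z. \<Sum>x\<in>X. f x z) holomorphic_on ball a r) (finite_subsets_at_top UNIV)"
        using holomorphic_on_imp_continuous_on[OF cball] ball by (intro always_eventually) auto
    qed auto
    then show ?thesis
      using r(1) by (intro holomorphic_on_imp_differentiable_at[of _ "ball a r"]) auto
  qed
  then show ?thesis by (simp add: holomorphic_on_def field_differentiable_at_within)
qed

lemma balanced_size_bound:
  assumes "balanced b"
  obtains M where "\<And>j. j \<in> {1..6} \<Longrightarrow> norm (b j) \<le> M" "\<And>j. j \<in> {1..6} \<Longrightarrow> 1 / norm (b j) \<le> M"
proof
  fix j :: nat assume j: "j \<in> {1..6}"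
  have "norm (b j) + 1 / norm (b j) \<le> (\<Sum>j\<in>{1..6}. norm (b j) + 1 / norm (b j))"
    using j by (intro member_le_sum) auto
  then show "norm (b j) \<le> (\<Sum>j\<in>{1..6}. norm (b j) + 1 / norm (b j))"
    "1 / norm (b j) \<le> (\<Sum>j\<in>{1..6}. norm (b j) + 1 / norm (b j))"
    by (smt (verit) norm_ge_zero divide_nonneg_nonneg)+
qed

lemma summable_bilateral_term:
  assumes b: "balanced b" and l: "l \<noteq> 0"
  shows "bilateral_term b l summable_on UNIV"
proof -
  obtain M where M: "\<And>j. j \<in> {1..6} \<Longrightarrow> norm (b j) \<le> M" "\<And>j. j \<in> {1..6} \<Longrightarrow> 1 / norm (b j) \<le> M"
    using balanced_size_bound[OF b] by blast
  define L where "L = max (norm l) (1 / norm l)"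
  show ?thesis
    by (rule abs_summable_summable, rule Infinite_Sum.abs_summable_on_comparison_test',
        rule summable_on_cmult_left[OF summable_q_abs_int],
        rule norm_bilateral_term_le[OF b l, of L M M])
       (auto intro!: M simp: L_def)
qed

lemma holomorphic_weight_G [holomorphic_intros]:
  assumes "f holomorphic_on S" "\<And>z. z \<in> S \<Longrightarrow> f z \<noteq> 0" "\<And>j. j \<in> {1..6} \<Longrightarrow> b j \<noteq> 0"
  shows "(\<lambda>z. weight_G b (f z)) holomorphic_on S"
  unfolding weight_G_def using assms by (intro holomorphic_intros) auto

lemma holomorphic_bilateral_sum:
  assumes b: "balanced b"
  shows "bilateral_sum b holomorphic_on - {0}"
proof -
  obtain M where M: "\<And>j. j \<in> {1..6} \<Longrightarrow> norm (b j) \<le> M" "\<And>j. j \<in> {1..6} \<Longrightarrow> 1 / norm (b j) \<le> M"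
    using balanced_size_bound[OF b] by blast
  have "(\<lambda>l. \<Sum>\<^sub>\<infinity>x\<in>UNIV. bilateral_term b l x) holomorphic_on - {0}"
  proof (rule holomorphic_on_bilateral_infsum)
    show "(\<lambda>l. bilateral_term b l x) holomorphic_on - {0}" for x
      unfolding bilateral_term_def using b
      by (intro holomorphic_intros) (auto simp: balanced_def)
    fix a :: complex assume a: "a \<in> - {0}"
    define L where "L = max (2 * norm a) (2 / norm a)"
    have L: "norm l \<le> L" "1 / norm l \<le> L" "l \<noteq> 0" if "l \<in> cball a (norm a / 2)" for l
    proof -
      have d: "norm (a - l) \<le> norm a / 2" using that by (simp add: dist_norm)
      have "norm l \<le> 2 * norm a"
        using norm_triangle_sub[of l a] d norm_ge_zero[of a] norm_minus_commute[of l a] by linarith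
      then show "norm l \<le> L" by (simp add: L_def)
      have low: "norm a / 2 \<le> norm l"
        using norm_triangle_sub[of a l] d by simp
      then show "l \<noteq> 0" using a by auto
      have "1 / norm l \<le> 1 / (norm a / 2)"
        using low a by (intro divide_left_mono mult_pos_pos) auto
      then show "1 / norm l \<le> L" by (simp add: L_def)
    qed
    show "\<exists>r>0. \<exists>K. cball a r \<subseteq> - {0} \<and>
        (\<forall>l\<in>cball a r. \<forall>x. norm (bilateral_term b l x) \<le> norm q ^ nat \<bar>x\<bar> * K)"
    proof (intro exI conjI ballI allI)
      show "0 < norm a / 2" using a by simp
      show "cball a (norm a / 2) \<subseteq> - {0}" using L(3) by blast
      show "norm (bilateral_term b l x) \<le> norm q ^ nat \<bar>x\<bar> * (L\<^sup>2 * ((1 + L\<^sup>2) * phi_bound (L * M) ^ 2 * phi_bound (L * M) ^ 15))"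
        if "l \<in> cball a (norm a / 2)" for l x
        by (rule norm_bilateral_term_le[OF b L(3,1,2)[OF that]]) (auto intro!: M)
    qed
  qed
  then show ?thesis unfolding bilateral_sum_def[abs_def] .
qed

lemma bilateral_sum_q:
  assumes "l \<noteq> 0"
  shows "bilateral_sum b (q * l) = bilateral_sum b l / (l ^ 6 * q\<^sup>2)"
proof -
  have "(\<Sum>\<^sub>\<infinity>x\<in>UNIV. bilateral_term b l (x + 1)) = bilateral_sum b l"
    unfolding bilateral_sum_def by (rule infsum_reindex_bij_betw) (rule bij_plus_right)
  then show ?thesis
    unfolding bilateral_sum_def[of b "q * l"] bilateral_term_shift[OF assms]
    by (simp add: divide_inverse infsum_cmult_left')
qed

lemma bilateral_sum_inverse:
  assumes "l \<noteq> 0"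
  shows "bilateral_sum b (1 / l) = - bilateral_sum b l / l\<^sup>2"
proof -
  have "(\<Sum>\<^sub>\<infinity>x\<in>UNIV. bilateral_term b l (- x)) = bilateral_sum b l"
    unfolding bilateral_sum_def by (rule infsum_reindex_bij_betw) (rule bij_uminus)
  moreover have "bilateral_term b (1 / l) = (\<lambda>x. bilateral_term b l (- x) * (- 1 / l\<^sup>2))"
    by (rule ext) (simp add: bilateral_term_inverse[OF assms])
  moreover have "(\<Sum>\<^sub>\<infinity>x\<in>UNIV. bilateral_term b l (- x) * (- 1 / l\<^sup>2)) =
      (\<Sum>\<^sub>\<infinity>x\<in>UNIV. bilateral_term b l (- x)) * (- 1 / l\<^sup>2)"
    by (rule infsum_cmult_left')
  ultimately show ?thesis
    unfolding bilateral_sum_def[of b "1 / l"] by simp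
qed

lemma theta_bracket_q:
  assumes b: "balanced b" and m: "m \<noteq> 0"
  shows "theta_bracket b (q * m) = theta_bracket b m / (q * m ^ 6)"
proof -
  have b0: "b j \<noteq> 0" if "j \<in> {1..6}" for j using b that by (auto simp: balanced_def)
  have "(\<Prod>j\<in>{1..6}. theta (q * m * b j)) = (\<Prod>j\<in>{1..6}. - theta (m * b j) / (m * b j))"
    using b0 m by (intro prod.cong refl) (simp add: theta_q[of "m * b _"] mult.assoc)
  also have "\<dots> = (\<Prod>j\<in>{1..6}. theta (m * b j)) / (q * m ^ 6)"
    using b by (simp add: prod_dividef prod.distrib prod_uminus balanced_def mult.commute)
  finally have 1: "(\<Prod>j\<in>{1..6}. theta (q * m * b j)) = (\<Prod>j\<in>{1..6}. theta (m * b j)) / (q * m ^ 6)" .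
  have "(\<Prod>j\<in>{1..6}. theta (q * m / b j)) = (\<Prod>j\<in>{1..6}. - theta (m / b j) / (m / b j))"
    using b0 m by (intro prod.cong refl) (simp add: theta_q[of "m / b _", simplified times_divide_eq_right])
  also have "\<dots> = (\<Prod>j\<in>{1..6}. theta (m / b j)) * q / m ^ 6"
    using b by (simp add: prod_dividef prod.distrib prod_uminus balanced_def)
  finally have 2: "(\<Prod>j\<in>{1..6}. theta (q * m / b j)) = (\<Prod>j\<in>{1..6}. theta (m / b j)) * q / m ^ 6" .
  show ?thesis unfolding theta_bracket_def 1 2 using m
    by (simp add: field_simps power2_eq_square)
qed

lemma theta_bracket_inverse:
  assumes b: "balanced b" and m: "m \<noteq> 0"
  shows "theta_bracket b (1 / m) = - theta_bracket b m / m ^ 4"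
proof -
  have b0: "b j \<noteq> 0" if "j \<in> {1..6}" for j using b that by (auto simp: balanced_def)
  have "(\<Prod>j\<in>{1..6}. theta (1 / m * b j)) = (\<Prod>j\<in>{1..6}. - theta (m / b j) / (m / b j))"
    using b0 m theta_inverse[of "m / b _"] by (intro prod.cong refl) simp
  also have "\<dots> = (\<Prod>j\<in>{1..6}. theta (m / b j)) * q / m ^ 6"
    using b by (simp add: prod_dividef prod.distrib prod_uminus balanced_def)
  finally have 1: "(\<Prod>j\<in>{1..6}. theta (1 / m * b j)) = (\<Prod>j\<in>{1..6}. theta (m / b j)) * q / m ^ 6" .
  have "(\<Prod>j\<in>{1..6}. theta (1 / m / b j)) = (\<Prod>j\<in>{1..6}. - theta (m * b j) / (m * b j))"
    using b0 m theta_inverse[of "m * b _"] by (intro prod.cong refl) simp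
  also have "\<dots> = (\<Prod>j\<in>{1..6}. theta (m * b j)) / (q * m ^ 6)"
    using b by (simp add: prod_dividef prod.distrib prod_uminus balanced_def mult.commute)
  finally have 2: "(\<Prod>j\<in>{1..6}. theta (1 / m / b j)) = (\<Prod>j\<in>{1..6}. theta (m * b j)) / (q * m ^ 6)" .
  show ?thesis unfolding theta_bracket_def 1 2 using m
    by (simp add: field_simps power2_eq_square eval_nat_numeral)
qed

lemma holomorphic_theta_bracket:
  assumes "balanced b"
  shows "theta_bracket b holomorphic_on - {0}"
  unfolding theta_bracket_def[abs_def] using assms
  by (intro holomorphic_intros) (auto simp: balanced_def)

section \<open>Determinants of theta functions of type BC\<close>

text \<open>After division by \<open>\<theta>(t\<^bsup>2\<^esup>)\<close> and a power of \<open>t\<close> these are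
  the theta functions of degree one that are invariant under \<open>t \<mapsto> 1 / t\<close>, a space of
  dimension two.\<close>

definition BC_theta :: "(complex \<Rightarrow> complex) \<Rightarrow> bool" where
  "BC_theta f \<longleftrightarrow> f holomorphic_on - {0} \<and>
     (\<forall>t. t \<noteq> 0 \<longrightarrow> f (q * t) = f t / (q * t ^ 6) \<and> f (1 / t) = - f t / t ^ 4)"

text \<open>As a function of \<open>l\<close>, it spans the functions in \<open>BC_theta\<close> that vanish at
  \<open>m\<close>.\<close>

definition theta_kernel :: "complex \<Rightarrow> complex \<Rightarrow> complex" where
  "theta_kernel l m = l * theta (l\<^sup>2) * theta (m\<^sup>2) * theta (l * m) * theta (m / l)"

text \<open>The condition under which the theta kernel does not vanish.\<close>

definition generic_pair :: "complex \<Rightarrow> complex \<Rightarrow> bool" where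
  "generic_pair x y \<longleftrightarrow> x \<noteq> 0 \<and> y \<noteq> 0 \<and> x\<^sup>2 \<notin> q_powers q \<and> y\<^sup>2 \<notin> q_powers q \<and>
     x * y \<notin> q_powers q \<and> y / x \<notin> q_powers q"

lemma theta_kernel_nonzero: "generic_pair l m \<Longrightarrow> theta_kernel l m \<noteq> 0"
  by (simp add: generic_pair_def theta_kernel_def theta_eq_0_iff)

lemma theta_kernel_antisym:
  assumes "l \<noteq> 0" "m \<noteq> 0"
  shows "theta_kernel m l = - theta_kernel l m"
  using theta_inverse[of "m / l"] assms
  by (simp add: theta_kernel_def mult.commute)

lemma BC_theta_bilateral_sum: "balanced b \<Longrightarrow> BC_theta (\<lambda>l. l * bilateral_sum b l)"
  unfolding BC_theta_def
proof (intro conjI allI impI)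
  fix t :: complex assume "t \<noteq> 0"
  then show "q * t * bilateral_sum b (q * t) = t * bilateral_sum b t / (q * t ^ 6)"
    by (subst bilateral_sum_q) (simp_all add: power2_eq_square)
  show "1 / t * bilateral_sum b (1 / t) = - (t * bilateral_sum b t) / t ^ 4"
    using \<open>t \<noteq> 0\<close> by (subst bilateral_sum_inverse) (simp_all add: field_simps eval_nat_numeral)
qed (intro holomorphic_intros holomorphic_bilateral_sum)

lemma BC_theta_theta_bracket: "balanced b \<Longrightarrow> BC_theta (theta_bracket b)"
  by (simp add: BC_theta_def holomorphic_theta_bracket theta_bracket_q theta_bracket_inverse)

lemma BC_theta_kernel:
  assumes "m \<noteq> 0"
  shows "BC_theta (\<lambda>l. theta_kernel l m)"
  unfolding BC_theta_def
proof (intro conjI allI impI)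
  show "(\<lambda>l. theta_kernel l m) holomorphic_on - {0}"
    unfolding theta_kernel_def using assms by (intro holomorphic_intros) auto
  fix t :: complex assume t: "t \<noteq> 0"
  have "theta ((q * t)\<^sup>2) = theta (q * (q * t\<^sup>2))" by (simp add: power2_eq_square mult_ac)
  also have "\<dots> = theta (t\<^sup>2) / (q * t ^ 4)"
    using t by (simp add: theta_q field_simps eval_nat_numeral)
  finally have 1: "theta ((q * t)\<^sup>2) = theta (t\<^sup>2) / (q * t ^ 4)" .
  have 2: "theta (q * t * m) = - theta (t * m) / (t * m)"
    using theta_q[of "t * m"] t assms by (simp add: mult.assoc)
  have 3: "theta (m / (q * t)) = - (m / (q * t)) * theta (m / t)"
    using theta_q[of "m / (q * t)"] t assms by (simp add: field_simps)
  show "theta_kernel (q * t) m = theta_kernel t m / (q * t ^ 6)"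
    unfolding theta_kernel_def 1 2 3 using t assms by (simp add: field_simps eval_nat_numeral)
  have 4: "theta ((1 / t)\<^sup>2) = - theta (t\<^sup>2) / t\<^sup>2"
    using theta_inverse[of "t\<^sup>2"] t by (simp add: power_divide)
  show "theta_kernel (1 / t) m = - theta_kernel t m / t ^ 4"
    unfolding theta_kernel_def 4 using t by (simp add: field_simps eval_nat_numeral)
qed

lemma BC_theta_combination:
  "BC_theta f \<Longrightarrow> BC_theta g \<Longrightarrow> BC_theta (\<lambda>t. f t * c - g t * d)"
  unfolding BC_theta_def by (auto intro!: holomorphic_intros simp: diff_divide_distrib)

lemma BC_theta_zero_class:
  assumes f: "BC_theta f" and a: "a \<noteq> 0" "f a = 0"
  shows "f (a * q powi k) = 0"
proof (induction k rule: int_induct[of _ 0])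
  case base then show ?case using a by simp
next
  case (step1 i)
  have "f (q * (a * q powi i)) = 0" using f a step1 by (simp add: BC_theta_def)
  then show ?case by (simp add: power_int_add mult_ac)
next
  case (step2 i)
  have "f (q * (a * q powi (i - 1))) = 0" using step2 by (simp add: power_int_diff mult_ac)
  moreover have "f (q * (a * q powi (i - 1))) = f (a * q powi (i - 1)) / (q * (a * q powi (i - 1)) ^ 6)"
    using f a unfolding BC_theta_def by simp
  ultimately show ?case using a by simp
qed

lemma neg_one_notin_q_powers: "- 1 \<notin> q_powers q"
proof
  assume "- 1 \<in> q_powers q"
  then obtain k where k: "q powi k = - 1" by (auto simp: q_powers_def)
  then have "q powi (k + k) = 1" by (subst power_int_add) simp_all
  then have "k = 0" by (simp add: q_powi_eq_1_iff)
  with k show False by simp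
qed

lemma sqrt_q_notin_q_powers: "s\<^sup>2 = q \<Longrightarrow> s \<notin> q_powers q"
proof
  assume s: "s\<^sup>2 = q" and "s \<in> q_powers q"
  then obtain k where k: "s = q powi k" by (auto simp: q_powers_def)
  have "q powi (k + k - 1) = q powi k * q powi k / q"
    by (subst power_int_diff, simp, subst power_int_add) simp_all
  then have "q powi (k + k - 1) = 1" using s k by (simp add: power2_eq_square)
  then have "k + k - 1 = 0" by (simp only: q_powi_eq_1_iff)
  then show False by presburger
qed

text \<open>The functions in \<^const>\<open>BC_theta\<close> vanish at the four classes of square roots of powers of
  \<open>q\<close>. With the classes of \<open>m\<close>, \<open>1 / m\<close> and \<open>n\<close> there are seven classes of zeros, one more than the degree
  six of the theta functions allows.\<close>

lemma BC_theta_eq_0: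
  assumes f: "BC_theta f" and zero: "f m = 0" "f n = 0" and gen: "generic_pair n m" and w: "w \<noteq> 0"
  shows "f w = 0"
proof -
  have nm: "n \<noteq> 0" "m \<noteq> 0" "n\<^sup>2 \<notin> q_powers q" "m\<^sup>2 \<notin> q_powers q" "n * m \<notin> q_powers q" "m / n \<notin> q_powers q"
    using gen by (auto simp: generic_pair_def)
  \<comment> \<open>The square roots of powers of \<open>q\<close> form the classes of \<open>1\<close>, \<open>-1\<close>, \<open>s\<close> and \<open>-s\<close>.\<close>
  define s where "s = csqrt q"
  have s: "s\<^sup>2 = q" "s \<noteq> 0" by (simp_all add: s_def)
  define R where "R = {1, -1, s, - s}"
  have inv: "f (1 / t) = - f t / t ^ 4" "f (q * t) = f t / (q * t ^ 6)" if "t \<noteq> 0" for t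
    using f that by (auto simp: BC_theta_def)
  have ratio_R: "a / b \<notin> q_powers q" if "a \<in> R" "b \<in> R" "a \<noteq> b" for a b
  proof -
    have "s \<notin> q_powers q" "- s \<notin> q_powers q" 
      using sqrt_q_notin_q_powers[of s] sqrt_q_notin_q_powers[of "- s"] s(1) by simp_all
    moreover have "- (1 / s) \<in> q_powers q \<longleftrightarrow> - s \<in> q_powers q"
      using q_powers_inverse_iff[of "- s"] by simp
    ultimately show ?thesis
      using that s(2) neg_one_notin_q_powers q_powers_inverse_iff[of s]
      unfolding R_def by auto
  qed
  have sq_R: "a\<^sup>2 \<in> q_powers q" "a \<noteq> 0" if "a \<in> R" for a
    using that by (auto simp: R_def s)
  have cross_R: "x / a \<notin> q_powers q" "a / x \<notin> q_powers q" if "x\<^sup>2 \<notin> q_powers q" "a \<in> R" for x a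
  proof -
    have "x / a \<notin> q_powers q"
    proof
      assume "x / a \<in> q_powers q"
      then have "(x / a) * (x / a) * a\<^sup>2 \<in> q_powers q" using sq_R(1)[OF that(2)] by (intro q_powers_mult)
      then show False using that sq_R(2)[OF that(2)] by (simp add: power2_eq_square)
    qed
    then show "x / a \<notin> q_powers q" "a / x \<notin> q_powers q" using q_powers_inverse_iff[of "x / a"] by auto
  qed
  have zero_R: "f a = 0" if "a \<in> R" for a
  proof -
    have "f 1 = 0" "f (- 1) = 0" using inv(1)[of 1] inv(1)[of "- 1"] by auto
    moreover have "f t = 0" if "t\<^sup>2 = q" "t \<noteq> 0" for t
    proof -
      have "f t = f (q * (1 / t))" using that by (simp add: power2_eq_square field_simps flip: that(1))
      also have "\<dots> = (- f t / t ^ 4) / (q * (1 / t) ^ 6)"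
        using inv(2)[of "1 / t"] inv(1)[of t] that by simp
      also have "\<dots> = - f t"
        using that by (simp add: field_simps eval_nat_numeral flip: that(1))
      finally show ?thesis by simp
    qed
    from this[of s] this[of "- s"] have "f s = 0" "f (- s) = 0" using s by auto
    ultimately show ?thesis using that by (auto simp: R_def)
  qed
  define A where "A = R \<union> {m, 1 / m, n}"
  have inv_sq: "(1 / m)\<^sup>2 \<notin> q_powers q" using q_powers_inverse_iff[of "m\<^sup>2"] nm by (simp add: power_divide)
  have mm: "m / (1 / m) \<notin> q_powers q" "1 / m / m \<notin> q_powers q"
    using nm inv_sq by (simp_all add: power2_eq_square)
  have nm': "n / m \<notin> q_powers q" "n / (1 / m) \<notin> q_powers q" "1 / m / n \<notin> q_powers q"
    using nm q_powers_inverse_iff[of "m / n"] q_powers_inverse_iff[of "n * m"] by (simp_all add: mult.commute)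
  have ratio: "a / b \<notin> q_powers q" if "a \<in> A" "b \<in> A" "a \<noteq> b" for a b
    using that ratio_R[of a b] cross_R[OF nm(4)] cross_R[OF inv_sq] cross_R[OF nm(3)] mm nm' nm(6)
    unfolding A_def by auto
  have card: "6 < card A"
  proof -
    have one: "x / x \<in> q_powers q" if "x \<noteq> 0" for x using that by simp
    have ne: "x \<noteq> y" if "x / y \<notin> q_powers q" "y \<noteq> 0" for x y using one[of y] that by auto
    have "s \<notin> q_powers q" "- s \<notin> q_powers q" by (rule sqrt_q_notin_q_powers, simp add: s(1))+
    then have "s \<noteq> 1" "- s \<noteq> 1" using q_power_in_q_powers(3) by metis+
    then have "1 \<noteq> s" "1 \<noteq> - s" "- 1 \<noteq> s" by auto
    then have "card R = 4" unfolding R_def using s(2) by (simp add: card_insert_if)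
    moreover have "finite R" by (simp add: R_def)
    moreover have "m \<notin> R" "1 / m \<notin> R" "n \<notin> R" "m \<noteq> 1 / m" "m \<noteq> n" "1 / m \<noteq> n"
      using sq_R(1) nm inv_sq ne[OF mm(1)] ne[OF nm(6)] ne[OF nm'(3)] nm(1,2) by (blast, blast, blast, auto)
    ultimately show ?thesis by (simp add: A_def card_insert_if)
  qed
  have zero_A: "f a = 0" if "a \<in> A" for a
    using that zero_R zero inv(1)[of m] nm by (auto simp: A_def)
  have A0: "0 \<notin> A" using sq_R(2) nm by (auto simp: A_def)
  show ?thesis
  proof (rule theta_growth_too_many_zeros[where d = 6 and A = A and f = f, OF _ _ _ A0 card _ _ w])
    show "f holomorphic_on - {0}" using f by (simp add: BC_theta_def)
    then show "theta_growth 6 f"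
      by (rule theta_growthI_quasi_periodic[of _ "1 / q"]) (simp_all add: inv)
    show "finite A" by (simp add: A_def R_def)
    show "f (a * q powi k) = 0" if "a \<in> A" for a k
      using that A0 by (intro BC_theta_zero_class[OF f] zero_A) auto
    show "a / b \<notin> q_powers q" if "a \<in> A" "b \<in> A" "a \<noteq> b" for a b using ratio that by blast
  qed
qed

text \<open>The zero at \<open>m\<close> leaves one degree of freedom: a suitable combination of \<open>f\<close> and
  the theta kernel has a further zero at \<open>n\<close>, one too many.\<close>

lemma BC_theta_two_values:
  assumes f: "BC_theta f" and zero: "f m = 0" and gen: "generic_pair n m" and l: "l \<noteq> 0"
  shows "f l * theta_kernel n m = f n * theta_kernel l m"
proof -
  have m: "m \<noteq> 0" and n: "n \<noteq> 0" using gen by (auto simp: generic_pair_def)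
  have "theta 1 = 0" by (simp add: theta_eq_0_iff)
  then have "theta_kernel m m = 0" using m by (simp add: theta_kernel_def)
  then have "f l * theta_kernel n m - theta_kernel l m * f n = 0"
    by (intro BC_theta_eq_0[OF BC_theta_combination[OF f BC_theta_kernel[OF m]] _ _ gen l])
       (simp_all add: zero)
  then show ?thesis by (simp add: mult.commute)
qed

definition pair_product :: "(nat \<Rightarrow> complex) \<Rightarrow> complex" where
  "pair_product b = (\<Prod>i\<in>{1..6}. \<Prod>j\<in>{i<..6}. phi (q / (b i * b j)))"

text \<open>The two-term identity for \<open>f = 1\<close> says that this difference vanishes.\<close>

definition defect :: "(nat \<Rightarrow> complex) \<Rightarrow> complex \<Rightarrow> complex \<Rightarrow> complex" where
  "defect b l m = l * bilateral_sum b l * theta_bracket b m - m * bilateral_sum b m * theta_bracket b l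
     - theta_kernel l m * (phi q * pair_product b)"

lemma defect_antisym:
  assumes "l \<noteq> 0" "m \<noteq> 0"
  shows "defect b m l = - defect b l m"
  using theta_kernel_antisym[OF assms] by (simp add: defect_def)

text \<open>For fixed \<open>m\<close> both parts of the defect are multiples of the same theta kernel, so a single
  point \<open>n\<close> decides.\<close>

lemma defect_eq_0_move:
  assumes b: "balanced b" and gen: "generic_pair n m" and zero: "defect b n m = 0" and l: "l \<noteq> 0"
  shows "defect b l m = 0"
proof -
  define W where "W = (\<lambda>t. t * bilateral_sum b t * theta_bracket b m - theta_bracket b t * (m * bilateral_sum b m))"
  have m: "m \<noteq> 0" using gen by (simp add: generic_pair_def)
  have "BC_theta W"
    unfolding W_def by (intro BC_theta_combination BC_theta_bilateral_sum BC_theta_theta_bracket b)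
  then have "W l * theta_kernel n m = W n * theta_kernel l m"
    by (rule BC_theta_two_values[OF _ _ gen l]) (simp add: W_def)
  moreover have D: "defect b t m = W t - theta_kernel t m * (phi q * pair_product b)" for t
    by (simp add: defect_def W_def mult.commute)
  ultimately have "theta_kernel n m * defect b l m = theta_kernel l m * defect b n m"
    unfolding D by (simp add: algebra_simps)
  then show ?thesis using zero theta_kernel_nonzero[OF gen] by simp
qed

section \<open>Permutations\<close>

lemma weight_G_permute: "p permutes {1..6} \<Longrightarrow> weight_G (b \<circ> p) z = weight_G b z"
  unfolding weight_G_def
  by (subst (2) prod.permute[of p]) (simp_all add: o_def)

lemma bilateral_sum_permute: "p permutes {1..6} \<Longrightarrow> bilateral_sum (b \<circ> p) l = bilateral_sum b l"
  by (simp add: bilateral_sum_def bilateral_term_def weight_G_permute)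

lemma theta_bracket_permute:
  assumes "p permutes {1..6}"
  shows "theta_bracket (b \<circ> p) m = theta_bracket b m"
  using prod.permute[OF assms, of "\<lambda>j. theta (m * b j)"] prod.permute[OF assms, of "\<lambda>j. theta (m / b j)"]
  by (simp add: theta_bracket_def o_def)

lemma balanced_permute:
  assumes "p permutes {1..6}"
  shows "balanced (b \<circ> p) \<longleftrightarrow> balanced b"
proof -
  have "(\<forall>j\<in>{1..6}. b (p j) \<noteq> 0) \<longleftrightarrow> (\<forall>j\<in>p ` {1..6}. b j \<noteq> 0)" by blast
  then have "(\<forall>j\<in>{1..6}. b (p j) \<noteq> 0) \<longleftrightarrow> (\<forall>j\<in>{1..6}. b j \<noteq> 0)"
    by (simp only: permutes_image[OF assms])
  moreover have "(\<Prod>j\<in>{1..6}. b (p j)) = (\<Prod>j\<in>{1..6}. b j)"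
    using prod.permute[OF assms, of b] by (simp add: o_def)
  ultimately show ?thesis by (simp only: balanced_def o_def)
qed

text \<open>Indexing by two-element sets makes the symmetry in the parameters visible.\<close>

lemma pair_product_subsets:
  "pair_product b = (\<Prod>e\<in>{e. e \<subseteq> {1..6} \<and> card e = 2}. phi (q / (\<Prod>i\<in>e. b i)))"
proof -
  have "(\<Prod>e\<in>{e. e \<subseteq> {1..6::nat} \<and> card e = 2}. phi (q / (\<Prod>i\<in>e. b i))) =
      (\<Prod>(i, j)\<in>(SIGMA i:{1..6}. {i<..6}). phi (q / (b i * b j)))"
  proof (rule prod.reindex_bij_witness[of _ "\<lambda>(i, j). {i, j}" "\<lambda>e. (Min e, Max e)"])
    fix e assume "e \<in> {e. e \<subseteq> {1..6::nat} \<and> card e = 2}"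
    then obtain i j where e: "e = {i, j}" "i < j" "i \<in> {1..6}" "j \<in> {1..6}"
      by (auto simp: card_2_iff) (metis insert_commute linorder_neqE_nat)
    then show "(case (Min e, Max e) of (i, j) \<Rightarrow> {i, j}) = e"
      "(Min e, Max e) \<in> (SIGMA i:{1..6}. {i<..6})"
      "(case (Min e, Max e) of (i, j) \<Rightarrow> phi (q / (b i * b j))) = phi (q / (\<Prod>i\<in>e. b i))"
      by auto
  qed auto
  then show ?thesis
    by (simp add: pair_product_def prod.Sigma)
qed

lemma pair_product_permute:
  assumes p: "p permutes {1..6}"
  shows "pair_product (b \<circ> p) = pair_product b"
proof -
  have inj: "inj p" using p by (rule permutes_inj)
  have bij: "bij_betw ((`) p) {e. e \<subseteq> {1..6} \<and> card e = 2} {e. e \<subseteq> {1..6} \<and> card e = 2}"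
    unfolding bij_betw_def
  proof
    show "inj_on ((`) p) {e. e \<subseteq> {1..6} \<and> card e = 2}"
      using inj by (simp add: inj_on_def inj_image_eq_iff)
    have sub: "p ` e \<subseteq> {1..6}" if "e \<subseteq> {1..6}" for e
      using that permutes_image[OF p] by blast
    have card: "card (p ` e) = card e" for e
      using inj by (metis card_image inj_on_subset subset_UNIV)
    show "(`) p ` {e. e \<subseteq> {1..6} \<and> card e = 2} = {e. e \<subseteq> {1..6} \<and> card e = 2}"
    proof (rule endo_inj_surj)
      show "(`) p ` {e. e \<subseteq> {1..6} \<and> card e = 2} \<subseteq> {e. e \<subseteq> {1..6} \<and> card e = 2}"
        unfolding image_subset_iff mem_Collect_eq card using sub by blast
    qed (use inj in \<open>auto simp: inj_on_def inj_image_eq_iff intro: finite_subset[of _ "Pow {1..6}"]\<close>)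
  qed
  have "(\<Prod>i\<in>e. (b \<circ> p) i) = (\<Prod>i\<in>p ` e. b i)" for e
    using inj by (subst prod.reindex) (auto simp: inj_on_def)
  then show ?thesis
    unfolding pair_product_subsets
    using prod.reindex_bij_betw[OF bij, of "\<lambda>e. phi (q / (\<Prod>i\<in>e. b i))"] by simp
qed

lemma defect_permute: "p permutes {1..6} \<Longrightarrow> defect (b \<circ> p) l m = defect b l m"
  by (simp add: defect_def bilateral_sum_permute theta_bracket_permute pair_product_permute)

lemma exists_permutation_3:
  assumes "i \<in> {1..6}" "j \<in> {1..6}" "k \<in> {1..6}" "i \<noteq> j" "i \<noteq> k" "j \<noteq> (k::nat)"
  obtains p where "p permutes {1..6}" "p 1 = i" "p 2 = j" "p 3 = k"
proof -
  define p1 where "p1 = Transposition.transpose 1 i"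
  define p2 where "p2 = p1 \<circ> Transposition.transpose 2 (p1 j)"
  define k' where "k' = Transposition.transpose 2 (p1 j) (p1 k)"
  define p3 where "p3 = p2 \<circ> Transposition.transpose 3 k'"
  have p1: "p1 permutes {1..6}"
    unfolding p1_def using assms by (intro permutes_swap_id) auto
  then have p1j: "p1 j \<in> {1..6}" "p1 k \<in> {1..6}" using assms by (simp_all only: permutes_in_image)
  have t2: "Transposition.transpose 2 (p1 j) permutes {1..6}"
    using p1j by (intro permutes_swap_id) auto
  then have p2: "p2 permutes {1..6}" unfolding p2_def using p1 by (rule permutes_compose)
  have k': "k' \<in> {1..6}" unfolding k'_def using t2 p1j by (simp only: permutes_in_image)
  have "Transposition.transpose 3 k' permutes {1..6}"
    using k' by (intro permutes_swap_id) auto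
  then have p3: "p3 permutes {1..6}" unfolding p3_def using p2 by (rule permutes_compose)
  have inj: "p1 x = p1 y \<longleftrightarrow> x = y" for x y using permutes_inj[OF p1] by (auto dest: injD)
  have p1i: "p1 1 = i" "p1 i = 1" by (simp_all add: p1_def)
  have ne: "p1 j \<noteq> 1" "p1 k \<noteq> 1" "p1 j \<noteq> p1 k" using assms inj p1i by metis+
  have k'ne: "k' \<noteq> 1" "k' \<noteq> 2"
    using ne by (auto simp: k'_def Transposition.transpose_def)
  have p1p1: "p1 (p1 x) = x" for x by (simp add: p1_def)
  have "p3 1 = i" "p3 2 = j"
    using k'ne ne by (auto simp: p3_def p2_def transpose_apply_other p1i p1p1 simp del: One_nat_def)
  moreover have "p3 3 = k" by (simp add: p3_def p2_def k'_def p1p1)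
  ultimately show ?thesis using that p3 by blast
qed

section \<open>Parameters with a product in the powers of q\<close>

lemma phi_powi_eq_0: "k \<le> 0 \<Longrightarrow> phi (q powi k) = 0"
  unfolding phi_eq_0_iff
  by (rule exI[of _ "nat (- k)"]) (simp add: power_int_def power_inverse)

lemma weight_G_eq_0:
  assumes "j \<in> {1..6}" "phi (q * z / b j) = 0 \<or> phi (q * inverse z / b j) = 0"
  shows "weight_G b z = 0"
  unfolding weight_G_def using assms by (subst prod_zero_iff) auto

text \<open>The factor of \<open>G\<close> belonging to \<open>b\<^sub>1\<close> cuts the series off on the left, and
  the one belonging to \<open>b\<^sub>2\<close> on the right.\<close>

lemma bilateral_term_b1_eq_0:
  assumes b: "balanced b" and prod: "b 1 * b 2 = q powi N" and x: "x < 0 \<or> x \<ge> 1 - N"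
  shows "bilateral_term b (b 1) x = 0"
proof -
  have b0: "b 1 \<noteq> 0" "b 2 \<noteq> 0" using b by (auto simp: balanced_def)
  have "q * (b 1 * q powi x) / b 1 = q powi (1 + x)"
    using b0 by (simp add: power_int_add)
  moreover have "q * inverse (b 1 * q powi x) / b 2 = q powi (1 - x - N)"
  proof -
    have "q * inverse (b 1 * q powi x) / b 2 = q / q powi x / (b 1 * b 2)"
      using b0 by (simp add: field_simps)
    then show ?thesis unfolding prod by (simp add: power_int_diff)
  qed
  ultimately have "weight_G b (b 1 * q powi x) = 0"
    using x weight_G_eq_0[of 1 "b 1 * q powi x" b] weight_G_eq_0[of 2 "b 1 * q powi x" b]
      phi_powi_eq_0[of "1 + x"] phi_powi_eq_0[of "1 - x - N"] by auto
  then show ?thesis by (simp add: bilateral_term_def)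
qed

lemma theta_q_power_eq_0: "theta (q powi k) = 0"
  using q_powersI[of "q powi k" k] by (simp add: theta_eq_0_iff)

lemma theta_1 [simp]: "theta 1 = 0"
  using theta_q_power_eq_0[of 0] by simp

lemma theta_bracket_eq_first:
  assumes "balanced b" "j \<in> {1..6}"
  shows "theta_bracket b (b j) = (\<Prod>i\<in>{1..6}. theta (b j * b i))"
proof -
  have "b j \<noteq> 0" using assms by (auto simp: balanced_def)
  then have "(\<Prod>i\<in>{1..6}. theta (b j / b i)) = 0"
    using assms(2) by (subst prod_zero_iff) (auto intro!: bexI[of _ j])
  then show ?thesis by (simp add: theta_bracket_def)
qed

lemma theta_bracket_b1_eq_0:
  assumes "balanced b" "b 1 * b 2 = q powi N"
  shows "theta_bracket b (b 1) = 0"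
proof -
  have "theta (b 1 * b 2) = 0" unfolding assms(2) by (rule theta_q_power_eq_0)
  then have "(\<Prod>i\<in>{1..6}. theta (b 1 * b i)) = 0"
    by (intro prod_zero bexI[of _ 2]) auto
  then show ?thesis using assms theta_bracket_eq_first[of b 1] by simp
qed

lemma pair_product_expand: "pair_product b =
   phi (q / (b 1 * b 2)) * phi (q / (b 1 * b 3)) * phi (q / (b 1 * b 4)) * phi (q / (b 1 * b 5)) * phi (q / (b 1 * b 6)) *
   phi (q / (b 2 * b 3)) * phi (q / (b 2 * b 4)) * phi (q / (b 2 * b 5)) * phi (q / (b 2 * b 6)) *
   phi (q / (b 3 * b 4)) * phi (q / (b 3 * b 5)) * phi (q / (b 3 * b 6)) *
   phi (q / (b 4 * b 5)) * phi (q / (b 4 * b 6)) * phi (q / (b 5 * b 6))"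
proof -
  have "{1..6} = {1, 2, 3, 4, 5, 6::nat}" "{1<..6} = {2, 3, 4, 5, 6::nat}" "{2<..6} = {3, 4, 5, 6::nat}"
    "{3<..6} = {4, 5, 6::nat}" "{4<..6} = {5, 6::nat}" "{5<..6} = {6::nat}"
    by auto
  then show ?thesis by (simp add: pair_product_def mult.assoc)
qed

lemma prod_6: "(\<Prod>j\<in>{1..6}. g j) = g 1 * g 2 * g 3 * g 4 * g 5 * g 6" for g :: "nat \<Rightarrow> complex"
proof -
  have "{1..6} = {1, 2, 3, 4, 5, 6::nat}" by auto
  then show ?thesis by (simp add: mult.assoc)
qed

text \<open>The cut-offs at both ends overlap, so that no term of the series at \<open>l = b\<^sub>1\<close> remains.\<close>

lemma defect_eq_0_positive_power:
  assumes b: "balanced b" and prod: "b 1 * b 2 = q ^ Suc n" and gen: "generic_pair (b 1) m" and l: "l \<noteq> 0"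
  shows "defect b l m = 0"
proof -
  have prod': "b 1 * b 2 = q powi (int (Suc n))" using prod by (simp only: power_int_of_nat)
  have "bilateral_term b (b 1) x = 0" for x
    by (rule bilateral_term_b1_eq_0[OF b prod']) auto
  then have "bilateral_sum b (b 1) = 0" by (simp add: bilateral_sum_def)
  moreover have "theta_bracket b (b 1) = 0" by (rule theta_bracket_b1_eq_0[OF b prod'])
  moreover have "q / (b 1 * b 2) = q powi (- int n)"
    unfolding prod by (simp add: power_int_minus divide_inverse)
  then have "phi (q / (b 1 * b 2)) = 0" by (simp only: phi_powi_eq_0)
  then have "pair_product b = 0" by (simp add: pair_product_expand)
  ultimately have "defect b (b 1) m = 0" by (simp add: defect_def)
  then show ?thesis using defect_eq_0_move[OF b gen _ l] by blast
qed

text \<open>For \<open>b\<^sub>1 b\<^sub>2 = 1\<close> and \<open>l = b\<^sub>1\<close> only the term at \<open>x = 0\<close> survives, and the theta bracket vanishes at \<open>b\<^sub>1\<close>. What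
  remains at \<open>m = b\<^sub>3\<close> is an identity between two products.\<close>

lemma defect_eq_0_at_one:
  assumes b: "balanced b" and prod: "b 1 * b 2 = 1"
    and gen: "generic_pair (b 1) (b 3)" "generic_pair (b 3) l" and m: "m \<noteq> 0"
  shows "defect b l m = 0"
proof -
  have prod': "b 1 * b 2 = q powi 0" using prod by simp
  have b0: "b 1 \<noteq> 0" "b 2 \<noteq> 0" "b 3 \<noteq> 0" "b 4 \<noteq> 0" "b 5 \<noteq> 0" "b 6 \<noteq> 0"
    using b by (auto simp: balanced_def)
  have "bilateral_term b (b 1) x = 0" if "x \<noteq> 0" for x
    using that by (intro bilateral_term_b1_eq_0[OF b prod']) auto
  then have "bilateral_sum b (b 1) = bilateral_term b (b 1) 0"
    unfolding bilateral_sum_def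
    by (subst infsum_cong_neutral[where T = "{0}" and g = "bilateral_term b (b 1)"]) auto
  then have S: "bilateral_sum b (b 1) = (1 - (b 1)\<^sup>2) * weight_G b (b 1)"
    by (simp add: bilateral_term_def)
  have P: "theta_bracket b (b 1) = 0" by (rule theta_bracket_b1_eq_0[OF b prod'])
  have P3: "theta_bracket b (b 3) = (\<Prod>i\<in>{1..6}. theta (b 3 * b i))"
    by (rule theta_bracket_eq_first[OF b]) simp
  have b2: "b 2 = 1 / b 1" using prod b0 by (simp add: field_simps)
  have q4: "b 3 * b 4 * b 5 * b 6 = q"
    using b prod by (simp only: balanced_def prod_6) (metis mult.assoc mult_1_left)
  have th: "theta (b 3 * b 4) = phi (q / (b 5 * b 6)) * phi (q / (b 3 * b 4))"
    "theta (b 3 * b 5) = phi (q / (b 4 * b 6)) * phi (q / (b 3 * b 5))"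
    "theta (b 3 * b 6) = phi (q / (b 4 * b 5)) * phi (q / (b 3 * b 6))"
    unfolding qtheta_def using b0 by (simp_all flip: q4)
  have G: "weight_G b (b 1) = phi q * phi (q / (b 1)\<^sup>2) * (phi (q * (b 1)\<^sup>2) * phi q) *
      (phi (q / (b 2 * b 3)) * phi (q / (b 1 * b 3))) * (phi (q / (b 2 * b 4)) * phi (q / (b 1 * b 4))) *
      (phi (q / (b 2 * b 5)) * phi (q / (b 1 * b 5))) * (phi (q / (b 2 * b 6)) * phi (q / (b 1 * b 6)))"
    unfolding weight_G_def prod_6 b2 using b0
    by (simp add: power2_eq_square divide_inverse mult.assoc)
  have th1: "theta ((b 1)\<^sup>2) = (1 - (b 1)\<^sup>2) * phi (q * (b 1)\<^sup>2) * phi (q / (b 1)\<^sup>2)"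
    using phi_rec[of "(b 1)\<^sup>2"] by (simp add: qtheta_def mult.commute)
  have th2: "theta (b 3 * b 2) = theta (b 3 / b 1)" "theta (b 3 * b 3) = theta ((b 3)\<^sup>2)"
    "theta (b 3 * b 1) = theta (b 1 * b 3)"
    by (simp_all add: b2 power2_eq_square mult.commute)
  have pp: "phi (q / (b 1 * b 2)) = phi q" unfolding prod by simp
  have "defect b (b 1) (b 3) = 0"
    unfolding defect_def P S P3 G theta_kernel_def th1 pair_product_expand prod_6 th th2 pp
    by (simp add: mult_ac)
  then have "defect b l (b 3) = 0"
    using defect_eq_0_move[OF b gen(1)] gen(2) by (simp add: generic_pair_def)
  then have "defect b (b 3) l = 0"
    using defect_antisym[of l "b 3" b] gen(2) by (simp add: generic_pair_def)
  then have "defect b m l = 0" by (rule defect_eq_0_move[OF b gen(2) _ m])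
  then show ?thesis using defect_antisym[of m l b] gen(2) m by (simp add: generic_pair_def)
qed

section \<open>Contiguous relation\<close>

text \<open>Scaling one parameter multiplies \<open>G\<close> by a function that is affine in \<open>z + 1 /
  z\<close>. Any three such functions are linearly dependent, which is the source of the contiguous
  relation.\<close>

lemma weight_G_scale:
  assumes i: "i \<in> {1..6}" and a: "a i \<noteq> 0" and z: "z \<noteq> 0"
  shows "a i * weight_G (a(i := q * a i)) z = weight_G a z * ((a i + 1 / a i) - (z + 1 / z))"
proof -
  define a' where "a' = a(i := q * a i)"
  have a': "a' i = q * a i" "\<And>j. j \<noteq> i \<Longrightarrow> a' j = a j" by (simp_all add: a'_def)
  define R where "R = (\<Prod>j\<in>{1..6} - {i}. phi (q * z / a j) * phi (q * inverse z / a j))"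
  have "weight_G a' z = phi (z / a i) * phi (inverse z / a i) *
      (\<Prod>j\<in>{1..6} - {i}. phi (q * z / a' j) * phi (q * inverse z / a' j))"
    unfolding weight_G_def by (subst prod.remove[OF _ i]) (simp_all add: a')
  also have "(\<Prod>j\<in>{1..6} - {i}. phi (q * z / a' j) * phi (q * inverse z / a' j)) = R"
    unfolding R_def by (rule prod.cong) (auto simp: a')
  also have "phi (z / a i) = (1 - z / a i) * phi (q * z / a i)"
    using phi_rec[of "z / a i"] by (simp add: mult.commute)
  also have "phi (inverse z / a i) = (1 - inverse z / a i) * phi (q * inverse z / a i)"
    using phi_rec[of "inverse z / a i"] by (simp add: mult.commute)
  finally have 1: "weight_G a' z = (1 - z / a i) * (1 - inverse z / a i) *
      (phi (q * z / a i) * phi (q * inverse z / a i) * R)"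
    by (simp add: mult_ac)
  have 2: "weight_G a z = phi (q * z / a i) * phi (q * inverse z / a i) * R"
    unfolding weight_G_def R_def by (rule prod.remove[OF _ i]) simp
  have "a i * ((1 - z / a i) * (1 - inverse z / a i)) = (a i + 1 / a i) - (z + 1 / z)"
  proof -
    have "a i * inverse (a i) = 1" "z * inverse z = 1" using a z by simp_all
    then show ?thesis unfolding divide_inverse mult_1_left by algebra
  qed
  then have "a i * ((1 - z / a i) * (1 - inverse z / a i) * Y) = (a i + 1 / a i - (z + 1 / z)) * Y" for Y
    by (simp only: mult.assoc[symmetric])
  then show ?thesis
    unfolding a'_def[symmetric] 1 2 by (simp only: mult.commute[of _ "a i + 1 / a i - (z + 1 / z)"])
qed

lemma balanced_scale:
  assumes i: "i \<in> {1..6}" and a: "\<And>j. j \<in> {1..6} \<Longrightarrow> a j \<noteq> 0" "(\<Prod>j\<in>{1..6}. a j) = 1"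
  shows "balanced (a(i := q * a i))"
proof -
  have "(\<Prod>j\<in>{1..6}. (a(i := q * a i)) j) = q * a i * (\<Prod>j\<in>{1..6} - {i}. (a(i := q * a i)) j)"
    by (subst prod.remove[OF _ i]) simp_all
  also have "(\<Prod>j\<in>{1..6} - {i}. (a(i := q * a i)) j) = (\<Prod>j\<in>{1..6} - {i}. a j)"
    by (rule prod.cong) auto
  also have "q * a i * (\<Prod>j\<in>{1..6} - {i}. a j) = q"
    using a(2) by (subst (asm) prod.remove[OF _ i]) simp_all
  finally show ?thesis using a(1) i by (auto simp: balanced_def)
qed

lemma theta_bracket_scale:
  assumes i: "i \<in> {1..6}" and a: "\<And>j. j \<in> {1..6} \<Longrightarrow> a j \<noteq> 0" and m: "m \<noteq> 0"
  shows "a i * theta_bracket (a(i := q * a i)) m =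
    - ((\<Prod>j\<in>{1..6}. theta (m * a j)) - (\<Prod>j\<in>{1..6}. theta (m / a j))) / m"
proof -
  have ai: "a i \<noteq> 0" using a i by blast
  define a' where "a' = a(i := q * a i)"
  have a': "a' i = q * a i" "\<And>j. j \<noteq> i \<Longrightarrow> a' j = a j" by (simp_all add: a'_def)
  have rest: "(\<Prod>j\<in>{1..6}. g (a' j)) = c * (\<Prod>j\<in>{1..6}. g (a j))"
    if "g (q * a i) = c * g (a i)" for g :: "complex \<Rightarrow> complex" and c
  proof -
    have "(\<Prod>j\<in>{1..6} - {i}. g (a' j)) = (\<Prod>j\<in>{1..6} - {i}. g (a j))"
      by (rule prod.cong) (auto simp: a')
    then show ?thesis using that
      by (subst (1 2) prod.remove[OF _ i]) (simp_all only: finite_atLeastAtMost a' mult_ac)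
  qed
  have 1: "(\<Prod>j\<in>{1..6}. theta (m * a' j)) = - 1 / (m * a i) * (\<Prod>j\<in>{1..6}. theta (m * a j))"
    using theta_q[of "m * a i"] m ai by (intro rest) (simp add: mult_ac)
  have 2: "(\<Prod>j\<in>{1..6}. theta (m / a' j)) = - (m / (q * a i)) * (\<Prod>j\<in>{1..6}. theta (m / a j))"
    using theta_q[of "m / (q * a i)"] m ai by (intro rest) (simp add: field_simps)
  show ?thesis unfolding a'_def[symmetric] theta_bracket_def 1 2 using m ai by (simp add: field_simps power2_eq_square)
qed

text \<open>For \<open>a\<^sub>1 \<cdots> a\<^sub>6 = 1\<close> the two products are reciprocal polynomials of each other, so their
  difference is, up to the factor \<open>x\<^bsup>6\<^esup>\<close>, antisymmetric under \<open>x \<mapsto> 1 / x\<close>.\<close>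

lemma reciprocal_difference:
  fixes a1 a2 a3 a4 a5 a6 :: complex
  assumes "a1 * a2 * a3 * a4 * a5 * a6 = 1"
  obtains c0 c1 where "\<And>x. (x*a1 - 1) * (x*a2 - 1) * (x*a3 - 1) * (x*a4 - 1) * (x*a5 - 1) * (x*a6 - 1)
      - (x - a1) * (x - a2) * (x - a3) * (x - a4) * (x - a5) * (x - a6) =
      (x\<^sup>2 - 1) * (x * (c1 * (x\<^sup>2 + 1) + c0 * x))"
proof
  define e1 where "e1 = a1 + a2 + a3 + a4 + a5 + a6"
  define e5 where "e5 = a2*a3*a4*a5*a6 + a1*a3*a4*a5*a6 + a1*a2*a4*a5*a6 + a1*a2*a3*a5*a6 + a1*a2*a3*a4*a6 + a1*a2*a3*a4*a5"
  define e4 where "e4 = a1*a2*a3*a4 + a1*a2*a3*a5 + a1*a2*a3*a6 + a1*a2*a4*a5 + a1*a2*a4*a6 + a1*a2*a5*a6 + a1*a3*a4*a5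
    + a1*a3*a4*a6 + a1*a3*a5*a6 + a1*a4*a5*a6 + a2*a3*a4*a5 + a2*a3*a4*a6 + a2*a3*a5*a6 + a2*a4*a5*a6 + a3*a4*a5*a6"
  define e2 where "e2 = a1*a2 + a1*a3 + a1*a4 + a1*a5 + a1*a6 + a2*a3 + a2*a4 + a2*a5 + a2*a6 + a3*a4 + a3*a5 + a3*a6
    + a4*a5 + a4*a6 + a5*a6"
  fix x
  have "(x*a1 - 1) * (x*a2 - 1) * (x*a3 - 1) * (x*a4 - 1) * (x*a5 - 1) * (x*a6 - 1)
      - (x - a1) * (x - a2) * (x - a3) * (x - a4) * (x - a5) * (x - a6) =
      (x^6 - 1) * (a1 * a2 * a3 * a4 * a5 * a6 - 1) + (x^5 - x) * (e1 - e5) + (x^4 - x^2) * (e4 - e2)"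
    unfolding e1_def e2_def e4_def e5_def by algebra
  then show "(x*a1 - 1) * (x*a2 - 1) * (x*a3 - 1) * (x*a4 - 1) * (x*a5 - 1) * (x*a6 - 1)
      - (x - a1) * (x - a2) * (x - a3) * (x - a4) * (x - a5) * (x - a6) =
      (x\<^sup>2 - 1) * (x * ((e1 - e5) * (x\<^sup>2 + 1) + (e4 - e2) * x))"
    unfolding assms by algebra
qed

lemma pair_product_scale_factor:
  assumes i: "i \<in> {1..6}"
  shows "pair_product (a(i := q * a i)) = pair_product a * (\<Prod>j\<in>{1..6} - {i}. 1 - 1 / (a i * a j))"
proof -
  have first: "pair_product (c(1 := q * c 1)) = pair_product c * (\<Prod>j\<in>{1..6} - {1}. 1 - 1 / (c 1 * c j))" for c
  proof -
    have step: "phi (q / (q * x * y)) = (1 - 1 / (x * y)) * phi (q / (x * y))" for x y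
      using phi_rec[of "1 / (x * y)"] by (simp add: mult_ac)
    have up: "(c(1 := q * c 1)) 1 = q * c 1" "(c(1 := q * c 1)) 2 = c 2" "(c(1 := q * c 1)) 3 = c 3"
      "(c(1 := q * c 1)) 4 = c 4" "(c(1 := q * c 1)) 5 = c 5" "(c(1 := q * c 1)) 6 = c 6"
      by simp_all
    have "{1..6} - {1} = {2, 3, 4, 5, 6::nat}" by auto
    then have "(\<Prod>j\<in>{1..6} - {1}. 1 - 1 / (c 1 * c j)) = (1 - 1 / (c 1 * c 2)) * (1 - 1 / (c 1 * c 3)) *
        (1 - 1 / (c 1 * c 4)) * (1 - 1 / (c 1 * c 5)) * (1 - 1 / (c 1 * c 6))" by (simp add: mult.assoc)
    then show ?thesis unfolding pair_product_expand up step by (simp only: mult_ac)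
  qed
  define p where "p = Transposition.transpose 1 i"
  have p: "p permutes {1..6}" unfolding p_def using i by (intro permutes_swap_id) auto
  have p1: "p 1 = i" "p i = 1" "\<And>j. p (p j) = j" by (simp_all add: p_def)
  have "(a \<circ> p)(1 := q * (a \<circ> p) 1) = a(i := q * a i) \<circ> p"
    using p1 by (auto simp: fun_eq_iff) metis
  then have "pair_product (a(i := q * a i)) = pair_product a * (\<Prod>j\<in>{1..6} - {1}. 1 - 1 / ((a \<circ> p) 1 * (a \<circ> p) j))"
    using first[of "a \<circ> p"] by (simp only: pair_product_permute[OF p])
  also have "(\<Prod>j\<in>{1..6} - {1}. 1 - 1 / ((a \<circ> p) 1 * (a \<circ> p) j)) = (\<Prod>j\<in>{1..6} - {i}. 1 - 1 / (a i * a j))"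
  proof (rule prod.reindex_bij_witness[of _ p p])
    have "p x = i \<longleftrightarrow> x = 1" "p x = 1 \<longleftrightarrow> x = i" for x using p1 by metis+
    then show "p x \<in> {1..6} - {i}" if "x \<in> {1..6} - {1}" for x
      using that permutes_in_image[OF p] by (simp del: One_nat_def atLeastAtMost_iff)
    show "p x \<in> {1..6} - {1}" if "x \<in> {1..6} - {i}" for x
      using that permutes_in_image[OF p] \<open>\<And>x. p x = 1 \<longleftrightarrow> x = i\<close> by (simp del: One_nat_def atLeastAtMost_iff)
  qed (simp_all add: p1 del: One_nat_def)
  finally show ?thesis .
qed

text \<open>Multiplied by \<open>a\<^sub>i\<^bsup>2\<^esup>\<close>, the factor gained by the pair product is affine
  in \<open>a\<^sub>i + 1 / a\<^sub>i\<close>, with coefficients that do not depend on \<open>i\<close>.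
  The identity between the two polynomials is evaluated at \<open>a\<^sub>i\<close>, a zero of the second
  one.\<close>

lemma pair_product_scale:
  assumes a: "\<And>j. j \<in> {1..6} \<Longrightarrow> a j \<noteq> 0" "(\<Prod>j\<in>{1..6}. a j) = 1"
  obtains c0 c1 where "\<And>i. i \<in> {1..6} \<Longrightarrow> (a i)\<^sup>2 \<noteq> 1 \<Longrightarrow>
    (a i)\<^sup>2 * pair_product (a(i := q * a i)) = pair_product a * ((a i + 1 / a i) * c1 + c0)"
proof -
  obtain c0 c1 where c: "\<And>x. (\<Prod>j\<in>{1..6}. x * a j - 1) - (\<Prod>j\<in>{1..6}. x - a j) =
      (x\<^sup>2 - 1) * (x * (c1 * (x\<^sup>2 + 1) + c0 * x))"
    using reciprocal_difference[of "a 1" "a 2" "a 3" "a 4" "a 5" "a 6"] a(2) unfolding prod_6 by metis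
  show ?thesis
  proof (rule that[of c1 c0])
    fix i :: nat assume i: "i \<in> {1..6}" and sq: "(a i)\<^sup>2 \<noteq> 1"
    define x where "x = a i"
    have x: "x \<noteq> 0" using a(1)[OF i] by (simp add: x_def)
    have zero: "(\<Prod>j\<in>{1..6}. x - a j) = 0" using i by (intro prod_zero bexI[of _ i]) (auto simp: x_def)
    have "(\<Prod>j\<in>{1..6}. x * a j - 1) = (x\<^sup>2 - 1) * (\<Prod>j\<in>{1..6} - {i}. x * a j - 1)"
      by (subst prod.remove[OF _ i]) (simp_all add: x_def power2_eq_square)
    then have "(x\<^sup>2 - 1) * (\<Prod>j\<in>{1..6} - {i}. x * a j - 1) = (x\<^sup>2 - 1) * (x * (c1 * (x\<^sup>2 + 1) + c0 * x))"
      using c[of x] by (simp only: zero diff_0_right)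
    then have N: "(\<Prod>j\<in>{1..6} - {i}. x * a j - 1) = x * (c1 * (x\<^sup>2 + 1) + c0 * x)"
      using sq by (simp add: x_def)
    have rest: "x * (\<Prod>j\<in>{1..6} - {i}. a j) = 1"
      using a(2) prod.remove[OF _ i, of a] by (simp add: x_def)
    have "(\<Prod>j\<in>{1..6} - {i}. 1 - 1 / (x * a j)) = (\<Prod>j\<in>{1..6} - {i}. (x * a j - 1) / (x * a j))"
      by (rule prod.cong) (use a(1) x in \<open>auto simp: diff_divide_distrib\<close>)
    also have "\<dots> = (x * (c1 * (x\<^sup>2 + 1) + c0 * x)) / (x ^ 5 * (\<Prod>j\<in>{1..6} - {i}. a j))"
    proof -
      have "card ({1..6} - {i}) = 5" using i by simp
      then show ?thesis by (simp only: prod_dividef prod.distrib prod_constant N)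
    qed
    also have "x ^ 5 * (\<Prod>j\<in>{1..6} - {i}. a j) = x ^ 4"
      using rest by (simp add: eval_nat_numeral mult.assoc)
    finally have "x\<^sup>2 * (\<Prod>j\<in>{1..6} - {i}. 1 - 1 / (x * a j)) = (c1 * (x\<^sup>2 + 1) + c0 * x) / x"
      using x by (simp add: eval_nat_numeral)
    also have "\<dots> = (x + 1 / x) * c1 + c0"
      using x by (simp add: add_divide_distrib distrib_left distrib_right power2_eq_square mult.commute)
    finally show "(a i)\<^sup>2 * pair_product (a(i := q * a i)) = pair_product a * ((a i + 1 / a i) * c1 + c0)"
      unfolding pair_product_scale_factor[OF i] x_def by (simp only: mult.left_commute[of "(a i)\<^sup>2" "pair_product a"])
  qed
qed

text \<open>The series satisfies this relation term by term, the theta brackets of the three scaled parameter sets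
  are proportional, and the pair product contributes an affine function of \<open>s i\<close>.\<close>

lemma defect_contiguous:
  assumes a: "\<And>j. j \<in> {1..6} \<Longrightarrow> a j \<noteq> 0" "(\<Prod>j\<in>{1..6}. a j) = 1"
    and sq: "(a 1)\<^sup>2 \<noteq> 1" "(a 2)\<^sup>2 \<noteq> 1" "(a 3)\<^sup>2 \<noteq> 1"
    and lm: "l \<noteq> 0" "m \<noteq> 0"
  defines "s \<equiv> \<lambda>i. a i + 1 / a i"
  defines "D \<equiv> \<lambda>i. (a i)\<^sup>2 * defect (a(i := q * a i)) l m"
  shows "(s 2 - s 3) * D 1 + (s 3 - s 1) * D 2 + (s 1 - s 2) * D 3 = 0"
proof -
  define B where "B = (\<lambda>i t. a i * bilateral_sum (a(i := q * a i)) t)"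
  have B: "(s 2 - s 3) * B 1 t + (s 3 - s 1) * B 2 t + (s 1 - s 2) * B 3 t = 0" if t: "t \<noteq> 0" for t
  proof -
    define T where "T = (\<lambda>i x. bilateral_term (a(i := q * a i)) t x)"
    have sum: "(\<lambda>x. c * (a i * T i x)) summable_on UNIV" if "i \<in> {1..6}" for i c
      unfolding T_def by (intro summable_on_cmult_right summable_bilateral_term balanced_scale a t that)
    have T: "a i * T i x = bilateral_term a t x * (s i - (t * q powi x + 1 / (t * q powi x)))" if "i \<in> {1..6}" for i x
    proof -
      have "a i * weight_G (a(i := q * a i)) (t * q powi x) =
          weight_G a (t * q powi x) * (s i - (t * q powi x + 1 / (t * q powi x)))"
        unfolding s_def by (rule weight_G_scale) (use that a t in auto)
      then show ?thesis
        unfolding T_def bilateral_term_def mult.left_commute[of "a i"] by (simp only: mult.assoc)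
    qed
    have "(s 2 - s 3) * B 1 t + (s 3 - s 1) * B 2 t + (s 1 - s 2) * B 3 t =
      (\<Sum>\<^sub>\<infinity>x\<in>UNIV. (s 2 - s 3) * (a 1 * T 1 x) + (s 3 - s 1) * (a 2 * T 2 x) + (s 1 - s 2) * (a 3 * T 3 x))"
      unfolding B_def bilateral_sum_def T_def[symmetric]
      by (subst infsum_add, intro summable_on_add sum, simp, simp, rule sum, simp,
          subst infsum_add, rule sum, simp, rule sum, simp) (simp add: infsum_cmult_right' T_def)
    also have "\<dots> = (\<Sum>\<^sub>\<infinity>x\<in>(UNIV::int set). 0)"
    proof (rule infsum_cong)
      fix x :: int
      have T': "a 1 * T 1 x = bilateral_term a t x * (s 1 - (t * q powi x + 1 / (t * q powi x)))"
        "a 2 * T 2 x = bilateral_term a t x * (s 2 - (t * q powi x + 1 / (t * q powi x)))"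
        "a 3 * T 3 x = bilateral_term a t x * (s 3 - (t * q powi x + 1 / (t * q powi x)))"
        by (rule T, simp)+
      show "(s 2 - s 3) * (a 1 * T 1 x) + (s 3 - s 1) * (a 2 * T 2 x) + (s 1 - s 2) * (a 3 * T 3 x) = 0"
        unfolding T' by algebra
    qed
    finally show ?thesis by simp
  qed
  define X where "X = (\<lambda>t. - ((\<Prod>j\<in>{1..6}. theta (t * a j)) - (\<Prod>j\<in>{1..6}. theta (t / a j))) / t)"
  have X: "a i * theta_bracket (a(i := q * a i)) t = X t" if "i \<in> {1..6}" "t \<noteq> 0" for i t
    unfolding X_def by (rule theta_bracket_scale) (use that a in auto)
  obtain c0 c1 where c: "\<And>i. i \<in> {1, 2, 3} \<Longrightarrow>
    (a i)\<^sup>2 * pair_product (a(i := q * a i)) = pair_product a * (s i * c1 + c0)"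
  proof -
    obtain c0 c1 where c: "\<And>i. i \<in> {1..6} \<Longrightarrow> (a i)\<^sup>2 \<noteq> 1 \<Longrightarrow>
        (a i)\<^sup>2 * pair_product (a(i := q * a i)) = pair_product a * (s i * c1 + c0)"
      using pair_product_scale[OF a] unfolding s_def by blast
    show ?thesis by (rule that[of c1 c0], rule c) (use sq in auto)
  qed
  have D: "D i = l * B i l * X m - m * B i m * X l - theta_kernel l m * phi q * (pair_product a * (s i * c1 + c0))"
    if "i \<in> {1, 2, 3}" for i
  proof -
    have i: "i \<in> {1..6}" using that by auto
    have "D i = l * B i l * (a i * theta_bracket (a(i := q * a i)) m) - m * B i m * (a i * theta_bracket (a(i := q * a i)) l)
        - theta_kernel l m * phi q * ((a i)\<^sup>2 * pair_product (a(i := q * a i)))"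
      unfolding D_def defect_def B_def by algebra
    then show ?thesis unfolding X[OF i lm(1)] X[OF i lm(2)] c[OF that] .
  qed
  have "(s 2 - s 3) * D 1 + (s 3 - s 1) * D 2 + (s 1 - s 2) * D 3 =
     l * X m * ((s 2 - s 3) * B 1 l + (s 3 - s 1) * B 2 l + (s 1 - s 2) * B 3 l)
     - m * X l * ((s 2 - s 3) * B 1 m + (s 3 - s 1) * B 2 m + (s 1 - s 2) * B 3 m)"
    unfolding D[of 1, simplified] D[of 2, simplified] D[of 3, simplified] One_nat_def by algebra
  then show ?thesis unfolding B[OF lm(1)] B[OF lm(2)] by simp
qed

lemma generic_pair_q_shift: "generic_pair (x * q powi i) (y * q powi j) \<longleftrightarrow> generic_pair x y"
proof -
  have "q powi (2 * k) = (q powi k)\<^sup>2" for k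
    by (metis mult_2 power2_eq_square power_int_add q_nonzero)
  then have 1: "(x * q powi i)\<^sup>2 = x\<^sup>2 * q powi (2 * i)" "(y * q powi j)\<^sup>2 = y\<^sup>2 * q powi (2 * j)"
    by (simp_all add: power_mult_distrib)
  have 2: "x * q powi i * (y * q powi j) = x * y * q powi (i + j)"
    "y * q powi j / (x * q powi i) = y / x * q powi (j - i)"
    by (simp_all add: power_int_add power_int_diff)
  show ?thesis unfolding generic_pair_def 1 2 q_powers_mult_iff by simp
qed

lemma generic_pair_q_shift_1: "generic_pair (q * x) y \<longleftrightarrow> generic_pair x y" "generic_pair x (y / q) \<longleftrightarrow> generic_pair x y"
  "generic_pair (y / q) x \<longleftrightarrow> generic_pair y x"
  using generic_pair_q_shift[of x 1 y 0] generic_pair_q_shift[of x 0 y "- 1"] generic_pair_q_shift[of y "- 1" x 0]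
  by (simp_all add: power_int_minus mult.commute divide_inverse)

text \<open>The contiguous relation determines the defect on \<open>b\<^sub>1 b\<^sub>2 = q\<^bsup>-n-1\<^esup>\<close> by its values on
  \<open>b\<^sub>1 b\<^sub>2 = q\<^bsup>-n\<^esup>\<close>, where two of its three terms lie.\<close>

lemma defect_eq_0_negative_power:
  assumes "balanced b" and "b 1 * b 2 * q ^ n = 1"
    and "generic_pair (b 1) (b 3)" "generic_pair (b 3) l" and "generic_pair (b 1) m"
  shows "defect b l m = 0"
  using assms
proof (induction n arbitrary: b)
  case 0
  then show ?case by (intro defect_eq_0_at_one) (auto simp: generic_pair_def)
next
  case (Suc n)
  have b0: "b j \<noteq> 0" if "j \<in> {1..6}" for j using Suc.prems(1) that by (auto simp: balanced_def)
  have b123: "b 1 \<noteq> 0" "b 2 \<noteq> 0" "b 3 \<noteq> 0" using b0 by auto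
  \<comment> \<open>The product of \<open>a\<close> is \<open>1\<close>. Scaling \<open>a 3\<close> gives back \<open>b\<close>, while scaling \<open>a 1\<close> or \<open>a 2\<close> brings the product of the first two parameters one power closer to \<open>1\<close>.\<close>
  define a where "a = b(3 := b 3 / q)"
  have a_simps: "a 1 = b 1" "a 2 = b 2" "a 3 = b 3 / q" by (simp_all add: a_def)
  have b_eq: "b = a(3 := q * a 3)" by (simp add: a_def)
  have a0: "a j \<noteq> 0" if "j \<in> {1..6}" for j using b0[OF that] b123 by (simp add: a_def)
  have aprod: "(\<Prod>j\<in>{1..6}. a j) = 1"
    using Suc.prems(1) unfolding balanced_def prod_6 by (simp add: a_def field_simps)
  have nq: "(b 1)\<^sup>2 \<notin> q_powers q" "(b 3)\<^sup>2 \<notin> q_powers q"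
    using Suc.prems(3) by (simp_all add: generic_pair_def)
  have b12: "b 1 * b 2 = 1 / q ^ Suc n" using Suc.prems(2) by (simp add: field_simps)
  then have b12q: "b 1 * b 2 \<in> q_powers q" by (simp add: q_powers_inverse_iff del: power_Suc)
  have "b 1 * b 2 \<noteq> 1" unfolding b12 using q_power_eq_1_iff[of "Suc n"] by (simp del: power_Suc)
  moreover have "b 1 \<noteq> b 2" using nq(1) b12q by (auto simp: power2_eq_square)
  ultimately have s12: "(b 1 + 1 / b 1) - (b 2 + 1 / b 2) \<noteq> 0"
  proof -
    have "b 1 * inverse (b 1) = 1" "b 2 * inverse (b 2) = 1" using b123 by simp_all
    then have "(b 1 + 1 / b 1) - (b 2 + 1 / b 2) = (b 1 - b 2) * (b 1 * b 2 - 1) * inverse (b 1) * inverse (b 2)"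
      unfolding divide_inverse mult_1_left by algebra
    moreover have "b 1 - b 2 \<noteq> 0" "b 1 * b 2 - 1 \<noteq> 0" "inverse (b 1) \<noteq> 0" "inverse (b 2) \<noteq> 0"
      using \<open>b 1 * b 2 \<noteq> 1\<close> \<open>b 1 \<noteq> b 2\<close> b123 by simp_all
    ultimately show ?thesis by (simp only: mult_eq_0_iff) simp
  qed
  have sq1: "(a 1)\<^sup>2 \<noteq> 1" unfolding a_simps using nq(1) q_power_in_q_powers(3) by metis
  have sq2: "(a 2)\<^sup>2 \<noteq> 1"
  proof
    assume "(a 2)\<^sup>2 = 1"
    then have "(b 1)\<^sup>2 = (b 1 * b 2) * (b 1 * b 2)" by (simp add: a_simps power2_eq_square)
    then show False using nq(1) q_powers_mult[OF b12q b12q] by simp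
  qed
  have sq3: "(a 3)\<^sup>2 \<noteq> 1"
  proof
    assume "(a 3)\<^sup>2 = 1"
    then have "(b 3)\<^sup>2 = q ^ 2" by (simp add: a_simps power_divide)
    then show False using nq(2) q_power_in_q_powers(1)[of 2] by simp
  qed
  have lm: "l \<noteq> 0" "m \<noteq> 0" using Suc.prems(4,5) by (auto simp: generic_pair_def)
  have "defect (a(1 := q * a 1)) l m = 0"
  proof (rule Suc.IH)
    show "balanced (a(1 := q * a 1))" by (rule balanced_scale[OF _ a0 aprod]) auto
    show "(a(1 := q * a 1)) 1 * (a(1 := q * a 1)) 2 * q ^ n = 1"
      using Suc.prems(2) by (simp add: a_def mult_ac)
  qed (use Suc.prems(3-5) in \<open>simp_all add: a_def generic_pair_q_shift_1\<close>)
  moreover have "defect (a(2 := q * a 2)) l m = 0"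
  proof (rule Suc.IH)
    show "balanced (a(2 := q * a 2))" by (rule balanced_scale[OF _ a0 aprod]) auto
    show "(a(2 := q * a 2)) 1 * (a(2 := q * a 2)) 2 * q ^ n = 1"
      using Suc.prems(2) by (simp add: a_def mult_ac)
  qed (use Suc.prems(3-5) in \<open>simp_all add: a_def generic_pair_q_shift_1\<close>)
  ultimately have "((a 1 + 1 / a 1) - (a 2 + 1 / a 2)) * ((a 3)\<^sup>2 * defect b l m) = 0"
    using defect_contiguous[OF a0 aprod sq1 sq2 sq3 lm] b_eq by simp
  then show ?case unfolding a_simps using s12 b123 by simp
qed

lemma defect_eq_0_q_power:
  assumes b: "balanced b" and prod: "b 1 * b 2 \<in> q_powers q"
    and gen: "generic_pair (b 1) (b 3)" "generic_pair (b 3) l" "generic_pair (b 1) m"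
  shows "defect b l m = 0"
proof -
  obtain k where k: "b 1 * b 2 = q powi k" using prod by (auto simp: q_powers_def)
  have l: "l \<noteq> 0" using gen by (simp add: generic_pair_def)
  show ?thesis
  proof (cases "k \<ge> 1")
    case True
    then have "k = int (Suc (nat (k - 1)))" by simp
    then have "b 1 * b 2 = q ^ Suc (nat (k - 1))" using k by (metis power_int_of_nat)
    then show ?thesis by (rule defect_eq_0_positive_power[OF b _ gen(3) l])
  next
    case False
    then have "b 1 * b 2 * q ^ nat (- k) = 1" unfolding k by (simp add: power_int_def power_inverse)
    then show ?thesis by (rule defect_eq_0_negative_power[OF b _ gen])
  qed
qed

lemma defect_eq_0_q_power_any:
  assumes b: "balanced b" and ijk: "i \<in> {1..6}" "j \<in> {1..6}" "k \<in> {1..6}" "i \<noteq> j" "i \<noteq> k" "j \<noteq> k"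
    and prod: "b i * b j \<in> q_powers q"
    and gen: "generic_pair (b i) (b k)" "generic_pair (b k) l" "generic_pair (b i) m"
  shows "defect b l m = 0"
proof -
  obtain p where p: "p permutes {1..6}" "p 1 = i" "p 2 = j" "p 3 = k"
    using exists_permutation_3[OF ijk] by blast
  have "defect (b \<circ> p) l m = 0"
    by (rule defect_eq_0_q_power) (use p b prod gen in \<open>auto simp: balanced_permute\<close>)
  then show ?thesis using defect_permute[OF p(1)] by simp
qed

section \<open>Moving two parameters\<close>

text \<open>The product \<open>b\<^sub>1 b\<^sub>2\<close> is kept fixed, so the parameters stay balanced.\<close>

definition parameter_path :: "(nat \<Rightarrow> complex) \<Rightarrow> complex \<Rightarrow> nat \<Rightarrow> complex" where
  "parameter_path b t = b(1 := t, 2 := b 1 * b 2 / t)"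

lemma parameter_path_simps [simp]:
  "parameter_path b t 1 = t" "parameter_path b t (Suc 0) = t" "parameter_path b t 2 = b 1 * b 2 / t"
  "j \<noteq> 1 \<Longrightarrow> j \<noteq> 2 \<Longrightarrow> parameter_path b t j = b j"
  by (simp_all add: parameter_path_def)

lemma balanced_parameter_path:
  assumes "balanced b" "t \<noteq> 0"
  shows "balanced (parameter_path b t)"
  using assms unfolding balanced_def prod_6
  by (auto simp: parameter_path_def)

lemma parameter_path_swap:
  assumes "balanced b" "t \<noteq> 0"
  shows "parameter_path b t \<circ> Transposition.transpose 1 2 = parameter_path b (b 1 * b 2 / t)"
proof
  fix j
  have "b 1 \<noteq> 0" "b 2 \<noteq> 0" using assms by (auto simp: balanced_def)
  then show "(parameter_path b t \<circ> Transposition.transpose 1 2) j = parameter_path b (b 1 * b 2 / t) j"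
    using assms(2) by (auto simp: parameter_path_def Transposition.transpose_def)
qed

lemma bilateral_term_permute: "p permutes {1..6} \<Longrightarrow> bilateral_term (b \<circ> p) l x = bilateral_term b l x"
  by (simp add: bilateral_term_def weight_G_permute)

text \<open>For large \<open>t\<close> the preceding bound applies directly. The exchange of \<open>b\<^sub>1\<close>
  and \<open>b\<^sub>2\<close> turns small \<open>t\<close> into large ones.\<close>

lemma norm_bilateral_term_path_le:
  assumes b: "balanced b" and l: "l \<noteq> 0"
  obtains K c where "0 \<le> K" "0 \<le> c" "\<And>t x. t \<noteq> 0 \<Longrightarrow> norm (bilateral_term (parameter_path b t) l x) \<le>
      norm q ^ nat \<bar>x\<bar> * (K * (phi_bound (c * norm t) * phi_bound (c / norm t)) ^ 2)"
proof -
  obtain M0 where M0: "\<And>j. j \<in> {1..6} \<Longrightarrow> norm (b j) \<le> M0" "\<And>j. j \<in> {1..6} \<Longrightarrow> 1 / norm (b j) \<le> M0"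
    using balanced_size_bound[OF b] by blast
  define B where "B = norm (b 1 * b 2)"
  have B: "B > 0" using b by (auto simp: B_def balanced_def)
  define L where "L = max (norm l) (1 / norm l)"
  define M where "M = max M0 (max 1 (max B (1 / B)))"
  \<comment> \<open>The multiple \<open>C \<bar>t\<bar>\<close> bounds both \<open>\<bar>t\<bar>\<close> and \<open>\<bar>t\<bar> / B\<close>, the sizes of \<open>b\<^sub>1\<close> and \<open>1 / b\<^sub>2\<close> on the path; \<open>C / \<bar>t\<bar>\<close> does so after the exchange.\<close>
  define C where "C = 1 + B + 1 / B"
  define K where "K = L\<^sup>2 * ((1 + L\<^sup>2) * phi_bound (L * M) ^ 15)"
  have L: "0 \<le> L" "norm l \<le> L" "1 / norm l \<le> L" by (auto simp: L_def le_max_iff_disj)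
  have M: "M0 \<le> M" "1 \<le> M" "B \<le> M" "1 / B \<le> M" by (auto simp: M_def)
  have C: "1 \<le> C" "1 / B \<le> C" "B \<le> C" "0 \<le> C" using B by (auto simp: C_def)
  have K0: "0 \<le> K" using phi_bound_ge_1[of "L * M"] L(1) M(2) by (simp add: K_def)
  have large: "norm (bilateral_term (parameter_path b t) l x) \<le> norm q ^ nat \<bar>x\<bar> * (K * phi_bound (L * r) ^ 2)"
    if t: "t \<noteq> 0" and r: "norm t \<le> r" "norm t / B \<le> r" and M1: "1 / norm t \<le> M" "B / norm t \<le> M" for t x r
  proof -
    have "norm (bilateral_term (parameter_path b t) l x) \<le>
      norm q ^ nat \<bar>x\<bar> * (L\<^sup>2 * ((1 + L\<^sup>2) * phi_bound (L * r) ^ 2 * phi_bound (L * M) ^ 15))"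
    proof (rule norm_bilateral_term_le[OF balanced_parameter_path[OF b t] l L(2,3)])
      show "norm (parameter_path b t j) \<le> M" if "j \<in> {3..6}" for j
        using that M0(1)[of j] M(1) by auto
      show "1 / norm (parameter_path b t j) \<le> M" if "j \<in> {3..6}" for j
        using that M0(2)[of j] M(1) by auto
    qed (use r M1 t in \<open>auto simp: B_def norm_divide norm_mult\<close>)
    then show ?thesis by (simp add: K_def mult_ac)
  qed
  have nn: "1 \<le> phi_bound (L * C * u)" if "0 \<le> u" for u
    using L(1) C(4) that by (intro phi_bound_ge_1) simp
  have "norm (bilateral_term (parameter_path b t) l x) \<le>
      norm q ^ nat \<bar>x\<bar> * (K * (phi_bound (L * C * norm t) * phi_bound (L * C / norm t)) ^ 2)"
    if t: "t \<noteq> 0" for t x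
  proof (cases "norm t \<ge> 1")
    case True
    have r: "norm t \<le> C * norm t" "norm t / B \<le> C * norm t"
      using mult_right_mono[of 1 C "norm t"] mult_right_mono[of "1 / B" C "norm t"] C by simp_all
    have "1 / norm t \<le> 1" "B / norm t \<le> B"
      using True B by (simp_all add: divide_le_eq)
    then have "1 / norm t \<le> M" "B / norm t \<le> M" using M by linarith+
    then have "norm (bilateral_term (parameter_path b t) l x) \<le>
        norm q ^ nat \<bar>x\<bar> * (K * phi_bound (L * (C * norm t)) ^ 2)"
      by (intro large t r)
    also have "\<dots> \<le> norm q ^ nat \<bar>x\<bar> * (K * (phi_bound (L * C * norm t) * phi_bound (L * C / norm t)) ^ 2)"
    proof (intro mult_left_mono power_mono K0)
      show "phi_bound (L * (C * norm t)) \<le> phi_bound (L * C * norm t) * phi_bound (L * C / norm t)"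
        using nn[of "norm t"] nn[of "1 / norm t"] mult_left_mono[of 1 "phi_bound (L * C / norm t)" "phi_bound (L * C * norm t)"]
        by (simp add: mult.assoc)
      show "0 \<le> phi_bound (L * (C * norm t))" using nn[of "norm t"] by (simp add: mult.assoc)
    qed simp
    finally show ?thesis .
  next
    case False
    define u where "u = b 1 * b 2 / t"
    have u: "u \<noteq> 0" "norm u = B / norm t" using t B by (auto simp: u_def B_def norm_divide)
    have tr: "Transposition.transpose 1 2 permutes {1..6::nat}" by (rule permutes_swap_id) auto
    have "bilateral_term (parameter_path b t) l x = bilateral_term (parameter_path b u) l x"
      using bilateral_term_permute[OF tr, of "parameter_path b t"] parameter_path_swap[OF b t] by (simp add: u_def)
    also have "norm \<dots> \<le> norm q ^ nat \<bar>x\<bar> * (K * phi_bound (L * (C * (1 / norm t))) ^ 2)"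
    proof (rule large[OF u(1)])
      have "B * (1 / norm t) \<le> C * (1 / norm t)" "1 * (1 / norm t) \<le> C * (1 / norm t)"
        using C by (intro mult_right_mono; simp)+
      then show "norm u \<le> C * (1 / norm t)" "norm u / B \<le> C * (1 / norm t)" using u B by simp_all
      have "norm t * (1 / B) \<le> 1 * (1 / B)" using False B by (intro mult_right_mono) auto
      then show "1 / norm u \<le> M" using u M by simp
      show "B / norm u \<le> M" using u B M False by simp
    qed
    also have "\<dots> \<le> norm q ^ nat \<bar>x\<bar> * (K * (phi_bound (L * C * norm t) * phi_bound (L * C / norm t)) ^ 2)"
    proof (intro mult_left_mono power_mono K0)
      show "phi_bound (L * (C * (1 / norm t))) \<le> phi_bound (L * C * norm t) * phi_bound (L * C / norm t)"
        using nn[of "norm t"] nn[of "1 / norm t"] mult_right_mono[of 1 "phi_bound (L * C * norm t)" "phi_bound (L * C / norm t)"]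
        by simp
      show "0 \<le> phi_bound (L * (C * (1 / norm t)))" using nn[of "1 / norm t"] by simp
    qed simp
    finally show ?thesis .
  qed
  then show ?thesis using that[of K "L * C"] K0 L(1) C(4) by simp
qed

lemma theta_dominated_bilateral_sum_path:
  assumes b: "balanced b" and l: "l \<noteq> 0"
  shows "theta_dominated 2 (\<lambda>t. bilateral_sum (parameter_path b t) l)"
proof -
  obtain K c where Kc: "0 \<le> K" "0 \<le> c" and le: "\<And>t x. t \<noteq> 0 \<Longrightarrow> norm (bilateral_term (parameter_path b t) l x) \<le>
      norm q ^ nat \<bar>x\<bar> * (K * (phi_bound (c * norm t) * phi_bound (c / norm t)) ^ 2)"
    using norm_bilateral_term_path_le[OF assms] by blast
  define Q where "Q = (\<Sum>\<^sub>\<infinity>x\<in>(UNIV::int set). norm q ^ nat \<bar>x\<bar>)"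
  show ?thesis
  proof (rule theta_dominatedI[of _ "Q * K" c])
    fix t :: complex assume t: "t \<noteq> 0"
    define R where "R = K * (phi_bound (c * norm t) * phi_bound (c / norm t)) ^ 2"
    have sum: "(\<lambda>x. norm (bilateral_term (parameter_path b t) l x)) summable_on UNIV"
      by (rule Infinite_Sum.abs_summable_on_comparison_test'[OF summable_on_cmult_left[OF summable_q_abs_int]])
         (rule le[OF t])
    have "norm (bilateral_sum (parameter_path b t) l) \<le> (\<Sum>\<^sub>\<infinity>x\<in>UNIV. norm (bilateral_term (parameter_path b t) l x))"
      unfolding bilateral_sum_def by (rule norm_infsum_bound[OF sum])
    also have "\<dots> \<le> (\<Sum>\<^sub>\<infinity>x\<in>(UNIV::int set). norm q ^ nat \<bar>x\<bar> * R)"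
      using le[OF t, folded R_def] by (intro infsum_mono sum summable_on_cmult_left summable_q_abs_int)
    also have "\<dots> = Q * R" by (simp add: Q_def infsum_cmult_left')
    finally show "norm (bilateral_sum (parameter_path b t) l) \<le>
        (Q * K) * (phi_bound (c * norm t) * phi_bound (c / norm t)) ^ 2"
      by (simp add: R_def)
  next
    show "0 \<le> Q * K" unfolding Q_def using Kc by (intro mult_nonneg_nonneg infsum_nonneg) auto
    show "0 \<le> c" by (rule Kc)
  qed
qed

lemma holomorphic_bilateral_sum_path:
  assumes b: "balanced b" and l: "l \<noteq> 0"
  shows "(\<lambda>t. bilateral_sum (parameter_path b t) l) holomorphic_on - {0}"
  unfolding bilateral_sum_def
proof (rule holomorphic_on_bilateral_infsum)
  have b0: "b j \<noteq> 0" if "j \<in> {1..6}" for j using b that by (auto simp: balanced_def)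
  show "(\<lambda>t. bilateral_term (parameter_path b t) l x) holomorphic_on - {0}" for x
    unfolding bilateral_term_def weight_G_def prod_6 using b0
    by (auto intro!: holomorphic_intros simp del: One_nat_def)
  obtain K c where Kc: "0 \<le> K" "0 \<le> c" and le: "\<And>t x. t \<noteq> 0 \<Longrightarrow> norm (bilateral_term (parameter_path b t) l x) \<le>
      norm q ^ nat \<bar>x\<bar> * (K * (phi_bound (c * norm t) * phi_bound (c / norm t)) ^ 2)"
    using norm_bilateral_term_path_le[OF assms] by blast
  fix a :: complex assume a: "a \<in> - {0}"
  show "\<exists>r>0. \<exists>R. cball a r \<subseteq> - {0} \<and>
      (\<forall>t\<in>cball a r. \<forall>x. norm (bilateral_term (parameter_path b t) l x) \<le> norm q ^ nat \<bar>x\<bar> * R)"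
  proof (intro exI conjI ballI allI)
    show "0 < norm a / 2" using a by simp
    have low: "norm a / 2 \<le> norm t" "norm t \<le> 2 * norm a" if "t \<in> cball a (norm a / 2)" for t
    proof -
      have d: "norm (a - t) \<le> norm a / 2" using that by (simp add: dist_norm)
      show "norm a / 2 \<le> norm t" using norm_triangle_sub[of a t] d by simp
      show "norm t \<le> 2 * norm a"
        using norm_triangle_sub[of t a] d norm_ge_zero[of a] norm_minus_commute[of t a] by linarith
    qed
    then show "cball a (norm a / 2) \<subseteq> - {0}" using a by force
    fix t x assume t: "t \<in> cball a (norm a / 2)"
    have t0: "t \<noteq> 0" using low(1)[OF t] a by auto
    have "phi_bound (c * norm t) \<le> phi_bound (c * (2 * norm a))"
      using low[OF t] Kc by (intro phi_bound_mono mult_left_mono) auto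
    moreover have "phi_bound (c / norm t) \<le> phi_bound (c / (norm a / 2))"
      using low[OF t] Kc a t0 by (intro phi_bound_mono divide_left_mono mult_pos_pos) auto
    moreover have "1 \<le> phi_bound (c * norm t)" "1 \<le> phi_bound (c / norm t)"
      using Kc by (auto intro!: phi_bound_ge_1)
    ultimately have "(phi_bound (c * norm t) * phi_bound (c / norm t)) ^ 2 \<le>
        (phi_bound (c * (2 * norm a)) * phi_bound (c / (norm a / 2))) ^ 2"
      by (intro power_mono mult_mono) auto
    then show "norm (bilateral_term (parameter_path b t) l x) \<le> norm q ^ nat \<bar>x\<bar> *
        (K * (phi_bound (c * (2 * norm a)) * phi_bound (c / (norm a / 2))) ^ 2)"
      using Kc by (intro order_trans[OF le[OF t0]] mult_left_mono) auto
  qed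
qed

lemma theta_bracket_path:
  assumes "balanced b" "t \<noteq> 0"
  shows "theta_bracket (parameter_path b t) m =
    (theta (m * b 3) * theta (m * b 4) * theta (m * b 5) * theta (m * b 6)) * (theta (m * t) * theta (m * (b 1 * b 2) / t))
    + (- q / m\<^sup>2 * (theta (m / b 3) * theta (m / b 4) * theta (m / b 5) * theta (m / b 6))) *
      (theta (m / t) * theta (m / (b 1 * b 2) * t))"
  unfolding theta_bracket_def prod_6 by (simp add: mult_ac)

lemma pair_product_path:
  "pair_product (parameter_path b t) = 
    (phi (q / (b 1 * b 2)) * (phi (q / (b 3 * b 4)) * phi (q / (b 3 * b 5)) * phi (q / (b 3 * b 6)) *
      phi (q / (b 4 * b 5)) * phi (q / (b 4 * b 6)) * phi (q / (b 5 * b 6)))) *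
    ((phi (q / (b 1 * b 2 * b 3) * t) * phi (q / b 3 / t)) * (phi (q / (b 1 * b 2 * b 4) * t) * phi (q / b 4 / t)) *
     (phi (q / (b 1 * b 2 * b 5) * t) * phi (q / b 5 / t)) * (phi (q / (b 1 * b 2 * b 6) * t) * phi (q / b 6 / t)))"
  if "t \<noteq> 0"
  using that unfolding pair_product_expand by (simp add: mult_ac)

lemma defect_path_holomorphic:
  assumes b: "balanced b" and lm: "l \<noteq> 0" "m \<noteq> 0"
  shows "(\<lambda>t. defect (parameter_path b t) l m) holomorphic_on - {0}"
proof -
  have b0: "b j \<noteq> 0" if "j \<in> {1..6}" for j using b that by (auto simp: balanced_def)
  have "(\<lambda>t. theta_bracket (parameter_path b t) u) holomorphic_on - {0}" if "u \<noteq> 0" for u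
    unfolding theta_bracket_def prod_6 using b0 that
    by (auto intro!: holomorphic_intros simp del: One_nat_def)
  moreover have "(\<lambda>t. pair_product (parameter_path b t)) holomorphic_on - {0}"
  proof -
    have "(\<lambda>t. parameter_path b t j) holomorphic_on - {0}" for j
      by (cases "j = 1"; cases "j = 2") (auto intro!: holomorphic_intros)
    moreover have "parameter_path b t j \<noteq> 0" if "t \<in> - {0}" "j \<in> {1..6}" for t j
      using balanced_parameter_path[OF b, of t] that by (auto simp: balanced_def)
    ultimately show ?thesis
      unfolding pair_product_def by (intro holomorphic_intros) auto
  qed
  ultimately show ?thesis
    unfolding defect_def using lm b
    by (intro holomorphic_intros holomorphic_bilateral_sum_path) auto
qed

lemma theta_dominated_cong:
  assumes "theta_dominated d f" "\<And>t. t \<noteq> 0 \<Longrightarrow> g t = f t"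
  shows "theta_dominated d g"
  using assms by (simp add: theta_dominated_def)

text \<open>Each of the three products in the defect has degree four: two from the series and two from the theta
  bracket, or four pairs of factors in the pair product.\<close>

lemma defect_path_growth:
  assumes b: "balanced b" and lm: "l \<noteq> 0" "m \<noteq> 0"
  shows "theta_growth 4 (\<lambda>t. defect (parameter_path b t) l m)"
proof -
  have pair: "theta_dominated 2 (\<lambda>t. theta_bracket (parameter_path b t) u)" for u
  proof (rule theta_dominated_cong[OF theta_dominated_add theta_bracket_path[OF b]])
    show "theta_dominated 2 (\<lambda>t. (theta (u * b 3) * theta (u * b 4) * theta (u * b 5) * theta (u * b 6)) *
        (theta (u * t) * theta (u * (b 1 * b 2) / t)))"
      using theta_dominated_cmult[OF theta_dominated_mult[OF theta_dominated_theta(1)[of u] theta_dominated_theta(2)[of "u * (b 1 * b 2)"]]]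
      by (simp only: one_add_one)
    show "theta_dominated 2 (\<lambda>t. (- q / u\<^sup>2 * (theta (u / b 3) * theta (u / b 4) * theta (u / b 5) * theta (u / b 6))) *
      (theta (u / t) * theta (u / (b 1 * b 2) * t)))"
      using theta_dominated_cmult[OF theta_dominated_mult[OF theta_dominated_theta(2)[of u] theta_dominated_theta(1)[of "u / (b 1 * b 2)"]]]
      by (simp only: one_add_one)
  qed
  have prod: "theta_dominated 4 (\<lambda>t. pair_product (parameter_path b t))"
  proof (rule theta_dominated_cong[OF theta_dominated_cmult pair_product_path])
    show "theta_dominated 4 (\<lambda>t. (phi (q / (b 1 * b 2 * b 3) * t) * phi (q / b 3 / t)) * (phi (q / (b 1 * b 2 * b 4) * t) * phi (q / b 4 / t)) *
     (phi (q / (b 1 * b 2 * b 5) * t) * phi (q / b 5 / t)) * (phi (q / (b 1 * b 2 * b 6) * t) * phi (q / b 6 / t)))"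
      using theta_dominated_mult[OF theta_dominated_mult[OF theta_dominated_mult[OF
         theta_dominated_phi_pair theta_dominated_phi_pair] theta_dominated_phi_pair] theta_dominated_phi_pair,
         of "q / (b 1 * b 2 * b 3)" "q / b 3" "q / (b 1 * b 2 * b 4)" "q / b 4" "q / (b 1 * b 2 * b 5)" "q / b 5"
         "q / (b 1 * b 2 * b 6)" "q / b 6"]
      by (simp add: eval_nat_numeral)
  qed
  have prods: "theta_dominated 4 (\<lambda>t. (c * bilateral_sum (parameter_path b t) u) * theta_bracket (parameter_path b t) v)"
    if "u \<noteq> 0" for c u v
    using theta_dominated_mult[OF theta_dominated_cmult[OF theta_dominated_bilateral_sum_path[OF b that], of c] pair[of v]]
    by simp
  have "theta_dominated 4 (\<lambda>t. ((l * bilateral_sum (parameter_path b t) l) * theta_bracket (parameter_path b t) m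
      + ((- m) * bilateral_sum (parameter_path b t) m) * theta_bracket (parameter_path b t) l)
      + (- theta_kernel l m * phi q) * pair_product (parameter_path b t))"
    by (intro theta_dominated_add prods lm theta_dominated_cmult prod)
  then have "theta_dominated 4 (\<lambda>t. defect (parameter_path b t) l m)"
    by (rule theta_dominated_cong) (simp add: defect_def mult_ac)
  then show ?thesis by (rule theta_dominated_imp_growth)
qed

section \<open>The two-term identity\<close>

definition generic_parameters :: "(nat \<Rightarrow> complex) \<Rightarrow> bool" where
  "generic_parameters b \<longleftrightarrow> balanced b \<and>
     (\<forall>i\<in>{1..6}. \<forall>j\<in>{1..6}. b i * b j \<notin> q_powers q \<and> (i \<noteq> j \<longrightarrow> b i / b j \<notin> q_powers q))"

lemma generic_parameters_permute:
  assumes p: "p permutes {1..6}" and b: "generic_parameters b"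
  shows "generic_parameters (b \<circ> p)"
  unfolding generic_parameters_def
proof (intro conjI ballI)
  show "balanced (b \<circ> p)" using b balanced_permute[OF p, of b] by (simp add: generic_parameters_def)
  fix i j :: nat assume "i \<in> {1..6}" "j \<in> {1..6}"
  then have "p i \<in> {1..6}" "p j \<in> {1..6}" by (simp_all only: permutes_in_image[OF p])
  moreover have "p i = p j \<longleftrightarrow> i = j" using permutes_inj[OF p] by (auto dest: injD)
  ultimately show "(b \<circ> p) i * (b \<circ> p) j \<notin> q_powers q" "i \<noteq> j \<longrightarrow> (b \<circ> p) i / (b \<circ> p) j \<notin> q_powers q"
    using b unfolding generic_parameters_def by (simp_all only: o_def) blast+
qed

text \<open>On the path, \<open>t\<close> forms a product in the powers of \<open>q\<close> with one of
  \<open>b\<^sub>3, ..., b\<^sub>6\<close> on four classes, and \<open>b\<^sub>1 b\<^sub>2 / t\<close>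
  forms such a product with \<open>b\<^sub>3\<close> on a fifth one.\<close>

lemma defect_eq_0_noncritical:
  assumes b: "generic_parameters b" and lm: "l \<noteq> 0" "m \<noteq> 0" "l\<^sup>2 \<notin> q_powers q" "m\<^sup>2 \<notin> q_powers q"
    and gen: "\<And>j. j \<in> {1..6} \<Longrightarrow> generic_pair (b j) l \<and> generic_pair (b j) m"
    and crit: "b 1 * b 2 * (b 3)\<^sup>2 \<notin> q_powers q"
  shows "defect b l m = 0"
proof -
  have bal: "balanced b" using b by (simp add: generic_parameters_def)
  have b0: "b j \<noteq> 0" if "j \<in> {1..6}" for j using bal that by (auto simp: balanced_def)
  have prodq: "b i * b j \<notin> q_powers q" if "i \<in> {1..6}" "j \<in> {1..6}" for i j
    using b that by (auto simp: generic_parameters_def)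
  have quot: "b i / b j \<notin> q_powers q" if "i \<in> {1..6}" "j \<in> {1..6}" "i \<noteq> j" for i j
    using b that by (auto simp: generic_parameters_def)
  define c where "c = b 1 * b 2 * b 3"
  have c0: "c \<noteq> 0" using b0 by (simp add: c_def)
  define A where "A = insert c ((\<lambda>j. 1 / b j) ` {3..6})"
  have cb: "c * b j \<notin> q_powers q" if "j \<in> {3..6}" for j
  proof -
    have tail: "c * (b 4 * b 5 * b 6) = q" using bal unfolding balanced_def prod_6 c_def by (simp add: mult_ac)
    have key: "c * x \<notin> q_powers q" if "c * x * y = q" "y \<notin> q_powers q" for x y
    proof
      assume "c * x \<in> q_powers q"
      then have "q / (c * x) \<in> q_powers q" by (intro q_powers_divide) auto
      moreover have "q / (c * x) = y"
      proof -
        have "c * x \<noteq> 0" using that(1) by auto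
        then show ?thesis using that(1) by (metis nonzero_mult_div_cancel_left)
      qed
      ultimately show False using that(2) by simp
    qed
    have "j = 3 \<or> j = 4 \<or> j = 5 \<or> j = 6" using that by auto
    then show ?thesis
    proof (elim disjE)
      assume "j = 3" then show ?thesis using crit by (simp add: c_def power2_eq_square mult.assoc)
    next
      assume "j = 4" then show ?thesis using key[of "b 4" "b 5 * b 6"] tail prodq[of 5 6] by (simp add: mult_ac)
    next
      assume "j = 5" then show ?thesis using key[of "b 5" "b 4 * b 6"] tail prodq[of 4 6] by (simp add: mult_ac)
    next
      assume "j = 6" then show ?thesis using key[of "b 6" "b 4 * b 5"] tail prodq[of 4 5] by (simp add: mult_ac)
    qed
  qed
  have cb': "1 / b j / c \<notin> q_powers q" "c / (1 / b j) \<notin> q_powers q" if "j \<in> {3..6}" for j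
    using cb[OF that] q_powers_inverse_iff[of "c * b j"] by (simp_all add: mult.commute)
  have bb: "1 / b i / (1 / b j) \<notin> q_powers q" if "i \<in> {3..6}" "j \<in> {3..6}" "i \<noteq> j" for i j
    using quot[of j i] that by simp
  have ratio: "x / y \<notin> q_powers q" if "x \<in> A" "y \<in> A" "x \<noteq> y" for x y
    using that cb' bb unfolding A_def by (elim insertE imageE) (simp_all only:, metis+)
  have card: "4 < card A"
  proof -
    have inj: "inj_on (\<lambda>j. 1 / b j) {3..6}"
    proof (rule inj_onI)
      fix i j assume ij: "i \<in> {3..6::nat}" "j \<in> {3..6}" "1 / b i = 1 / b j"
      then have "1 / b i / (1 / b j) \<in> q_powers q" using b0[of j] by simp
      then show "i = j" using bb[OF ij(1,2)] by blast
    qed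
    have "c \<notin> (\<lambda>j. 1 / b j) ` {3..6}"
    proof
      assume "c \<in> (\<lambda>j. 1 / b j) ` {3..6}"
      then obtain j where j: "j \<in> {3..6}" "c = 1 / b j" by auto
      then have "1 / b j / c \<in> q_powers q" using b0[of j] by simp
      then show False using cb'(1)[OF j(1)] by blast
    qed
    then show ?thesis unfolding A_def by (simp add: card_image[OF inj])
  qed
  have shift_gen: "generic_pair (q powi k / b j) y \<longleftrightarrow> generic_pair (b j) y" if "j \<in> {1..6}" "y \<noteq> 0" for j k y
  proof -
    have bj: "b j \<noteq> 0" by (rule b0[OF that(1)])
    have "generic_pair (q powi k / b j) y \<longleftrightarrow> generic_pair (1 / b j) y"
      using generic_pair_q_shift[of "1 / b j" k y 0] by simp
    also have "\<dots> \<longleftrightarrow> generic_pair (b j) y"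
      using q_powers_inverse_iff[of "(b j)\<^sup>2"] q_powers_inverse_iff[of "y / b j"] bj that
      by (auto simp: generic_pair_def power_divide mult.commute)
    finally show ?thesis .
  qed
  have bgen: "generic_pair (b i) (b j)" if "i \<in> {1..6}" "j \<in> {1..6}" "i \<noteq> j" for i j
    using prodq[of i j] prodq[of i i] prodq[of j j] quot[of j i] that b0 by (auto simp: generic_pair_def power2_eq_square)
  have bk_l: "generic_pair (b j) l" "generic_pair (b j) m" if "j \<in> {1..6}" for j
    using gen[OF that] by auto
  have zero: "defect (parameter_path b t) l m = 0" if t: "t \<noteq> 0" for t
  proof (rule theta_growth_too_many_zeros[where d = 4 and A = A and f = "\<lambda>t. defect (parameter_path b t) l m",
      OF defect_path_holomorphic[OF bal lm(1,2)] defect_path_growth[OF bal lm(1,2)] _ _ card _ _ t])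
    show "finite A" by (simp add: A_def)
    show "0 \<notin> A" using c0 b0 by (auto simp: A_def)
    show "x / y \<notin> q_powers q" if "x \<in> A" "y \<in> A" "x \<noteq> y" for x y using ratio that by blast
    fix x k assume "x \<in> A"
    then consider "x = c" | j where "j \<in> {3..6}" "x = 1 / b j" by (auto simp: A_def)
    then show "defect (parameter_path b (x * q powi k)) l m = 0"
    proof cases
      case 1
      define u where "u = x * q powi k"
      have u0: "u \<noteq> 0" using c0 by (simp add: u_def 1)
      have p2: "parameter_path b u 2 = q powi (- k) / b 3"
        using b0[of 1] b0[of 2] b0[of 3] by (simp add: u_def 1 c_def power_int_minus field_simps)
      have "defect (parameter_path b u) l m = 0"
      proof (rule defect_eq_0_q_power_any[OF balanced_parameter_path[OF bal u0], of 2 3 4])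
        show "parameter_path b u 2 * parameter_path b u 3 \<in> q_powers q"
          unfolding p2 using b0[of 3] q_powersI[OF refl] by simp
        show "generic_pair (parameter_path b u 2) (parameter_path b u 4)"
          unfolding p2 using shift_gen[of 3 "b 4"] bgen[of 3 4] b0[of 4] by simp
        show "generic_pair (parameter_path b u 4) l" using bk_l(1)[of 4] by simp
        show "generic_pair (parameter_path b u 2) m" unfolding p2 using shift_gen[of 3 m] bk_l(2)[of 3] lm(2) by simp
      qed auto
      then show ?thesis by (simp add: u_def)
    next
      case 2
      define u where "u = x * q powi k"
      have u: "u = q powi k / b j" by (simp add: u_def 2)
      have bj: "b j \<noteq> 0" using 2 b0 by auto
      have u0: "u \<noteq> 0" using bj by (simp add: u)
      \<comment> \<open>An auxiliary third index; its parameter does not move on the path.\<close>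
      obtain i where i: "i \<in> {3..6}" "i \<noteq> j" using that[of 3] that[of 4] by (cases "j = 3") auto
      have simps: "parameter_path b u 1 = u" "parameter_path b u j = b j" "parameter_path b u i = b i"
        using 2(1) i(1) by auto
      have ij: "i \<in> {1..6}" "j \<in> {1..6}" "1 \<noteq> j" "1 \<noteq> i" "j \<noteq> i" using 2(1) i by auto
      have "defect (parameter_path b u) l m = 0"
      proof (rule defect_eq_0_q_power_any[OF balanced_parameter_path[OF bal u0], of 1 j i])
        show "parameter_path b u 1 * parameter_path b u j \<in> q_powers q"
          unfolding simps unfolding u using bj q_powersI[OF refl] by simp
        show "generic_pair (parameter_path b u 1) (parameter_path b u i)"
          unfolding simps unfolding u using shift_gen[of j "b i"] bgen[of j i] b0[of i] ij by simp
        show "generic_pair (parameter_path b u i) l" unfolding simps using bk_l(1) ij by simp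
        show "generic_pair (parameter_path b u 1) m"
          unfolding simps unfolding u using shift_gen[of j m] bk_l(2) ij lm(2) by simp
      qed (use ij in auto)
      then show ?thesis by (simp add: u_def)
    qed
  qed
  have "parameter_path b (b 1) = b" using b0[of 1] by (auto simp: parameter_path_def)
  then show ?thesis using zero[of "b 1"] b0[of 1] by simp
qed

lemma defect_eq_0:
  assumes b: "generic_parameters b" and lm: "l \<noteq> 0" "m \<noteq> 0" "l\<^sup>2 \<notin> q_powers q" "m\<^sup>2 \<notin> q_powers q"
    and gen: "\<And>j. j \<in> {1..6} \<Longrightarrow> generic_pair (b j) l \<and> generic_pair (b j) m"
  shows "defect b l m = 0"
proof (cases "b 1 * b 2 * (b 3)\<^sup>2 \<in> q_powers q")
  case False
  then show ?thesis by (intro defect_eq_0_noncritical[OF b lm gen])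
next
  case True
  have b0: "b 1 \<noteq> 0" "b 2 \<noteq> 0" "b 3 \<noteq> 0" using b by (auto simp: generic_parameters_def balanced_def)
  define p where "p = Transposition.transpose 2 (3::nat)"
  have p: "p permutes {1..6}" unfolding p_def by (rule permutes_swap_id) auto
  have "(b \<circ> p) 1 * (b \<circ> p) 2 * ((b \<circ> p) 3)\<^sup>2 \<notin> q_powers q"
  proof
    assume "(b \<circ> p) 1 * (b \<circ> p) 2 * ((b \<circ> p) 3)\<^sup>2 \<in> q_powers q"
    then have "b 1 * b 3 * (b 2)\<^sup>2 \<in> q_powers q" by (simp add: p_def Transposition.transpose_def)
    then have "b 1 * b 3 * (b 2)\<^sup>2 / (b 1 * b 2 * (b 3)\<^sup>2) \<in> q_powers q" using True by (rule q_powers_divide)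
    moreover have "b 1 * b 3 * (b 2)\<^sup>2 / (b 1 * b 2 * (b 3)\<^sup>2) = b 2 / b 3"
      using b0 by (simp add: power2_eq_square)
    ultimately show False using b by (auto simp: generic_parameters_def)
  qed
  moreover have "generic_pair ((b \<circ> p) j) l \<and> generic_pair ((b \<circ> p) j) m" if "j \<in> {1..6}" for j
    using gen[of "p j"] that permutes_in_image[OF p] by simp
  ultimately have "defect (b \<circ> p) l m = 0"
    using defect_eq_0_noncritical[OF generic_parameters_permute[OF p b] lm] by blast
  then show ?thesis by (simp add: defect_permute[OF p])
qed

section \<open>Quasi-periodicity and the prefactor\<close>

text \<open>The inverse of the factor that \<open>theta\<close> picks up when \<open>a\<close> is multiplied by
  \<open>q\<^bsup>k\<^esup>\<close>; see \<open>theta_shift\<close>.\<close>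

definition shift_factor :: "complex \<Rightarrow> int \<Rightarrow> complex" where
  "shift_factor a k = (- a) powi k * q powi (k * (k - 1) div 2)"

lemma triangular_succ: "(k + 1) * (k + 1 - 1) div 2 = k * (k - 1) div 2 + k" for k :: int
proof -
  have "(k + 1) * (k + 1 - 1) = k * (k - 1) + k * 2" by (simp add: algebra_simps)
  then show ?thesis by simp
qed

lemma two_triangular: "2 * (k * (k - 1) div 2) = k * (k - 1)" for k :: int
  by (rule dvd_mult_div_cancel) simp

lemma shift_factor_succ: "shift_factor a (k + 1) = shift_factor a k * (- a * q powi k)" if "a \<noteq> 0"
  using that unfolding shift_factor_def triangular_succ by (simp add: power_int_add)

lemma theta_shift:
  assumes "a \<noteq> 0"
  shows "theta (a * q powi k) * shift_factor a k = theta a"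
proof -
  have step: "theta (a * q powi (k + 1)) * shift_factor a (k + 1) = theta (a * q powi k) * shift_factor a k" for k
  proof -
    have "a * q powi (k + 1) = q * (a * q powi k)" by (simp add: power_int_add)
    then have "theta (a * q powi (k + 1)) = - theta (a * q powi k) / (a * q powi k)"
      using assms by (simp only: theta_q[of "a * q powi k"] mult_eq_0_iff power_int_eq_0_iff q_nonzero simp_thms)
    then show ?thesis using assms by (simp add: shift_factor_succ)
  qed
  show ?thesis
  proof (induction k rule: int_induct[of _ 0])
    case base then show ?case by (simp add: shift_factor_def)
  next
    case (step1 i) then show ?case using step[of i] by simp
  next
    case (step2 i) then show ?case using step[of "i - 1"] by simp
  qed
qed

lemma qpoch_neg: "qpoch q a (- int n) = inverse (\<Prod>i<n. 1 - a / q ^ n * q ^ i)"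
proof (cases "n = 0")
  case False
  have "(\<Prod>i\<in>{1..n}. 1 - a * q powi - int i) = (\<Prod>i<n. 1 - a / q ^ n * q ^ i)"
    by (rule prod.reindex_bij_witness[of _ "\<lambda>i. n - i" "\<lambda>i. n - i"])
       (auto simp: power_int_minus power_diff field_simps)
  then show ?thesis using False by (simp add: qpoch_def)
qed (simp add: qpoch_def)

lemma phi_qpoch:
  assumes "a \<notin> q_powers q"
  shows "phi a = qpoch q a k * phi (a * q powi k)" and "qpoch q a k \<noteq> 0"
proof -
  have nz: "1 - a * q powi j \<noteq> 0" for j
  proof
    assume "1 - a * q powi j = 0"
    then have "a * q powi j \<in> q_powers q" by simp
    then show False using assms by (simp add: q_powers_mult_iff)
  qed
  have "phi a = qpoch q a k * phi (a * q powi k) \<and> qpoch q a k \<noteq> 0"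
  proof (cases k rule: int_cases2)
    case (nonneg n)
    have "(\<Prod>i<n. 1 - a * q ^ i) \<noteq> 0" using nz[of "int _"] by simp
    then show ?thesis using phi_split[of a n] nonneg by (simp add: qpoch_def)
  next
    case (nonpos n)
    have "1 - a / q ^ n * q ^ i \<noteq> 0" for i
      using nz[of "int i - int n"] by (simp add: power_int_diff)
    then have "(\<Prod>i<n. 1 - a / q ^ n * q ^ i) \<noteq> 0" by simp
    moreover have "phi (a / q ^ n) = (\<Prod>i<n. 1 - a / q ^ n * q ^ i) * phi a"
      using phi_split[of "a / q ^ n" n] by simp
    ultimately show ?thesis using nonpos by (simp add: qpoch_neg power_int_minus divide_inverse)
  qed
  then show "phi a = qpoch q a k * phi (a * q powi k)" and "qpoch q a k \<noteq> 0" by auto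
qed

lemma phi_nonzero: "a \<notin> q_powers q \<Longrightarrow> phi a \<noteq> 0"
proof
  assume a: "a \<notin> q_powers q" and "phi a = 0"
  then obtain j where "a * q ^ j = 1" by (auto simp: phi_eq_0_iff)
  then have "a = 1 / q ^ j" by (simp add: field_simps)
  then show False using a by (simp add: q_powers_inverse_iff)
qed

text \<open>The shift of \<open>theta\<close> with one of its two infinite products cancelled.\<close>

lemma qpoch_reflect:
  assumes "a \<notin> q_powers q" "a \<noteq> 0"
  shows "qpoch q a k * phi (q / a) = shift_factor a k * phi (q / (a * q powi k))"
proof -
  have "phi (a * q powi k) \<noteq> 0" using assms by (intro phi_nonzero) (simp add: q_powers_mult_iff)
  moreover have "phi (a * q powi k) * (qpoch q a k * phi (q / a)) =
      phi (a * q powi k) * (shift_factor a k * phi (q / (a * q powi k)))"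
  proof -
    have "phi (a * q powi k) * (qpoch q a k * phi (q / a)) = theta a"
      unfolding qtheta_def phi_qpoch(1)[OF assms(1), of k] by (simp only: mult_ac)
    also have "\<dots> = theta (a * q powi k) * shift_factor a k" by (simp only: theta_shift[OF assms(2)])
    finally show ?thesis by (simp only: qtheta_def mult_ac)
  qed
  ultimately show ?thesis by simp
qed

text \<open>The prefactor without \<open>(1 - l\<^bsup>2\<^esup>) G(l)\<close>, which the series absorbs
  (\<open>prefactor_eq\<close>).\<close>

definition theta_weight :: "(nat \<Rightarrow> complex) \<Rightarrow> complex \<Rightarrow> complex \<Rightarrow> complex" where
  "theta_weight b l m = theta_bracket b m /
    (phi q * (theta (l\<^sup>2) * theta (m\<^sup>2) * theta (l * m) * theta (m / l)) * pair_product b)"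

lemma prefactor_eq: "prefactor q b l m = (1 - l\<^sup>2) * weight_G b l * theta_weight b l m"
  by (simp add: prefactor_def theta_weight_def weight_G_def theta_bracket_def pair_product_def)

lemma weight_G_series_term:
  assumes b: "balanced b" and l: "l \<noteq> 0" "l\<^sup>2 \<noteq> 1"
    and gen: "\<And>j. j \<in> {1..6} \<Longrightarrow> l * b j \<notin> q_powers q \<and> l / b j \<notin> q_powers q"
  shows "(1 - l\<^sup>2) * weight_G b l * series_term q b f l x =
    bilateral_term b l x * eval_rat f ((l * q powi x + inverse l * q powi (- x)) / 2)"
proof -
  define C where "C = x * (x - 1) div 2"
  have C: "x + (x + 6 * C) = 3 * x\<^sup>2 - x"
    using two_triangular[of x, folded C_def] by (simp add: power2_eq_square algebra_simps)
  have b0: "b j \<noteq> 0" if "j \<in> {1..6}" for j using b that by (auto simp: balanced_def)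
  have "(\<Prod>j\<in>{1..6}. qpoch q (l * b j) x / qpoch q (q * l / b j) x) * weight_G b l =
      (\<Prod>j\<in>{1..6}. shift_factor (l * b j) x * (phi (q * (l * q powi x) / b j) * phi (q * inverse (l * q powi x) / b j)))"
    unfolding weight_G_def prod.distrib[symmetric]
  proof (rule prod.cong[OF refl])
    fix j :: nat assume j: "j \<in> {1..6}"
    note bj = b0[OF j]
    have "q * l / b j \<notin> q_powers q"
      using gen[OF j] q_powers_mult_iff[of "l / b j" 1] by (simp add: mult_ac)
    then have 1: "phi (q * l / b j) = qpoch q (q * l / b j) x * phi (q * (l * q powi x) / b j)"
      "qpoch q (q * l / b j) x \<noteq> 0"
      using phi_qpoch[of "q * l / b j" x] by (simp_all add: mult_ac)
    have 2: "qpoch q (l * b j) x * phi (q * inverse l / b j) =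
        shift_factor (l * b j) x * phi (q * inverse (l * q powi x) / b j)"
      using qpoch_reflect[of "l * b j" x] gen[OF j] bj l by (simp add: divide_inverse mult_ac)
    have "qpoch q (l * b j) x / qpoch q (q * l / b j) x * (phi (q * l / b j) * phi (q * inverse l / b j)) =
       (qpoch q (l * b j) x * phi (q * inverse l / b j)) * phi (q * (l * q powi x) / b j)"
      unfolding 1(1) using 1(2) by (simp add: mult_ac)
    then show "qpoch q (l * b j) x / qpoch q (q * l / b j) x * (phi (q * l / b j) * phi (q * inverse l / b j)) =
      shift_factor (l * b j) x * (phi (q * (l * q powi x) / b j) * phi (q * inverse (l * q powi x) / b j))"
      unfolding 2 by (simp add: mult_ac)
  qed
  also have "\<dots> = (\<Prod>j\<in>{1..6}. shift_factor (l * b j) x) * weight_G b (l * q powi x)"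
    by (simp add: prod.distrib weight_G_def)
  also have "(\<Prod>j\<in>{1..6}. shift_factor (l * b j) x) = (\<Prod>j\<in>{1..6}. - (l * b j)) powi x * q powi (6 * C)"
  proof -
    have "(\<Prod>j\<in>{1..6}. u j powi x) = (\<Prod>j\<in>{1..6}. u j) powi x" for u :: "nat \<Rightarrow> complex"
      unfolding prod_6 by (simp only: power_int_mult_distrib)
    moreover have "(q powi C) ^ 6 = q powi (6 * C)"
      using power_int_mult[of q C 6] by (simp add: mult.commute)
    ultimately show ?thesis
      unfolding shift_factor_def C_def[symmetric] prod.distrib by simp
  qed
  also have "(\<Prod>j\<in>{1..6}. - (l * b j)) = l ^ 6 * q"
    using b by (simp add: balanced_def prod.distrib prod_uminus)
  also have "(l ^ 6 * q) powi x * q powi (6 * C) = l powi (6 * x) * q powi (x + 6 * C)"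
    by (simp add: power_int_mult_distrib power_int_add power_int_mult)
  finally have eq: "(\<Prod>j\<in>{1..6}. qpoch q (l * b j) x / qpoch q (q * l / b j) x) * weight_G b l =
      l powi (6 * x) * q powi (x + 6 * C) * weight_G b (l * q powi x)" .
  have "(1 - l\<^sup>2) * weight_G b l * series_term q b f l x =
     (1 - l\<^sup>2 * q powi (2 * x)) * q powi x *
     ((\<Prod>j\<in>{1..6}. qpoch q (l * b j) x / qpoch q (q * l / b j) x) * weight_G b l) *
     eval_rat f ((l * q powi x + inverse l * q powi (- x)) / 2)"
    unfolding series_term_def using l by simp
  also have "\<dots> = (1 - l\<^sup>2 * q powi (2 * x)) * l powi (6 * x) * (q powi x * q powi (x + 6 * C)) *
     weight_G b (l * q powi x) * eval_rat f ((l * q powi x + inverse l * q powi (- x)) / 2)"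
    unfolding eq by (simp only: mult_ac)
  also have "q powi x * q powi (x + 6 * C) = q powi (3 * x\<^sup>2 - x)"
    unfolding C[symmetric] by (rule power_int_add[symmetric]) simp
  finally show ?thesis unfolding bilateral_term_def .
qed

lemma pair_product_nonzero:
  assumes "generic_parameters b"
  shows "pair_product b \<noteq> 0"
proof -
  have "phi (q / (b i * b j)) \<noteq> 0" if "i \<in> {1..6}" "j \<in> {i<..6}" for i j
  proof -
    have "b i * b j \<notin> q_powers q" using assms that by (auto simp: generic_parameters_def)
    then have "1 / (b i * b j) * q powi 1 \<notin> q_powers q"
      by (simp only: q_powers_mult_iff q_powers_inverse_iff not_False_eq_True)
    then show ?thesis by (intro phi_nonzero) simp
  qed
  then show ?thesis by (simp add: pair_product_def)
qed

lemma theta_weight_sum: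
  assumes "generic_parameters b" "l \<noteq> 0" "m \<noteq> 0" "l\<^sup>2 \<notin> q_powers q" "m\<^sup>2 \<notin> q_powers q"
    "l * m \<notin> q_powers q" "m / l \<notin> q_powers q"
    and "\<And>j. j \<in> {1..6} \<Longrightarrow> generic_pair (b j) l \<and> generic_pair (b j) m"
  shows "theta_weight b l m * bilateral_sum b l + theta_weight b m l * bilateral_sum b m = 1"
proof -
  have "defect b l m = 0" by (rule defect_eq_0) (use assms in auto)
  then have eq: "l * bilateral_sum b l * theta_bracket b m - m * bilateral_sum b m * theta_bracket b l =
     l * theta (l\<^sup>2) * theta (m\<^sup>2) * theta (l * m) * theta (m / l) * (phi q * pair_product b)"
    by (simp add: defect_def theta_kernel_def)
  have pp: "pair_product b \<noteq> 0" by (rule pair_product_nonzero[OF assms(1)])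
  have phi_q: "phi q \<noteq> 0"
    using q_power_eq_1_iff[of "Suc _"] by (auto simp: phi_eq_0_iff)
  define t where "t = theta (m / l)"
  define Z where "Z = phi q * (theta (l\<^sup>2) * theta (m\<^sup>2) * theta (l * m)) * pair_product b"
  have nz: "t \<noteq> 0" "Z \<noteq> 0"
    using assms pp phi_q by (auto simp: t_def Z_def theta_eq_0_iff)
  have inv: "theta (l / m) = - (l / m) * t"
    using theta_inverse[of "m / l"] assms(2,3) by (simp add: t_def)
  have w1: "theta_weight b l m = theta_bracket b m / (Z * t)"
    by (simp add: theta_weight_def Z_def t_def mult_ac)
  have w2: "theta_weight b m l = theta_bracket b l / (Z * (- (l / m) * t))"
    unfolding theta_weight_def inv Z_def by (simp add: mult_ac)
  have "theta_weight b l m * bilateral_sum b l + theta_weight b m l * bilateral_sum b m =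
     (l * bilateral_sum b l * theta_bracket b m - m * bilateral_sum b m * theta_bracket b l) / (l * Z * t)"
    unfolding w1 w2 using nz assms(2,3) by (simp add: field_simps)
  also have "\<dots> = 1"
    unfolding eq using nz assms(2,3) by (simp add: Z_def t_def mult_ac)
  finally show ?thesis .
qed

section \<open>Shifting the parameters\<close>

definition shifted :: "(nat \<Rightarrow> complex) \<Rightarrow> (nat \<Rightarrow> int) \<Rightarrow> nat \<Rightarrow> complex" where
  "shifted b k j = b j * q powi k j"

text \<open>The denominator in the prescribed value of the functional on a generator.\<close>

definition generator_scale :: "(nat \<Rightarrow> complex) \<Rightarrow> (nat \<Rightarrow> int) \<Rightarrow> complex" where
  "generator_scale b k = (\<Prod>j\<in>{1..6}. q powi (k j * (k j - 1) div 2) * b j powi k j)"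

lemma prod_powi:
  fixes x :: complex
  assumes "x \<noteq> 0" "finite A"
  shows "(\<Prod>i\<in>A. x powi f i) = x powi (\<Sum>i\<in>A. f i)"
  using assms(2) by (induction A rule: finite_induct) (simp_all add: assms(1) power_int_add)

lemma generic_parameters_shifted:
  assumes b: "generic_parameters b" and k: "(\<Sum>j\<in>{1..6}. k j) = 0"
  shows "generic_parameters (shifted b k)"
proof -
  have "(\<Prod>j\<in>{1..6}. shifted b k j) = (\<Prod>j\<in>{1..6}. b j)"
    using k by (simp add: shifted_def prod.distrib prod_powi)
  then have "balanced (shifted b k)"
    using b by (auto simp: generic_parameters_def balanced_def shifted_def)
  moreover have "shifted b k i * shifted b k j = b i * b j * q powi (k i + k j)"
    "shifted b k i / shifted b k j = b i / b j * q powi (k i - k j)" for i j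
    by (simp_all add: shifted_def power_int_add power_int_diff)
  ultimately show ?thesis
    using b unfolding generic_parameters_def by (simp only: q_powers_mult_iff) blast
qed

lemma weight_G_shifted:
  assumes b0: "\<And>j. j \<in> {1..6} \<Longrightarrow> b j \<noteq> 0" and z: "z \<noteq> 0"
    and gen: "\<And>j. j \<in> {1..6} \<Longrightarrow> z * b j \<notin> q_powers q \<and> b j / z \<notin> q_powers q"
  shows "weight_G (shifted b k) z * (generator_scale b k)\<^sup>2 =
    weight_G b z * (\<Prod>j\<in>{1..6}. qpoch q (b j * z) (k j) * qpoch q (b j / z) (k j))"
proof -
  have "weight_G (shifted b k) z * (generator_scale b k)\<^sup>2 = (\<Prod>j\<in>{1..6}. phi (q * z / shifted b k j) * phi (q * inverse z / shifted b k j)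
     * (q powi (k j * (k j - 1) div 2) * b j powi k j)\<^sup>2)"
    unfolding weight_G_def generator_scale_def prod_power_distrib prod.distrib[symmetric] ..
  also have "\<dots> = (\<Prod>j\<in>{1..6}. (phi (q * z / b j) * phi (q * inverse z / b j)) * (qpoch q (b j * z) (k j) * qpoch q (b j / z) (k j)))"
  proof (rule prod.cong[OF refl])
    fix j :: nat assume j: "j \<in> {1..6}"
    note bj = b0[OF j]
    have 1: "qpoch q (b j * z) (k j) * phi (q * inverse z / b j) = shift_factor (b j * z) (k j) * phi (q * inverse z / shifted b k j)"
      using qpoch_reflect[of "b j * z" "k j"] gen[OF j] bj z by (simp add: shifted_def divide_inverse mult_ac)
    have 2: "qpoch q (b j / z) (k j) * phi (q * z / b j) = shift_factor (b j / z) (k j) * phi (q * z / shifted b k j)"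
      using qpoch_reflect[of "b j / z" "k j"] gen[OF j] bj z by (simp add: shifted_def mult_ac)
    have 3: "shift_factor (b j * z) (k j) * shift_factor (b j / z) (k j) = (q powi (k j * (k j - 1) div 2) * b j powi k j)\<^sup>2"
      using z bj unfolding shift_factor_def power2_eq_square
      by (simp add: power_int_mult_distrib power_int_divide_distrib power_int_minus_left divide_simps)
    have "(phi (q * z / b j) * phi (q * inverse z / b j)) * (qpoch q (b j * z) (k j) * qpoch q (b j / z) (k j)) =
       (qpoch q (b j * z) (k j) * phi (q * inverse z / b j)) * (qpoch q (b j / z) (k j) * phi (q * z / b j))"
      by (simp only: mult_ac)
    also have "\<dots> = phi (q * z / shifted b k j) * phi (q * inverse z / shifted b k j) * (shift_factor (b j * z) (k j) * shift_factor (b j / z) (k j))"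
      unfolding 1 2 by (simp only: mult_ac)
    finally show "phi (q * z / shifted b k j) * phi (q * inverse z / shifted b k j) * (q powi (k j * (k j - 1) div 2) * b j powi k j)\<^sup>2 =
      (phi (q * z / b j) * phi (q * inverse z / b j)) * (qpoch q (b j * z) (k j) * qpoch q (b j / z) (k j))"
      unfolding 3 ..
  qed
  also have "\<dots> = weight_G b z * (\<Prod>j\<in>{1..6}. qpoch q (b j * z) (k j) * qpoch q (b j / z) (k j))"
    by (simp add: weight_G_def prod.distrib)
  finally show ?thesis .
qed

lemma prod_shift_factor:
  assumes k: "(\<Sum>j\<in>{1..6}. k j) = 0" and c: "c \<noteq> 0"
  shows "(\<Prod>j\<in>{1..6}. shift_factor (c * b j) (k j)) = generator_scale b k"
proof -
  have "shift_factor (c * b j) (k j) = (- c) powi k j * (q powi (k j * (k j - 1) div 2) * b j powi k j)" for j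
    by (simp add: shift_factor_def mult_ac flip: power_int_mult_distrib)
  then have "(\<Prod>j\<in>{1..6}. shift_factor (c * b j) (k j)) = (\<Prod>j\<in>{1..6}. (- c) powi k j) * generator_scale b k"
    unfolding generator_scale_def by (simp only: prod.distrib)
  then show ?thesis using k c by (simp add: prod_powi)
qed

lemma theta_bracket_shifted:
  assumes b0: "\<And>j. j \<in> {1..6} \<Longrightarrow> b j \<noteq> 0" and m: "m \<noteq> 0" and k: "(\<Sum>j\<in>{1..6}. k j) = 0"
  shows "theta_bracket (shifted b k) m * generator_scale b k = theta_bracket b m"
proof -
  have "(\<Prod>j\<in>{1..6}. theta (m * shifted b k j)) * generator_scale b k = (\<Prod>j\<in>{1..6}. theta (m * b j))"
    unfolding prod_shift_factor[OF k m, of b, symmetric] prod.distrib[symmetric]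
    using theta_shift b0 m by (intro prod.cong refl) (simp add: shifted_def mult.assoc[symmetric])
  moreover have "(\<Prod>j\<in>{1..6}. theta (m / shifted b k j)) * generator_scale b k = (\<Prod>j\<in>{1..6}. theta (m / b j))"
  proof -
    have reflect: "theta (m / y) = theta (q / m * y)" if "y \<noteq> 0" for y
      using that m by (simp add: qtheta_def mult.commute)
    have "q / m \<noteq> 0" using m by simp
    show ?thesis
      unfolding prod_shift_factor[OF k \<open>q / m \<noteq> 0\<close>, of b, symmetric] prod.distrib[symmetric]
    proof (rule prod.cong[OF refl])
      fix j :: nat assume j: "j \<in> {1..6}"
      show "theta (m / shifted b k j) * shift_factor (q / m * b j) (k j) = theta (m / b j)"
        using theta_shift[of "q / m * b j" "k j"] b0[OF j] m reflect[of "shifted b k j"] reflect[of "b j"]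
        by (simp add: shifted_def mult.assoc)
    qed
  qed
  ultimately show ?thesis unfolding theta_bracket_def by (simp add: left_diff_distrib mult.assoc)
qed

lemma intervals_6:
  "{1..6} = {1, 2, 3, 4, 5, 6::nat}" "{1<..6} = {2, 3, 4, 5, 6::nat}" "{2<..6} = {3, 4, 5, 6::nat}"
  "{3<..6} = {4, 5, 6::nat}" "{4<..6} = {5, 6::nat}" "{5<..6} = {6::nat}" "{6<..6} = ({}::nat set)"
  by auto

lemma sum_6: "(\<Sum>j\<in>{1..6}. g j) = g 1 + g 2 + g 3 + g 4 + g 5 + g 6" for g :: "nat \<Rightarrow> int"
  unfolding intervals_6(1) by (simp add: add.assoc)

lemma prod_pairs_symmetric:
  "(\<Prod>i\<in>{1..6}. \<Prod>j\<in>{i<..6}. h i j * h j i) = (\<Prod>i\<in>{1..6}. \<Prod>j\<in>{1..6} - {i}. h i j)" for h :: "nat \<Rightarrow> nat \<Rightarrow> complex"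
  unfolding prod_6[of "\<lambda>i. \<Prod>j\<in>{i<..6}. h i j * h j i"] prod_6[of "\<lambda>i. \<Prod>j\<in>{1..6} - {i}. h i j"]
  unfolding intervals_6 by (simp add: insert_Diff_if mult_ac)

text \<open>The quadratic exponents collected over all pairs sum to four times those of the single parameters because
  the \<open>k j\<close> sum to zero.\<close>

lemma pair_product_shifted:
  assumes b0: "\<And>j. j \<in> {1..6} \<Longrightarrow> b j \<noteq> 0" and k: "(\<Sum>j\<in>{1..6}. k j) = 0"
    and gen: "\<And>i j. i \<in> {1..6} \<Longrightarrow> j \<in> {1..6} \<Longrightarrow> b i * b j \<notin> q_powers q"
  shows "pair_product (shifted b k) * (generator_scale b k) ^ 4 =
    pair_product b * (\<Prod>i\<in>{1..6}. \<Prod>j\<in>{i<..6}. qpoch q (b i * b j) (k i + k j))"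
proof -
  define C where "C = (\<lambda>x::int. x * (x - 1) div 2)"
  have C2: "2 * C x = x * (x - 1)" for x unfolding C_def by (rule two_triangular)
  have step: "phi (q / (shifted b k i * shifted b k j)) * shift_factor (b i * b j) (k i + k j) =
      phi (q / (b i * b j)) * qpoch q (b i * b j) (k i + k j)" if "i \<in> {1..6}" "j \<in> {i<..6}" for i j
  proof -
    have "b i * b j * q powi (k i + k j) = shifted b k i * shifted b k j"
      by (simp add: shifted_def power_int_add)
    then show ?thesis
      using qpoch_reflect[of "b i * b j" "k i + k j"] gen[of i j] b0[of i] b0[of j] that by (simp add: mult.commute)
  qed
  have "pair_product (shifted b k) * (\<Prod>i\<in>{1..6}. \<Prod>j\<in>{i<..6}. shift_factor (b i * b j) (k i + k j)) =
    pair_product b * (\<Prod>i\<in>{1..6}. \<Prod>j\<in>{i<..6}. qpoch q (b i * b j) (k i + k j))"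
    unfolding pair_product_def prod.distrib[symmetric] by (intro prod.cong refl step)
  moreover have "(\<Prod>i\<in>{1..6}. \<Prod>j\<in>{i<..6}. shift_factor (b i * b j) (k i + k j)) = (generator_scale b k) ^ 4"
  proof -
    have "(\<Prod>i\<in>{1..6}. \<Prod>j\<in>{i<..6}. shift_factor (b i * b j) (k i + k j)) =
      (\<Prod>i\<in>{1..6}. \<Prod>j\<in>{i<..6}. (-1) powi (k i + k j) * q powi (C (k i + k j)) * (b i powi (k i + k j) * b j powi (k j + k i)))"
    proof (intro prod.cong refl)
      fix i j
      have "(- (b i * b j)) powi (k i + k j) = (-1) powi (k i + k j) * (b i powi (k i + k j) * b j powi (k j + k i))"
        by (simp add: add.commute[of "k j"] flip: power_int_mult_distrib)
      then show "shift_factor (b i * b j) (k i + k j) = (-1) powi (k i + k j) * q powi (C (k i + k j)) * (b i powi (k i + k j) * b j powi (k j + k i))"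
        by (simp add: shift_factor_def C_def)
    qed
    also have "\<dots> = (\<Prod>i\<in>{1..6}. \<Prod>j\<in>{i<..6}. (-1) powi (k i + k j)) * (\<Prod>i\<in>{1..6}. \<Prod>j\<in>{i<..6}. q powi (C (k i + k j)))
       * (\<Prod>i\<in>{1..6}. \<Prod>j\<in>{i<..6}. b i powi (k i + k j) * b j powi (k j + k i))"
      by (simp only: prod.distrib)
    also have "(\<Prod>i\<in>{1..6}. \<Prod>j\<in>{i<..6}. b i powi (k i + k j) * b j powi (k j + k i)) = (\<Prod>i\<in>{1..6}. b i powi k i) ^ 4"
    proof -
      have "(\<Prod>j\<in>{1..6} - {i}. b i powi (k i + k j)) = (b i powi k i) ^ 4" if "i \<in> {1..6}" for i
      proof -
        have "(\<Sum>j\<in>{1..6} - {i}. k i + k j) = 5 * k i + (\<Sum>j\<in>{1..6} - {i}. k j)"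
          using that by (simp add: sum.distrib)
        also have "(\<Sum>j\<in>{1..6} - {i}. k j) = - k i"
          using sum.remove[of "{1..6}" i k] k that by simp
        finally have "(\<Sum>j\<in>{1..6} - {i}. k i + k j) = k i * 4" by simp
        then show ?thesis using b0[OF that] by (simp add: prod_powi power_int_mult)
      qed
      then show ?thesis
        unfolding prod_pairs_symmetric[of "\<lambda>i j. b i powi (k i + k j)"] by (simp add: prod_power_distrib)
    qed
    also have "(\<Prod>i\<in>{1..6}. \<Prod>j\<in>{i<..6}. (- 1 :: complex) powi (k i + k j)) = 1"
    proof -
      have "(\<Prod>i\<in>{1..6}. \<Prod>j\<in>{i<..6}. (- 1 :: complex) powi (k i + k j)) =
          (\<Prod>i\<in>{1..6}. \<Prod>j\<in>{i<..6}. (-1) powi k i * (-1) powi k j)"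
        by (simp add: power_int_add)
      also have "\<dots> = (\<Prod>i\<in>{1..6}. ((-1) powi k i) ^ 5)"
        unfolding prod_pairs_symmetric[of "\<lambda>i j. (-1) powi k i"] by simp
      also have "\<dots> = (\<Prod>i\<in>{1..6}. (- 1 :: complex) powi k i) ^ 5" by (simp only: prod_power_distrib)
      also have "\<dots> = 1" using k by (simp add: prod_powi)
      finally show ?thesis .
    qed
    also have "(\<Prod>i\<in>{1..6}. \<Prod>j\<in>{i<..6}. q powi (C (k i + k j))) = (\<Prod>i\<in>{1..6}. q powi (C (k i))) ^ 4"
    proof -
      have "(\<Sum>i\<in>{1..6}. \<Sum>j\<in>{i<..6}. C (k i + k j)) = (\<Sum>i\<in>{1..6}. C (k i)) * 4"
      proof -
        have k6: "k 6 = - (k 1 + k 2 + k 3 + k 4 + k 5)" using k unfolding sum_6 by simp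
        have "2 * (\<Sum>i\<in>{1..6}. \<Sum>j\<in>{i<..6}. C (k i + k j)) = (\<Sum>i\<in>{1..6}. \<Sum>j\<in>{i<..6}. (k i + k j) * (k i + k j - 1))"
          by (simp add: sum_distrib_left C2)
        also have "\<dots> = 4 * (\<Sum>i\<in>{1..6}. k i * (k i - 1))"
          unfolding sum_6 unfolding intervals_6 by (simp add: k6) algebra
        also have "\<dots> = 2 * ((\<Sum>i\<in>{1..6}. C (k i)) * 4)"
          by (simp add: sum_distrib_left C2[symmetric])
        finally show ?thesis by simp
      qed
      then show ?thesis by (simp add: prod_powi power_int_mult)
    qed
    finally show ?thesis
      by (simp add: generator_scale_def C_def prod.distrib power_mult_distrib)
  qed
  ultimately show ?thesis by simp
qed

end

section \<open>Rational functions with prescribed poles\<close>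

definition pole_at :: "complex \<Rightarrow> complex" where
  "pole_at c = (c + 1 / c) / 2"

lemma zpm_factor_linear: "c \<noteq> 0 \<Longrightarrow> zpm_factor c = smult (- 2 * c) [:- pole_at c, 1:]"
  by (simp add: zpm_factor_def pole_at_def power2_eq_square algebra_simps)

lemma zpm_factor_nonzero: "c \<noteq> 0 \<Longrightarrow> zpm_factor c \<noteq> 0"
  by (simp add: zpm_factor_def)

lemma degree_zpm_factor: "c \<noteq> 0 \<Longrightarrow> degree (zpm_factor c) = 1"
  by (simp add: zpm_factor_def)

lemma poly_zpm_factor_eq_0_iff: "c \<noteq> 0 \<Longrightarrow> poly (zpm_factor c) x = 0 \<longleftrightarrow> x = pole_at c"
  by (subst zpm_factor_linear) auto

lemma pole_at_eq_iff:
  assumes "c \<noteq> 0" "d \<noteq> 0"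
  shows "pole_at c = pole_at d \<longleftrightarrow> c = d \<or> c * d = 1"
proof -
  have "c * inverse c = 1" "d * inverse d = 1" using assms by simp_all
  then have "2 * (c * d) * (pole_at c - pole_at d) = (c - d) * (c * d - 1)"
    unfolding pole_at_def divide_inverse mult_1_left by (simp add: algebra_simps)
  then have "pole_at c - pole_at d = 0 \<longleftrightarrow> (c - d) * (c * d - 1) = 0" using assms by (metis mult_eq_0_iff zero_neq_numeral)
  then show ?thesis by auto
qed

lemma Fract_add_same: "D \<noteq> 0 \<Longrightarrow> Fract N D + Fract M D = Fract (N + M) D" for D :: "complex poly"
  by (simp add: eq_fract algebra_simps)

lemma to_fract_const_mult: "to_fract [:c:] * Fract N D = Fract (smult c N) D" for D :: "complex poly"
  by (simp add: to_fract_def)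

lemma quot_of_Fract:
  fixes N D :: "complex poly"
  assumes "D \<noteq> 0"
  obtains e where "N = fst (quot_of_fract (Fract N D)) * e" "D = snd (quot_of_fract (Fract N D)) * e" "e \<noteq> 0"
proof -
  have "quot_of_fract (Fract N D) = normalize_quot (N, D)"
    using quot_of_fract_quot_to_fract[of "(N, D)"] assms by (simp add: quot_to_fract_def)
  then show ?thesis
    using normalize_quotE[OF assms, of N] that assms by (metis fst_conv mult_eq_0_iff snd_conv)
qed

context q_base
begin

text \<open>Intervals of integers treat positive and negative indices of \<open>zpm_poch\<close> alike, as in
  \<open>zpm_poch_interval\<close>.\<close>

definition zpm_interval :: "complex \<Rightarrow> int \<Rightarrow> int \<Rightarrow> complex poly" where
  "zpm_interval c lo hi = (\<Prod>i\<in>{lo..<hi}. zpm_factor (c * q powi i))"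

lemma zpm_interval_concat:
  assumes "lo \<le> mid" "mid \<le> hi"
  shows "zpm_interval c lo hi = zpm_interval c lo mid * zpm_interval c mid hi"
  unfolding zpm_interval_def
  by (subst prod.union_disjoint[symmetric]) (use assms in \<open>auto simp: ivl_disj_un_two\<close>)

lemma zpm_interval_nonzero: "c \<noteq> 0 \<Longrightarrow> zpm_interval c lo hi \<noteq> 0"
  by (simp add: zpm_interval_def zpm_factor_nonzero)

lemma degree_zpm_interval: "c \<noteq> 0 \<Longrightarrow> degree (zpm_interval c lo hi) = nat (hi - lo)"
  unfolding zpm_interval_def
  by (subst degree_prod_eq_sum_degree) (simp_all add: zpm_factor_nonzero degree_zpm_factor)

lemma zpm_poch_interval:
  assumes c: "c \<noteq> 0" and k: "- int n \<le> k"
  shows "zpm_poch q c k = Fract (zpm_interval c (- int n) k) (zpm_interval c (- int n) 0)"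
proof (cases "k \<ge> 0")
  case True
  have "(\<Prod>i<nat k. zpm_factor (c * q ^ i)) = zpm_interval c 0 k"
    unfolding zpm_interval_def
    by (rule prod.reindex_bij_witness[of _ nat int]) (use True in auto)
  then show ?thesis
    using True zpm_interval_concat[of "- int n" 0 k c] c
    by (simp add: zpm_poch_def eq_fract zpm_interval_nonzero)
next
  case False
  have "(\<Prod>i\<in>{1..nat (- k)}. zpm_factor (c * q powi (- int i))) = zpm_interval c k 0"
    unfolding zpm_interval_def
    by (rule prod.reindex_bij_witness[of _ "\<lambda>i. nat (- i)" "\<lambda>i. - int i"]) (use False in auto)
  then show ?thesis
    using False k zpm_interval_concat[of "- int n" k 0 c] c
    by (simp add: zpm_poch_def eq_fract zpm_interval_nonzero)
qed

definition denom :: "(nat \<Rightarrow> complex) \<Rightarrow> nat \<Rightarrow> complex poly" where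
  "denom b n = (\<Prod>j\<in>{1..6}. zpm_interval (b j) (- int n) 0)"

definition poles_upto :: "(nat \<Rightarrow> complex) \<Rightarrow> nat \<Rightarrow> complex set" where
  "poles_upto b n = (\<lambda>(j, i). pole_at (b j * q powi i)) ` ({1..6} \<times> {- int n..<0})"

lemma V_gen_Fract:
  assumes "\<And>j. j \<in> {1..6} \<Longrightarrow> b j \<noteq> 0" "\<And>j. j \<in> {1..6} \<Longrightarrow> - int n \<le> k j"
  shows "V_gen q b k = Fract (\<Prod>j\<in>{1..6}. zpm_interval (b j) (- int n) (k j)) (denom b n)"
proof -
  have prod_Fract: "(\<Prod>j\<in>S. Fract (N j) (D j)) = Fract (\<Prod>j\<in>S. N j) (\<Prod>j\<in>S. D j)"
    if "finite S" for S and N D :: "nat \<Rightarrow> complex poly"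
    using that by (induction S rule: finite_induct) (simp_all add: One_fract_def)
  have "V_gen q b k = (\<Prod>j\<in>{1..6}. Fract (zpm_interval (b j) (- int n) (k j)) (zpm_interval (b j) (- int n) 0))"
    unfolding V_gen_def using assms by (intro prod.cong refl zpm_poch_interval) auto
  then show ?thesis unfolding denom_def by (simp only: prod_Fract finite_atLeastAtMost)
qed

context
  fixes b :: "nat \<Rightarrow> complex"
  assumes b: "generic_parameters b"
begin

lemma b_nonzero: "j \<in> {1..6} \<Longrightarrow> b j \<noteq> 0"
  using b by (auto simp: generic_parameters_def balanced_def)

lemma denom_nonzero: "denom b n \<noteq> 0"
  using b_nonzero by (simp add: denom_def zpm_interval_nonzero)

lemma degree_denom: "degree (denom b n) = 6 * n"
proof -
  have "degree (denom b n) = (\<Sum>j\<in>{1..6::nat}. n)"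
    unfolding denom_def
    by (subst degree_prod_eq_sum_degree)
       (auto simp: b_nonzero zpm_interval_nonzero degree_zpm_interval)
  then show ?thesis by simp
qed

text \<open>The genericity of the parameters makes all possible poles distinct, so the denominators are squarefree.\<close>

lemma poles_inj: "inj_on (\<lambda>(j, i). pole_at (b j * q powi i)) ({1..6} \<times> UNIV)"
proof (rule inj_onI, clarsimp simp del: One_nat_def)
  fix j i j' i'
  assume j: "1 \<le> j" "j \<le> 6" "1 \<le> j'" "j' \<le> 6" and eq: "pole_at (b j * q powi i) = pole_at (b j' * q powi i')"
  have b0: "b j \<noteq> 0" "b j' \<noteq> 0" using j b_nonzero by auto
  have "b j * q powi i * (b j' * q powi i') \<noteq> 1"
  proof
    assume "b j * q powi i * (b j' * q powi i') = 1"
    then have "b j * b j' * q powi (i + i') \<in> q_powers q" by (simp add: power_int_add mult_ac)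
    then show False using b j unfolding q_powers_mult_iff by (auto simp: generic_parameters_def)
  qed
  then have e: "b j * q powi i = b j' * q powi i'"
    using eq b0 by (simp add: pole_at_eq_iff)
  then have "b j / b j' = q powi (i' - i)" using b0 by (simp add: power_int_diff field_simps)
  then have "b j / b j' \<in> q_powers q" by (rule q_powersI)
  moreover have "j \<in> {1..6}" "j' \<in> {1..6}" using j by simp_all
  ultimately have jj: "j = j'" using b unfolding generic_parameters_def by blast
  then have "q powi (i' - i) = 1" using \<open>b j / b j' = q powi (i' - i)\<close> b0 by simp
  then show "j = j' \<and> i = i'" using jj by (simp add: q_powi_eq_1_iff)
qed

lemma denom_factor: obtains K where "K \<noteq> 0" "denom b n = smult K (\<Prod>x\<in>poles_upto b n. [:- x, 1:])"
proof -
  have "denom b n = (\<Prod>(j, i)\<in>{1..6} \<times> {- int n..<0}. smult (- 2 * (b j * q powi i)) [:- pole_at (b j * q powi i), 1:])"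
    unfolding denom_def zpm_interval_def
    by (subst prod.cartesian_product, rule prod.cong) (auto simp: zpm_factor_linear b_nonzero)
  also have "\<dots> = smult (\<Prod>(j, i)\<in>{1..6} \<times> {- int n..<0}. - 2 * (b j * q powi i))
      (\<Prod>(j, i)\<in>{1..6} \<times> {- int n..<0}. [:- pole_at (b j * q powi i), 1:])"
    unfolding case_prod_unfold by (rule prod_smult)
  also have "(\<Prod>(j, i)\<in>{1..6} \<times> {- int n..<0}. [:- pole_at (b j * q powi i), 1:]) = (\<Prod>x\<in>poles_upto b n. [:- x, 1:])"
    unfolding poles_upto_def
    by (subst prod.reindex[OF inj_on_subset[OF poles_inj]]) (auto simp: case_prod_unfold o_def)
  finally show ?thesis
    using that[of "\<Prod>(j, i)\<in>{1..6} \<times> {- int n..<0}. - 2 * (b j * q powi i)"] b_nonzero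
    by (auto simp: case_prod_unfold)
qed

lemma finite_poles_upto: "finite (poles_upto b n)"
  by (simp add: poles_upto_def)

lemma poly_denom_eq_0_iff: "poly (denom b n) x = 0 \<longleftrightarrow> x \<in> poles_upto b n"
proof -
  obtain K where "K \<noteq> 0" "denom b n = smult K (\<Prod>x\<in>poles_upto b n. [:- x, 1:])" using denom_factor by blast
  then show ?thesis by (auto simp: poly_prod prod_zero_iff finite_poles_upto)
qed

lemma order_denom:
  assumes x: "x \<in> poles_upto b n"
  shows "order x (denom b n) = 1"
proof -
  obtain K where K: "K \<noteq> 0" "denom b n = smult K (\<Prod>x\<in>poles_upto b n. [:- x, 1:])" using denom_factor by blast
  define R where "R = (\<Prod>y\<in>poles_upto b n - {x}. [:- y, 1:])"
  have "denom b n = smult K ([:- x, 1:] * R)"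
    unfolding K(2) R_def by (subst prod.remove[OF finite_poles_upto x]) simp
  moreover have "poly R x \<noteq> 0" unfolding R_def by (auto simp: poly_prod prod_zero_iff finite_poles_upto)
  moreover have "order x [:- x, 1:] = 1" using order_power_n_n[of x 1] by simp
  moreover have "R \<noteq> 0" using \<open>poly R x \<noteq> 0\<close> by auto
  ultimately show ?thesis using K(1) by (simp add: order_smult order_mult order_0I del: mult_pCons_left)
qed

lemma allowed_poles_eq: "allowed_poles q b = (\<Union>n. poles_upto b n)"
proof (intro subset_antisym subsetI)
  fix x assume "x \<in> allowed_poles q b"
  then obtain z j k where z: "x = (z + 1 / z) / 2" "z \<noteq> 0" "j \<in> {1..6}" "k < 0"
      "z = b j * q powi k \<or> 1 / z = b j * q powi k"
    unfolding allowed_poles_def by blast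
  have "x = pole_at (b j * q powi k)"
    using z(5)
  proof
    assume "1 / z = b j * q powi k"
    then show ?thesis using z(1,2) unfolding pole_at_def by (metis add.commute divide_divide_eq_right div_by_1 mult_1 nonzero_divide_mult_cancel_right divide_self)
  qed (simp add: z(1) pole_at_def)
  then have "x \<in> poles_upto b (nat (- k))"
    unfolding poles_upto_def using z by (auto intro!: image_eqI[of _ _ "(j, k)"])
  then show "x \<in> (\<Union>n. poles_upto b n)" by blast
next
  fix x assume "x \<in> (\<Union>n. poles_upto b n)"
  then obtain j k where jk: "x = pole_at (b j * q powi k)" "j \<in> {1..6}" "k < 0"
    by (auto simp: poles_upto_def)
  moreover have "b j * q powi k \<noteq> 0" using b_nonzero jk by simp
  ultimately show "x \<in> allowed_poles q b"
    unfolding allowed_poles_def pole_at_def by blast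
qed

lemma poles_upto_mono: "m \<le> n \<Longrightarrow> poles_upto b m \<subseteq> poles_upto b n"
  unfolding poles_upto_def by (intro image_mono) auto

lemma V_spaceI:
  assumes "degree N \<le> 6 * n"
  shows "Fract N (denom b n) \<in> V_space q b"
proof -
  obtain e where e: "N = fst (quot_of_fract (Fract N (denom b n))) * e"
      "denom b n = snd (quot_of_fract (Fract N (denom b n))) * e" "e \<noteq> 0"
    using quot_of_Fract[OF denom_nonzero] by blast
  define N' D' where "N' = fst (quot_of_fract (Fract N (denom b n)))" and "D' = snd (quot_of_fract (Fract N (denom b n)))"
  have D': "D' \<noteq> 0" by (simp add: D'_def)
  note e' = e(1,2)[folded N'_def D'_def]
  have "degree N' \<le> degree D'"
  proof (cases "N' = 0")
    case False
    have "degree N = degree N' + degree e" "6 * n = degree D' + degree e"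
      using False D' e(3) e' degree_denom[of n] by (metis degree_mult_eq)+
    then show ?thesis using assms by simp
  qed simp
  moreover have "x \<in> allowed_poles q b \<and> order x D' = 1" if "poly D' x = 0" for x
  proof
    have "poly (denom b n) x = 0" unfolding e'(2) using that by simp
    then have x: "x \<in> poles_upto b n" by (simp add: poly_denom_eq_0_iff)
    then show "x \<in> allowed_poles q b" by (auto simp: allowed_poles_eq)
    have "order x D' + order x e = 1"
      using order_denom[OF x] order_mult[of D' e x] D' e(3) e'(2) by simp
    moreover have "order x D' \<noteq> 0" using that D' by (simp add: order_root)
    ultimately show "order x D' = 1" by simp
  qed
  ultimately show ?thesis by (simp add: V_space_def N'_def D'_def)
qed

text \<open>The reduced denominator is squarefree with roots among the allowed poles, hence divides one of the
  denominators \<open>denom b n\<close>.\<close>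

lemma V_spaceE:
  assumes f: "f \<in> V_space q b"
  obtains n N where "degree N \<le> 6 * n" "f = Fract N (denom b n)"
proof -
  define N' D' where "N' = fst (quot_of_fract f)" and "D' = snd (quot_of_fract f)"
  have D': "D' \<noteq> 0" by (simp add: D'_def)
  have f_eq: "f = Fract N' D'" by (simp add: N'_def D'_def)
  have deg: "degree N' \<le> degree D'" and roots: "\<And>x. poly D' x = 0 \<Longrightarrow> x \<in> allowed_poles q b \<and> order x D' = 1"
    using f by (auto simp: V_space_def N'_def D'_def)
  define S where "S = {x. poly D' x = 0}"
  have finS: "finite S" unfolding S_def using D' by (rule poly_roots_finite)
  have "\<forall>x\<in>S. \<exists>n. x \<in> poles_upto b n" using roots by (auto simp: S_def allowed_poles_eq)
  then obtain M where M: "\<And>x. x \<in> S \<Longrightarrow> x \<in> poles_upto b (M x)" by metis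
  define n where "n = (\<Sum>x\<in>S. M x)"
  have n: "S \<subseteq> poles_upto b n"
  proof
    fix x assume x: "x \<in> S"
    then have "M x \<le> n" unfolding n_def using finS by (intro member_le_sum) auto
    then show "x \<in> poles_upto b n" using M[OF x] poles_upto_mono by blast
  qed
  have "rsquarefree D'"
    unfolding rsquarefree_def using D' roots by (metis order_root)
  then have D'_eq: "D' = smult (lead_coeff D') (\<Prod>x\<in>S. [:- x, 1:])"
    unfolding S_def by (rule complex_poly_decompose_rsquarefree[symmetric])
  obtain K where K: "K \<noteq> 0" "denom b n = smult K (\<Prod>x\<in>poles_upto b n. [:- x, 1:])" using denom_factor by blast
  define E where "E = smult (K / lead_coeff D') (\<Prod>x\<in>poles_upto b n - S. [:- x, 1:])"
  have DE: "denom b n = D' * E"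
  proof -
    have "(\<Prod>x\<in>poles_upto b n. [:- x, 1:]) = (\<Prod>x\<in>poles_upto b n - S. [:- x, 1:]) * (\<Prod>x\<in>S. [:- x, 1:])"
      by (rule prod.subset_diff[OF n finite_poles_upto])
    then have "denom b n = smult (lead_coeff D' * (K / lead_coeff D')) ((\<Prod>x\<in>S. [:- x, 1:]) * (\<Prod>x\<in>poles_upto b n - S. [:- x, 1:]))"
      unfolding K(2) using D' by (simp add: mult.commute)
    also have "\<dots> = smult (lead_coeff D') (\<Prod>x\<in>S. [:- x, 1:]) * E"
      unfolding E_def by (simp add: mult.commute)
    finally show ?thesis unfolding D'_eq[symmetric] .
  qed
  have E0: "E \<noteq> 0" using DE denom_nonzero[of n] by auto
  have "f = Fract (N' * E) (denom b n)"
    unfolding f_eq DE using D' E0 by (simp add: eq_fract mult_ac)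
  moreover have "degree (N' * E) \<le> 6 * n"
    using degree_mult_le[of N' E] deg degree_mult_eq[OF D' E0] degree_denom[of n] DE by simp
  ultimately show ?thesis using that by blast
qed

end

section \<open>Spanning by generators and the value of the functional\<close>

text \<open>A polynomial of degree at most \<open>M + 1\<close> becomes divisible by the first factor belonging to \<open>c\<close>
  after a multiple of the basis element without factors belonging to \<open>c\<close> is subtracted.\<close>

lemma poly_zpm_induct:
  assumes c: "c \<noteq> 0" "d \<noteq> 0" "c * d \<notin> q_powers q" "c / d \<notin> q_powers q"
    and add: "\<And>p p'. Q p \<Longrightarrow> Q p' \<Longrightarrow> Q (p + p')" and smult: "\<And>a p. Q p \<Longrightarrow> Q (smult a p)"
    and basis: "\<And>m. m \<le> M \<Longrightarrow> Q (zpm_interval c lo (lo + int m) * zpm_interval d lo' (lo' + int (M - m)))"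
    and N: "degree N \<le> M"
  shows "Q N"
  using add smult basis N
proof (induction M arbitrary: lo Q N)
  case 0
  then obtain a where "N = [:a:]" by (metis degree_eq_zeroE le_zero_eq)
  moreover have "Q 1" using "0.prems"(3)[of 0] by (simp add: zpm_interval_def)
  ultimately show ?case using "0.prems"(2)[of 1 a] by simp
next
  case (Suc M)
  define a where "a = c * q powi lo"
  have a0: "a \<noteq> 0" using c by (simp add: a_def)
  define P where "P = zpm_interval d lo' (lo' + int (Suc M))"
  have "poly P (pole_at a) \<noteq> 0"
  proof -
    have "poly (zpm_factor (d * q powi i)) (pole_at a) \<noteq> 0" for i
    proof -
      have ne: "x \<noteq> y" if "x / y \<notin> q_powers q" "y \<noteq> 0" for x y using that by auto
      have "a / (d * q powi i) = c / d * q powi (lo - i)" "a * (d * q powi i) = c * d * q powi (lo + i)"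
        by (simp_all add: a_def power_int_diff power_int_add)
      then have "a / (d * q powi i) \<notin> q_powers q" "a * (d * q powi i) \<notin> q_powers q"
        using c by (simp_all only: q_powers_mult_iff not_False_eq_True)
      then have "a \<noteq> d * q powi i" "a * (d * q powi i) \<noteq> 1"
        using c q_power_in_q_powers(3) by (auto simp: ne)
      then show ?thesis using a0 c by (simp add: poly_zpm_factor_eq_0_iff pole_at_eq_iff)
    qed
    then show ?thesis by (simp add: P_def zpm_interval_def poly_prod prod_zero_iff)
  qed
  define e where "e = poly N (pole_at a) / poly P (pole_at a)"
  have "poly (N - smult e P) (pole_at a) = 0"
    using \<open>poly P (pole_at a) \<noteq> 0\<close> by (simp add: e_def)
  then obtain R where R: "N - smult e P = [:- pole_at a, 1:] * R"
    unfolding poly_eq_0_iff_dvd by (elim dvdE)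
  define N' where "N' = smult (1 / (- 2 * a)) R"
  have N': "N - smult e P = zpm_factor a * N'"
  proof -
    have "1 / (- 2 * a) * (- 2 * a) = 1" using a0 by simp
    then show ?thesis
      unfolding R N'_def zpm_factor_linear[OF a0]
      by (simp only: mult_smult_left mult_smult_right smult_smult smult_1_left)
  qed
  have degP: "degree P = Suc M"
    unfolding P_def using degree_zpm_interval[OF c(2)] by simp
  have "degree (N - smult e P) \<le> Suc M"
    using Suc.prems(4) degP degree_smult_le[of e P] by (intro degree_diff_le) auto
  then have degN': "degree N' \<le> M"
    unfolding N' using a0 degree_mult_eq[of "zpm_factor a" N'] 
    by (cases "N' = 0") (simp_all add: zpm_factor_nonzero degree_zpm_factor)
  have shift: "zpm_factor a * zpm_interval c (lo + 1) (lo + 1 + int m) = zpm_interval c lo (lo + int (Suc m))" for m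
  proof -
    have "zpm_interval c lo (lo + 1) = zpm_factor a"
    proof -
      have "{lo..<lo + 1} = {lo}" by auto
      then show ?thesis by (simp add: zpm_interval_def a_def)
    qed
    then show ?thesis using zpm_interval_concat[of lo "lo + 1" "lo + int (Suc m)" c] by (simp add: add_ac)
  qed
  have "Q (zpm_factor a * N')"
  proof (rule Suc.IH[of "\<lambda>p. Q (zpm_factor a * p)" "lo + 1", OF _ _ _ degN'])
    show "Q (zpm_factor a * (p + p'))" if "Q (zpm_factor a * p)" "Q (zpm_factor a * p')" for p p'
      using Suc.prems(1)[OF that] by (simp add: distrib_left)
    show "Q (zpm_factor a * smult u p)" if "Q (zpm_factor a * p)" for u p
      using Suc.prems(2)[OF that] by simp
    show "Q (zpm_factor a * (zpm_interval c (lo + 1) (lo + 1 + int m) * zpm_interval d lo' (lo' + int (M - m))))"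
      if "m \<le> M" for m
      using Suc.prems(3)[of "Suc m"] that by (simp only: mult.assoc[symmetric] shift) simp
  qed
  moreover have "Q P" using Suc.prems(3)[of 0] by (simp add: P_def zpm_interval_def)
  ultimately have "Q (smult e P + (N - smult e P))" unfolding N' by (intro Suc.prems(1,2))
  then show ?case by simp
qed

text \<open>No element of the space has a pole at \<open>(z + 1 / z) / 2\<close>.\<close>

definition regular_point :: "(nat \<Rightarrow> complex) \<Rightarrow> complex \<Rightarrow> bool" where
  "regular_point b z \<longleftrightarrow> z \<noteq> 0 \<and> (\<forall>j\<in>{1..6}. z * b j \<notin> q_powers q \<and> z / b j \<notin> q_powers q)"

definition two_series :: "(nat \<Rightarrow> complex) \<Rightarrow> complex \<Rightarrow> complex \<Rightarrow> complex poly fract \<Rightarrow> complex" where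
  "two_series b l m f = prefactor q b l m * (\<Sum>\<^sub>\<infinity>x\<in>UNIV. series_term q b f l x) +
     prefactor q b m l * (\<Sum>\<^sub>\<infinity>x\<in>UNIV. series_term q b f m x)"

context
  fixes b :: "nat \<Rightarrow> complex"
  assumes b: "generic_parameters b"
begin

lemma exponents_lower_bound:
  fixes k :: "nat \<Rightarrow> int"
  obtains n where "\<And>j. j \<in> {1..6} \<Longrightarrow> - int n \<le> k j"
proof
  fix j :: nat assume "j \<in> {1..6}"
  then have "nat \<bar>k j\<bar> \<le> (\<Sum>j\<in>{1..6}. nat \<bar>k j\<bar>)" by (intro member_le_sum) auto
  then show "- int (\<Sum>j\<in>{1..6}. nat \<bar>k j\<bar>) \<le> k j" by linarith
qed

lemma V_space_eventually:
  assumes "f \<in> V_space q b"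
  shows "\<exists>n0. \<forall>n\<ge>n0. \<exists>N. degree N \<le> 6 * n \<and> f = Fract N (denom b n)"
proof -
  obtain n0 N where N: "degree N \<le> 6 * n0" "f = Fract N (denom b n0)" using V_spaceE[OF b assms] by blast
  have "\<exists>N'. degree N' \<le> 6 * n \<and> f = Fract N' (denom b n)" if "n \<ge> n0" for n
  proof -
    define X where "X = (\<Prod>j\<in>{1..6}. zpm_interval (b j) (- int n) (- int n0))"
    have D: "denom b n = X * denom b n0"
      unfolding denom_def X_def prod.distrib[symmetric] using that
      by (intro prod.cong refl zpm_interval_concat) auto
    have X0: "X \<noteq> 0" using denom_nonzero[OF b, of n] D by auto
    have "degree X + 6 * n0 = 6 * n"
      using degree_mult_eq[OF X0 denom_nonzero[OF b, of n0]] degree_denom[OF b] D by metis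
    then have "degree (X * N) \<le> 6 * n" using N(1) degree_mult_le[of X N] by simp
    moreover have "f = Fract (X * N) (denom b n)"
      unfolding D N(2) using X0 denom_nonzero[OF b] by (simp add: eq_fract)
    ultimately show ?thesis by blast
  qed
  then show ?thesis by blast
qed

lemma V_space_add:
  assumes "f \<in> V_space q b" "g \<in> V_space q b"
  shows "f + g \<in> V_space q b"
proof -
  obtain n0 m0 where n0: "\<And>n. n \<ge> n0 \<Longrightarrow> \<exists>N. degree N \<le> 6 * n \<and> f = Fract N (denom b n)"
    and m0: "\<And>n. n \<ge> m0 \<Longrightarrow> \<exists>N. degree N \<le> 6 * n \<and> g = Fract N (denom b n)"
    using V_space_eventually assms by metis
  define n where "n = max n0 m0"
  obtain N M where "degree N \<le> 6 * n" "f = Fract N (denom b n)" "degree M \<le> 6 * n" "g = Fract M (denom b n)"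
    using n0[of n] m0[of n] by (auto simp: n_def)
  then show ?thesis
    using V_spaceI[OF b, of "N + M" n] degree_add_le[of N "6 * n" M]
    by (simp only: Fract_add_same[OF denom_nonzero[OF b]])
qed

lemma V_space_smult:
  assumes "f \<in> V_space q b"
  shows "to_fract [:c:] * f \<in> V_space q b"
proof -
  obtain n N where "degree N \<le> 6 * n" "f = Fract N (denom b n)" using V_spaceE[OF b assms] by blast
  then show ?thesis
    using V_spaceI[OF b, of "smult c N" n] degree_smult_le[of c N] by (simp add: to_fract_const_mult)
qed

lemma V_gen_in_V_space:
  assumes "(\<Sum>j\<in>{1..6}. k j) = 0"
  shows "V_gen q b k \<in> V_space q b"
proof -
  obtain n where kn: "\<And>j. j \<in> {1..6} \<Longrightarrow> - int n \<le> k j" using exponents_lower_bound by blast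
  have 1: "int (\<Sum>j\<in>{1..6}. nat (k j + int n)) = (\<Sum>j\<in>{1..6}. k j + int n)"
    unfolding of_nat_sum
  proof (rule sum.cong[OF refl])
    fix j :: nat assume "j \<in> {1..6}"
    from kn[OF this] show "int (nat (k j + int n)) = k j + int n" by simp
  qed
  have 2: "(\<Sum>j\<in>{1..6}. k j + int n) = int (6 * n)" using assms by (simp add: sum.distrib)
  have "(\<Sum>j\<in>{1..6}. nat (k j + int n)) = 6 * n" using 1 unfolding 2 by (simp only: of_nat_eq_iff)
  moreover have "degree (\<Prod>j\<in>{1..6}. zpm_interval (b j) (- int n) (k j)) = (\<Sum>j\<in>{1..6}. nat (k j + int n))"
    using b_nonzero[OF b] by (subst degree_prod_eq_sum_degree) (auto simp: zpm_interval_nonzero degree_zpm_interval)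
  ultimately have "Fract (\<Prod>j\<in>{1..6}. zpm_interval (b j) (- int n) (k j)) (denom b n) \<in> V_space q b"
    by (intro V_spaceI[OF b]) simp
  then show ?thesis by (simp only: V_gen_Fract[OF b_nonzero[OF b] kn])
qed

lemma V_space_induct [consumes 1, case_names gen add smult]:
  assumes f: "f \<in> V_space q b"
    and gen: "\<And>k. (\<Sum>j\<in>{1..6}. k j) = 0 \<Longrightarrow> Q (V_gen q b k)"
    and add: "\<And>f g. f \<in> V_space q b \<Longrightarrow> g \<in> V_space q b \<Longrightarrow> Q f \<Longrightarrow> Q g \<Longrightarrow> Q (f + g)"
    and smult: "\<And>c f. f \<in> V_space q b \<Longrightarrow> Q f \<Longrightarrow> Q (to_fract [:c:] * f)"
  shows "Q f"
proof -
  obtain n N where N: "degree N \<le> 6 * n" "f = Fract N (denom b n)" using V_spaceE[OF b f] by blast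
  define Q' where "Q' = (\<lambda>p. degree p \<le> 6 * n \<and> Q (Fract p (denom b n)))"
  have b12: "b 1 \<noteq> 0" "b 2 \<noteq> 0" using b_nonzero[OF b] by auto
  have gp: "b 1 * b 2 \<notin> q_powers q" "b 1 / b 2 \<notin> q_powers q"
    using b unfolding generic_parameters_def by force+
  have "Q' N"
  proof (rule poly_zpm_induct[OF b12 gp, of Q' "6 * n" "- int n" "- int n"])
    show "Q' (p + p')" if "Q' p" "Q' p'" for p p'
      using that add[OF V_spaceI[OF b] V_spaceI[OF b], of p n p' n] unfolding Q'_def
      by (auto simp: Fract_add_same[OF denom_nonzero[OF b]] intro: degree_add_le)
    show "Q' (smult c p)" if "Q' p" for c p
      using that smult[OF V_spaceI[OF b], of p n c] degree_smult_le[of c p] unfolding Q'_def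
      by (auto simp: to_fract_const_mult)
    show "degree N \<le> 6 * n" by (rule N)
    fix m assume m: "m \<le> 6 * n"
    \<comment> \<open>The exponents of the generator whose numerator over \<open>denom b n\<close> is the basis polynomial with index \<open>m\<close>.\<close>
    define k where "k = (\<lambda>j::nat. if j = 1 then int m - int n else if j = 2 then 5 * int n - int m else - int n)"
    define p where "p = zpm_interval (b 1) (- int n) (- int n + int m) * zpm_interval (b 2) (- int n) (- int n + int (6 * n - m))"
    have "degree p = m + (6 * n - m)"
      unfolding p_def using b12 by (subst degree_mult_eq) (simp_all add: zpm_interval_nonzero degree_zpm_interval)
    then have "degree p \<le> 6 * n" using m by simp
    moreover have "(\<Sum>j\<in>{1..6}. k j) = 0" unfolding sum_6 by (simp add: k_def)
    moreover have "V_gen q b k = Fract p (denom b n)"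
    proof -
      have "V_gen q b k = Fract (\<Prod>j\<in>{1..6}. zpm_interval (b j) (- int n) (k j)) (denom b n)"
        by (rule V_gen_Fract[OF b_nonzero[OF b]]) (use m in \<open>auto simp: k_def\<close>)
      also have "(\<Prod>j\<in>{1..6}. zpm_interval (b j) (- int n) (k j)) = p"
      proof -
        have "{1..6} = {1, 2, 3, 4, 5, 6::nat}" by auto
        then show ?thesis using m by (simp add: k_def p_def zpm_interval_def of_nat_diff algebra_simps)
      qed
      finally show ?thesis .
    qed
    ultimately show "Q' (zpm_interval (b 1) (- int n) (- int n + int m) * zpm_interval (b 2) (- int n) (- int n + int (6 * n - m)))"
      using gen[of k] by (simp add: Q'_def p_def)
  qed
  then show ?thesis by (simp add: Q'_def N(2))
qed

lemma rahman_functional_unique: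
  assumes "rahman_functional q b J" "rahman_functional q b J'" "f \<in> V_space q b"
  shows "J f = J' f"
  using assms(3)
proof (induction rule: V_space_induct)
  case (gen k) then show ?case using assms by (simp add: rahman_functional_def)
next
  case (add f g) then show ?case using assms by (simp add: rahman_functional_def)
next
  case (smult c f) then show ?case using assms by (simp add: rahman_functional_def)
qed

lemma regular_point_shift: "regular_point b (z * q powi x) \<longleftrightarrow> regular_point b z"
proof -
  have "z * q powi x * b j = z * b j * q powi x" "z * q powi x / b j = z / b j * q powi x" for j
    by simp_all
  then show ?thesis unfolding regular_point_def by (simp only: q_powers_mult_iff) simp
qed

lemma regular_factor_nonzero:
  assumes "regular_point b z" "j \<in> {1..6}"
  shows "poly (zpm_factor (b j * q powi i)) (pole_at z) \<noteq> 0"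
proof -
  have z: "z \<noteq> 0" "z * b j \<notin> q_powers q" "z / b j \<notin> q_powers q" using assms by (auto simp: regular_point_def)
  have bj: "b j \<noteq> 0" using b_nonzero[OF b assms(2)] .
  have "z \<noteq> b j * q powi i"
  proof
    assume "z = b j * q powi i"
    then have "z / b j = q powi i" using bj by simp
    then show False using z(3) by (simp add: q_powersI)
  qed
  moreover have "z * (b j * q powi i) \<noteq> 1"
  proof
    assume "z * (b j * q powi i) = 1"
    then have "z * b j * q powi i \<in> q_powers q" by (simp add: mult.assoc)
    then show False using z(2) by (simp only: q_powers_mult_iff)
  qed
  ultimately show ?thesis using z bj by (simp add: poly_zpm_factor_eq_0_iff pole_at_eq_iff)
qed

lemma poly_zpm_interval_nonzero:
  "regular_point b z \<Longrightarrow> j \<in> {1..6} \<Longrightarrow> poly (zpm_interval (b j) lo hi) (pole_at z) \<noteq> 0"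
  using regular_factor_nonzero by (simp add: zpm_interval_def poly_prod prod_zero_iff)

lemma poly_denom_nonzero: "regular_point b z \<Longrightarrow> poly (denom b n) (pole_at z) \<noteq> 0"
  using poly_zpm_interval_nonzero by (simp add: denom_def poly_prod prod_zero_iff)

lemma eval_rat_add:
  assumes "f \<in> V_space q b" "g \<in> V_space q b" "regular_point b z"
  shows "eval_rat (f + g) (pole_at z) = eval_rat f (pole_at z) + eval_rat g (pole_at z)"
proof -
  obtain n N where f: "f = Fract N (denom b n)" using V_spaceE[OF b assms(1)] by blast
  obtain m M where g: "g = Fract M (denom b m)" using V_spaceE[OF b assms(2)] by blast
  have nz: "poly (denom b n) (pole_at z) \<noteq> 0" "poly (denom b m) (pole_at z) \<noteq> 0"
    using poly_denom_nonzero[OF assms(3)] by auto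
  show ?thesis unfolding f g add_fract[OF denom_nonzero[OF b] denom_nonzero[OF b]]
    using nz by (simp add: eval_rat_Fract add_frac_eq)
qed

lemma eval_rat_smult:
  assumes "f \<in> V_space q b" "regular_point b z"
  shows "eval_rat (to_fract [:c:] * f) (pole_at z) = c * eval_rat f (pole_at z)"
proof -
  obtain n N where f: "f = Fract N (denom b n)" using V_spaceE[OF b assms(1)] by blast
  show ?thesis unfolding f to_fract_const_mult
    using poly_denom_nonzero[OF assms(2)] by (simp add: eval_rat_Fract)
qed

lemma eval_rat_V_gen:
  assumes z: "regular_point b z"
  shows "eval_rat (V_gen q b k) (pole_at z) = (\<Prod>j\<in>{1..6}. qpoch q (b j * z) (k j) * qpoch q (b j / z) (k j))"
proof -
  obtain n where kn: "\<And>j. j \<in> {1..6} \<Longrightarrow> - int n \<le> k j" using exponents_lower_bound by blast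
  have "eval_rat (V_gen q b k) (pole_at z) =
      (\<Prod>j\<in>{1..6}. poly (zpm_interval (b j) (- int n) (k j)) (pole_at z) / poly (zpm_interval (b j) (- int n) 0) (pole_at z))"
    using V_gen_Fract[OF b_nonzero[OF b] kn] eval_rat_Fract[OF poly_denom_nonzero[OF z, of n]]
    by (simp add: denom_def poly_prod prod_dividef)
  also have "\<dots> = (\<Prod>j\<in>{1..6}. qpoch q (b j * z) (k j) * qpoch q (b j / z) (k j))"
  proof (rule prod.cong[OF refl])
    fix j :: nat assume j: "j \<in> {1..6}"
    have z0: "z \<noteq> 0" using z by (simp add: regular_point_def)
    have "eval_rat (zpm_poch q (b j) (k j)) (pole_at z) = qpoch q (b j * z) (k j) * qpoch q (b j / z) (k j)"
      unfolding pole_at_def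
    proof (rule eval_zpm_poch[OF z0])
      fix i :: int
      have zz: "z * b j \<notin> q_powers q" "z / b j \<notin> q_powers q" using z j by (auto simp: regular_point_def)
      have nq: "z * b j * q powi i \<notin> q_powers q" "z / b j * q powi (- i) \<notin> q_powers q"
        using zz by (simp_all only: q_powers_mult_iff not_False_eq_True)
      have "z * b j * q powi i \<noteq> 1" using nq(1) q_power_in_q_powers(3) by metis
      moreover have "b j * q powi i * z = z * b j * q powi i" by (simp only: mult_ac)
      moreover have "b j * q powi i / z \<noteq> 1"
      proof
        assume "b j * q powi i / z = 1"
        then have "z = b j * q powi i" using z0 by simp
        then have "z / b j * q powi (- i) = 1"
          using b_nonzero[OF b j] by (simp add: power_int_minus)
        then show False using nq(2) q_power_in_q_powers(3) by metis
      qed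
      ultimately show "b j * q powi i * z \<noteq> 1 \<and> b j * q powi i / z \<noteq> 1" by metis
    qed
    moreover have "eval_rat (zpm_poch q (b j) (k j)) (pole_at z) =
      poly (zpm_interval (b j) (- int n) (k j)) (pole_at z) / poly (zpm_interval (b j) (- int n) 0) (pole_at z)"
      using zpm_poch_interval[OF b_nonzero[OF b j] kn[OF j]] poly_zpm_interval_nonzero[OF z j]
      by (simp add: eval_rat_Fract)
    ultimately show "poly (zpm_interval (b j) (- int n) (k j)) (pole_at z) / poly (zpm_interval (b j) (- int n) 0) (pole_at z) =
      qpoch q (b j * z) (k j) * qpoch q (b j / z) (k j)" by simp
  qed
  finally show ?thesis .
qed

lemma series_point: "(l * q powi x + inverse l * q powi (- x)) / 2 = pole_at (l * q powi x)"
  unfolding pole_at_def power_int_minus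
  by (simp only: inverse_mult_distrib inverse_eq_divide[symmetric])

lemma series_term_add:
  assumes "f \<in> V_space q b" "g \<in> V_space q b" "regular_point b l"
  shows "series_term q b (f + g) l = (\<lambda>x. series_term q b f l x + series_term q b g l x)"
  using assms unfolding series_term_def series_point
  by (simp add: eval_rat_add regular_point_shift distrib_left)

lemma series_term_smult:
  assumes "f \<in> V_space q b" "regular_point b l"
  shows "series_term q b (to_fract [:c:] * f) l = (\<lambda>x. c * series_term q b f l x)"
  using assms unfolding series_term_def series_point
  by (simp add: eval_rat_smult regular_point_shift mult.left_commute)

lemma weight_G_nonzero:
  assumes "regular_point b l"
  shows "weight_G b l \<noteq> 0"
proof -
  have "phi (q * l / b j) \<noteq> 0" "phi (q * inverse l / b j) \<noteq> 0" if j: "j \<in> {1..6}" for j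
  proof -
    have g: "l * b j \<notin> q_powers q" "l / b j \<notin> q_powers q" using assms j by (auto simp: regular_point_def)
    have "l / b j * q powi 1 \<notin> q_powers q" "1 / (l * b j) * q powi 1 \<notin> q_powers q"
      using g by (simp_all only: q_powers_mult_iff q_powers_inverse_iff not_False_eq_True)
    then show "phi (q * l / b j) \<noteq> 0" "phi (q * inverse l / b j) \<noteq> 0"
      using phi_nonzero by (simp_all add: divide_inverse mult_ac)
  qed
  then show ?thesis by (simp add: weight_G_def)
qed

text \<open>A generator in the summand is absorbed into the weight by the shift of the parameters.\<close>

lemma series_term_V_gen:
  assumes l: "regular_point b l" "l\<^sup>2 \<noteq> 1"
  shows "(1 - l\<^sup>2) * weight_G b l * series_term q b (V_gen q b k) l x = (generator_scale b k)\<^sup>2 * bilateral_term (shifted b k) l x"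
proof -
  define z where "z = l * q powi x"
  have z: "regular_point b z" using l by (simp add: z_def regular_point_shift)
  have bal: "balanced b" using b by (simp add: generic_parameters_def)
  have l0: "l \<noteq> 0" "z \<noteq> 0" using l z by (auto simp: regular_point_def)
  have inv: "z * b j \<notin> q_powers q \<and> b j / z \<notin> q_powers q" if "j \<in> {1..6}" for j
    using z that q_powers_inverse_iff[of "z / b j"] by (simp add: regular_point_def)
  have "(1 - l\<^sup>2) * weight_G b l * series_term q b (V_gen q b k) l x =
    bilateral_term b l x * (\<Prod>j\<in>{1..6}. qpoch q (b j * z) (k j) * qpoch q (b j / z) (k j))"
    using weight_G_series_term[OF bal l0(1) l(2)] l(1) eval_rat_V_gen[OF z]
    by (simp add: series_point regular_point_def z_def)
  then show ?thesis
    using weight_G_shifted[OF b_nonzero[OF b] l0(2) inv, where k = k]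
    by (simp add: bilateral_term_def z_def mult_ac)
qed

lemma series_term_V_gen_sums:
  assumes l: "regular_point b l" "l\<^sup>2 \<noteq> 1" and k: "(\<Sum>j\<in>{1..6}. k j) = 0"
  shows "series_term q b (V_gen q b k) l summable_on UNIV"
    and "prefactor q b l m * (\<Sum>\<^sub>\<infinity>x\<in>UNIV. series_term q b (V_gen q b k) l x) =
      theta_weight b l m * (generator_scale b k)\<^sup>2 * bilateral_sum (shifted b k) l"
proof -
  define c where "c = (1 - l\<^sup>2) * weight_G b l"
  have c: "c \<noteq> 0" using weight_G_nonzero[OF l(1)] l(2) by (simp add: c_def)
  have l0: "l \<noteq> 0" using l by (simp add: regular_point_def)
  have "c * series_term q b (V_gen q b k) l x = (generator_scale b k)\<^sup>2 * bilateral_term (shifted b k) l x" for x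
    unfolding c_def by (rule series_term_V_gen[OF l])
  then have eq: "series_term q b (V_gen q b k) l = (\<lambda>x. ((generator_scale b k)\<^sup>2 / c) * bilateral_term (shifted b k) l x)"
    using c by (auto simp: field_simps)
  have "balanced (shifted b k)"
    using generic_parameters_shifted[OF b k] by (simp add: generic_parameters_def)
  then show "series_term q b (V_gen q b k) l summable_on UNIV"
    unfolding eq by (intro summable_on_cmult_right summable_bilateral_term l0)
  show "prefactor q b l m * (\<Sum>\<^sub>\<infinity>x\<in>UNIV. series_term q b (V_gen q b k) l x) =
      theta_weight b l m * (generator_scale b k)\<^sup>2 * bilateral_sum (shifted b k) l"
    unfolding eq infsum_cmult_right' bilateral_sum_def[symmetric] prefactor_eq c_def[symmetric]
    using c by simp
qed

lemma series_term_summable: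
  assumes f: "f \<in> V_space q b" and l: "regular_point b l" "l\<^sup>2 \<noteq> 1"
  shows "series_term q b f l summable_on UNIV"
  using f
proof (induction rule: V_space_induct)
  case (gen k) then show ?case by (rule series_term_V_gen_sums[OF l])
next
  case (add f g)
  show ?case unfolding series_term_add[OF add(1,2) l(1)] by (rule summable_on_add[OF add(3,4)])
next
  case (smult c f)
  show ?case unfolding series_term_smult[OF smult(1) l(1)] by (rule summable_on_cmult_right[OF smult(2)])
qed

text \<open>The powers of \<open>generator_scale\<close> contributed by the bracket, the weight and the pair product
  combine to the prescribed denominator.\<close>

lemma theta_weight_shifted:
  assumes m: "m \<noteq> 0" and k: "(\<Sum>j\<in>{1..6}. k j) = 0"
  shows "theta_weight b l m * (generator_scale b k)\<^sup>2 = theta_weight (shifted b k) l m *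
    ((\<Prod>i\<in>{1..6}. \<Prod>j\<in>{i<..6}. qpoch q (b i * b j) (k i + k j)) / generator_scale b k)"
proof -
  define g where "g = generator_scale b k"
  define R where "R = (\<Prod>i\<in>{1..6}. \<Prod>j\<in>{i<..6}. qpoch q (b i * b j) (k i + k j))"
  have g: "g \<noteq> 0" using b_nonzero[OF b] by (simp add: g_def generator_scale_def)
  have p: "pair_product b \<noteq> 0" "pair_product (shifted b k) \<noteq> 0"
    using pair_product_nonzero b generic_parameters_shifted[OF b k] by auto
  have 1: "theta_bracket b m = theta_bracket (shifted b k) m * g"
    unfolding g_def by (rule theta_bracket_shifted[OF b_nonzero[OF b] m k, symmetric])
  have 2: "pair_product (shifted b k) * g ^ 4 = pair_product b * R"
    unfolding g_def R_def using b by (intro pair_product_shifted b_nonzero[OF b] k) (auto simp: generic_parameters_def)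
  have 3: "g * g\<^sup>2 / pair_product b = R / g / pair_product (shifted b k)"
    using 2 g p by (simp add: field_simps eval_nat_numeral)
  have "theta_weight b l m * g\<^sup>2 = theta_bracket (shifted b k) m /
      (phi q * (theta (l\<^sup>2) * theta (m\<^sup>2) * theta (l * m) * theta (m / l))) * (g * g\<^sup>2 / pair_product b)"
    unfolding theta_weight_def 1 by (simp add: mult_ac)
  also have "\<dots> = theta_weight (shifted b k) l m * (R / g)"
    unfolding theta_weight_def 3 by (simp add: mult_ac)
  finally show ?thesis by (simp add: g_def R_def)
qed

lemma two_series_V_gen:
  assumes lm: "regular_point b l" "regular_point b m" "l\<^sup>2 \<notin> q_powers q" "m\<^sup>2 \<notin> q_powers q"
      "l * m \<notin> q_powers q" "m / l \<notin> q_powers q"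
    and k: "(\<Sum>j\<in>{1..6}. k j) = 0"
  shows "two_series b l m (V_gen q b k) =
    (\<Prod>i\<in>{1..6}. \<Prod>j\<in>{i<..6}. qpoch q (b i * b j) (k i + k j)) / generator_scale b k"
proof -
  have lm0: "l \<noteq> 0" "m \<noteq> 0" using lm by (auto simp: regular_point_def)
  have ne1: "l\<^sup>2 \<noteq> 1" "m\<^sup>2 \<noteq> 1" using lm(3,4) q_power_in_q_powers(3) by metis+
  have gen: "generic_pair (shifted b k j) l \<and> generic_pair (shifted b k j) m" if j: "j \<in> {1..6}" for j
  proof -
    have bb: "b j * b j \<notin> q_powers q" using b j unfolding generic_parameters_def by blast
    have "generic_pair (b j) l" "generic_pair (b j) m"
      using lm lm0 j bb b_nonzero[OF b j] by (auto simp: generic_pair_def regular_point_def power2_eq_square mult.commute)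
    then show ?thesis
      using generic_pair_q_shift[of "b j" "k j" _ 0] by (simp add: shifted_def)
  qed
  have "two_series b l m (V_gen q b k) =
      ((\<Prod>i\<in>{1..6}. \<Prod>j\<in>{i<..6}. qpoch q (b i * b j) (k i + k j)) / generator_scale b k) *
      (theta_weight (shifted b k) l m * bilateral_sum (shifted b k) l + theta_weight (shifted b k) m l * bilateral_sum (shifted b k) m)"
    unfolding two_series_def series_term_V_gen_sums(2)[OF lm(1) ne1(1) k] series_term_V_gen_sums(2)[OF lm(2) ne1(2) k]
      theta_weight_shifted[OF lm0(1) k] theta_weight_shifted[OF lm0(2) k]
    by (simp only: distrib_left distrib_right mult_ac)
  also have "theta_weight (shifted b k) l m * bilateral_sum (shifted b k) l + theta_weight (shifted b k) m l * bilateral_sum (shifted b k) m = 1"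
    by (rule theta_weight_sum[OF generic_parameters_shifted[OF b k] lm0 lm(3-6) gen])
  finally show ?thesis by simp
qed

text \<open>Cut off outside the space, the two series satisfy the defining conditions; uniqueness identifies them
  with the functional.\<close>

lemma rahman_J_eq_two_series:
  assumes lm: "regular_point b l" "regular_point b m" "l\<^sup>2 \<notin> q_powers q" "m\<^sup>2 \<notin> q_powers q"
      "l * m \<notin> q_powers q" "m / l \<notin> q_powers q"
    and f: "f \<in> V_space q b"
  shows "rahman_J q b f = two_series b l m f"
proof -
  have ne1: "l\<^sup>2 \<noteq> 1" "m\<^sup>2 \<noteq> 1" using lm(3,4) q_power_in_q_powers(3) by metis+
  define J where "J = (\<lambda>f. if f \<in> V_space q b then two_series b l m f else 0)"
  have add: "two_series b l m (f + g) = two_series b l m f + two_series b l m g"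
    if "f \<in> V_space q b" "g \<in> V_space q b" for f g
    using that lm(1,2) series_term_summable ne1
    by (simp add: two_series_def series_term_add infsum_add distrib_left)
  have smult: "two_series b l m (to_fract [:c:] * f) = c * two_series b l m f" if "f \<in> V_space q b" for c f
    using that lm(1,2) by (simp add: two_series_def series_term_smult infsum_cmult_right' distrib_left mult.left_commute)
  have J: "rahman_functional q b J \<and> (\<forall>f. f \<notin> V_space q b \<longrightarrow> J f = 0)"
    unfolding rahman_functional_def
    using V_space_add V_space_smult V_gen_in_V_space add smult two_series_V_gen[OF lm]
    by (simp add: J_def generator_scale_def)
  have "rahman_J q b = J"
    unfolding rahman_J_def
  proof (rule the_equality)
    show "rahman_functional q b J \<and> (\<forall>f. f \<notin> V_space q b \<longrightarrow> J f = 0)" by (rule J)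
    fix J' assume J': "rahman_functional q b J' \<and> (\<forall>f. f \<notin> V_space q b \<longrightarrow> J' f = 0)"
    show "J' = J"
    proof
      fix g show "J' g = J g"
        using J J' rahman_functional_unique[of J' J g] by (cases "g \<in> V_space q b") auto
    qed
  qed
  then show ?thesis using f by (simp add: J_def)
qed

end

end

theorem proposition3p3:
  fixes q :: complex and b :: "nat \<Rightarrow> complex" and l m :: complex
    and f :: "complex poly fract"
  assumes "0 < norm q" and "norm q < 1"
    and "(\<Prod>j\<in>{1..6}. b j) = q"
    and "\<And>i j. 1 \<le> i \<Longrightarrow> i < j \<Longrightarrow> j \<le> 6 \<Longrightarrow> b i / b j \<notin> q_powers q"
    and "\<And>i j. 1 \<le> i \<Longrightarrow> i \<le> j \<Longrightarrow> j \<le> 6 \<Longrightarrow> b i * b j \<notin> q_powers q"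
    and "generic q b l m"
    and "f \<in> V_space q b"
  shows "series_term q b f l summable_on UNIV \<and>
         series_term q b f m summable_on UNIV \<and>
         rahman_J q b f =
           prefactor q b l m * (\<Sum>\<^sub>\<infinity>x\<in>UNIV. series_term q b f l x) +
           prefactor q b m l * (\<Sum>\<^sub>\<infinity>x\<in>UNIV. series_term q b f m x)"
proof -
  interpret q_base q using assms(1,2) by unfold_locales
  have b0: "b j \<noteq> 0" if "j \<in> {1..6}" for j
  proof
    assume "b j = 0"
    then have "(\<Prod>j\<in>{1..6}. b j) = 0" using that \<open>b j = 0\<close> by (intro prod_zero bexI[of _ j]) auto
    then show False using assms(3) q_nonzero by metis
  qed
  have "generic_parameters b"
    unfolding generic_parameters_def balanced_def
  proof (intro conjI ballI)
    show "b j \<noteq> 0" if "j \<in> {1..6}" for j using b0[OF that] .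
    show "(\<Prod>j\<in>{1..6}. b j) = q" by (rule assms(3))
    fix i j :: nat assume ij: "i \<in> {1..6}" "j \<in> {1..6}"
    show "b i * b j \<notin> q_powers q"
      using assms(5)[of i j] assms(5)[of j i] ij by (cases "i \<le> j") (auto simp: mult.commute)
    show "i \<noteq> j \<longrightarrow> b i / b j \<notin> q_powers q"
      using assms(4)[of i j] assms(4)[of j i] ij q_powers_inverse_iff[of "b i / b j"]
      by (cases "i < j") auto
  qed
  note gen = assms(6)[unfolded generic_def]
  have lm0: "l \<noteq> 0" "m \<noteq> 0" using gen by auto
  have lm: "l\<^sup>2 \<notin> q_powers q" "m\<^sup>2 \<notin> q_powers q" "l * m \<notin> q_powers q" "m / l \<notin> q_powers q"
    using gen lm0 by (auto simp: theta_eq_0_iff)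
  have avoid: "regular_point b u" if u: "u \<noteq> 0" "\<And>j k. j \<in> {1..6} \<Longrightarrow> b j * q powi k \<noteq> u \<and> b j * q powi k \<noteq> 1 / u" for u
    unfolding regular_point_def
  proof (intro conjI ballI)
    fix j :: nat assume j: "j \<in> {1..6}"
    show "u * b j \<notin> q_powers q"
    proof
      assume "u * b j \<in> q_powers q"
      then obtain k where "u * b j = q powi k" by (auto simp: q_powers_def)
      then have "b j * q powi (- k) = 1 / u"
        using u(1) b0[OF j] by (simp add: power_int_minus field_simps)
      then show False using u(2)[OF j] by blast
    qed
    show "u / b j \<notin> q_powers q"
    proof
      assume "u / b j \<in> q_powers q"
      then obtain k where "u / b j = q powi k" by (auto simp: q_powers_def)
      then have "b j * q powi k = u" using b0[OF j] by (simp add: field_simps)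
      then show False using u(2)[OF j] by blast
    qed
  qed (rule u(1))
  have "regular_point b l" "regular_point b m" using gen lm0 by (auto intro!: avoid)
  moreover have "l\<^sup>2 \<noteq> 1" "m\<^sup>2 \<noteq> 1" using lm q_power_in_q_powers(3) by metis+
  ultimately show ?thesis
    using series_term_summable[OF \<open>generic_parameters b\<close> assms(7)]
      rahman_J_eq_two_series[OF \<open>generic_parameters b\<close> _ _ lm assms(7)]
    by (simp add: two_series_def)
qed

end
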